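(* Let $n$ be large and let $\delta,\kappa,\sigma,\beta,\beta'>0$ be constants with $\beta=\beta'$, $\kappa>\delta^{-1}$, $\delta^{-1}<\frac{\sigma\delta+\kappa}{2}$, and $$2\sigma>\max(\beta,\beta')+\tfrac{\delta^{-1}}{3\beta}(1+\mathbf{o}(1))+\tfrac{\sigma\delta+\kappa}{3\beta'}(1+\mathbf{o}(1)).$$ Let $d=\delta\left(\frac{\log n}{\log\log n}\right)^{1/3}$ be odd, $B=L_n(\frac13,\beta)$, $B'=L_n(\frac13,\beta')$. Let $m$ be uniformly random among the integers in $\left[2^{-1/d}L_n(\frac23,\delta^{-1}),L_n(\frac23,\delta^{-1})\right]$, and let $f(x,y)=\hat f_{m,n}(x,y)+\sum_{i=0}^{d-1}c_i(x-ym)x^{d-i-1}y^i$, where $\hat f_{m,n}(x,y)=\sum_{i=0}^de_ix^iy^{d-i}$ with $n=\sum_i e_im^i$ the base-$m$ expansion of $n$, and $c_i$ independent uniform in $\mathbb{I}\!\left(2L_n(\frac23,\kappa-\delta^{-1})\right)$. Let $\mathcal{X}_{f,m,n}$ be the set of integer pairs $(a,b)$ with $0\le a<|b|\le\frac12L_n(\frac13,\sigma)$, $a-bm$ $B$-smooth and $f(a,b)$ $B'$-smooth. Then $$\mathbb{E}_{m,f}\big(|\mathcal{X}_{f,m,n}|\big)\ge L_n\!\left(\tfrac13,\tau\right),\qquad \tau=2\sigma-\tfrac{\delta^{-1}}{3\beta}(1+\mathbf{o}(1))-\tfrac{\sigma\delta+\kappa}{3\beta'}(1+\mathbf{o}(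1)).$$
   Context: $L_x(\alpha,c)=\exp\!\big(c(\log x)^{\alpha}(\log\log x)^{1-\alpha}\big)$. $\mathbb{I}(L)=\left[-\frac12L,\frac12L\right)\cap\mathbb{Z}$. An integer is $y$-smooth if all its prime factors are $\le y$. $\mathbf{o}(1)$ denotes a quantity tending to $0$ as $n\to\infty$. *)

theory Defs
  imports "HOL-Analysis.Analysis" "HOL-Computational_Algebra.Primes"
begin

definition Lf :: "real \<Rightarrow> real \<Rightarrow> real \<Rightarrow> real" where
  "Lf x \<alpha> c = exp (c * (ln x) powr \<alpha> * (ln (ln x)) powr (1 - \<alpha>))"

definition Iset :: "real \<Rightarrow> int set" where
  "Iset L = {k. - L / 2 \<le> real_of_int k \<and> real_of_int k < L / 2}"

definition smooth :: "real \<Rightarrow> int \<Rightarrow> bool" where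
  "smooth y k \<longleftrightarrow> k \<noteq> 0 \<and> (\<forall>p::int. prime p \<and> p dvd k \<longrightarrow> real_of_int p \<le> y)"

text \<open>The odd degree d: delta (log n / log log n)^(1/3) rounded to an odd integer
  (the odd integer in [x-1, x+1)).\<close>
definition deg :: "real \<Rightarrow> nat \<Rightarrow> nat" where
  "deg \<delta> n = nat (2 * \<lfloor>\<delta> * (ln (real n) / ln (ln (real n))) powr (1/3) / 2\<rfloor> + 1)"

definition digit :: "nat \<Rightarrow> int \<Rightarrow> nat \<Rightarrow> int" where
  "digit n m i = (int n div m ^ i) mod m"

definition fhat :: "nat \<Rightarrow> int \<Rightarrow> nat \<Rightarrow> int \<Rightarrow> int \<Rightarrow> int" where
  "fhat n m d x y = (\<Sum>i=0..d. digit n m i * x ^ i * y ^ (d - i))"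

definition fpoly :: "nat \<Rightarrow> int \<Rightarrow> nat \<Rightarrow> (nat \<Rightarrow> int) \<Rightarrow> int \<Rightarrow> int \<Rightarrow> int" where
  "fpoly n m d c x y = fhat n m d x y + (\<Sum>i<d. c i * (x - y * m) * x ^ (d - i - 1) * y ^ i)"

definition Xset :: "nat \<Rightarrow> int \<Rightarrow> nat \<Rightarrow> (nat \<Rightarrow> int) \<Rightarrow> real \<Rightarrow> real \<Rightarrow> real \<Rightarrow> (int \<times> int) set" where
  "Xset n m d c \<sigma> \<beta> \<beta>' = {(a, b). 0 \<le> a \<and> a < \<bar>b\<bar> \<and> real_of_int \<bar>b\<bar> \<le> Lf (real n) (1/3) \<sigma> / 2
      \<and> smooth (Lf (real n) (1/3) \<beta>) (a - b * m)
      \<and> smooth (Lf (real n) (1/3) \<beta>') (fpoly n m d c a b)}"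

definition Mset :: "nat \<Rightarrow> real \<Rightarrow> nat \<Rightarrow> int set" where
  "Mset n \<delta> d = {m. 2 powr (- 1 / real d) * Lf (real n) (2/3) (1/\<delta>) \<le> real_of_int m
                    \<and> real_of_int m \<le> Lf (real n) (2/3) (1/\<delta>)}"

definition Cset :: "nat \<Rightarrow> real \<Rightarrow> real \<Rightarrow> nat \<Rightarrow> (nat \<Rightarrow> int) set" where
  "Cset n \<delta> \<kappa> d = PiE {..<d} (\<lambda>_. Iset (2 * Lf (real n) (2/3) (\<kappa> - 1/\<delta>)))"

definition expectX :: "nat \<Rightarrow> real \<Rightarrow> real \<Rightarrow> real \<Rightarrow> real \<Rightarrow> real \<Rightarrow> real" where
  "expectX n \<delta> \<kappa> \<sigma> \<beta> \<beta>' =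
     (let d = deg \<delta> n; M = Mset n \<delta> d; C = Cset n \<delta> \<kappa> d in
      (\<Sum>m\<in>M. \<Sum>c\<in>C. real (card (Xset n m d c \<sigma> \<beta> \<beta>'))) / (real (card M) * real (card C)))"

end

theory Submission
  imports Defs "HOL-Number_Theory.Cong" "HOL-Real_Asymp.Real_Asymp"
begin

text \<open>
  Write \<open>k = b m - a\<close>. For fixed \<open>b\<close> the pair \<open>(m, a)\<close> is determined by \<open>k\<close>, so averaging over
  \<open>m\<close> and counting \<open>a\<close> amounts to counting smooth integers \<open>k\<close> in an interval, without any
  congruence condition. For fixed \<open>(m, a, b)\<close> the value of the random polynomial is \<open>r - k t\<close>,
  where \<open>r\<close> is the value of the base-\<open>m\<close> polynomial and \<open>t = (\<Sum>i. c i * a ^ (d - i - 1) * b ^ i)\<close>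
  is nearly equidistributed because \<open>gcd a b = 1\<close>. It remains to find many smooth \<open>s\<close> in the residue
  class of \<open>r\<close> modulo \<open>k\<close>.

  The moduli \<open>k\<close> and the numbers \<open>s\<close> are taken to be products of primes, one from each of a sequence
  of disjoint intervals near the smoothness bound \<open>y = L(1/3, \<beta>)\<close>. A product of \<open>u\<close> such primes costs only a
  factor \<open>(log y) ^ u\<close>, which for this \<open>y\<close> is \<open>u ^ u\<close> up to a factor \<open>L(1/3, o(1))\<close>, so these products
  are essentially as dense as all smooth numbers. As \<open>k\<close> has no small divisors except 1, and the products
  \<open>s\<close> factor at every scale, the large sieve applied to two factors of \<open>s\<close> of suitable size shows that
  for almost all \<open>k\<close> the numbers \<open>s\<close> are equidistributed modulo \<open>k\<close>. The hypothesis
  \<open>1/\<delta> < (\<sigma> \<delta> + \<kappa>) / 2\<close> is what lets both factors be longer than \<open>k\<close>.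
\<close>


section \<open>An additive large sieve\<close>

text \<open>The exponent is a count of primes. Put t = (log n / loglog n)^(1/3), so that log y is
  \<beta> t loglog n. Then k consists of about t / (\<delta> \<beta>) primes and s of about t
  (\<sigma> \<delta> + \<kappa>) / \<beta>, and each prime costs about log y = exp((1/3 + o(1))
  loglog n). These two counts are the two subtracted terms of \<tau>. All other losses must be
  exp(o(t loglog n)): constants to the power d or to the number of primes are harmless, a constant
  to the power of their product is not.

  The obstacle is that the residue r of the polynomial value modulo k depends on k, b and m in an
  uncontrolled way. Equidistribution is therefore needed for all residues at once, outside a set of
  moduli that does not depend on r. This is why s is split into factors: Ramanujan sums do not
  change when their argument is multiplied by a unit, so r disappears from the error after
  Cauchy-Schwarz, and the large sieve averages a quantity depending on k alone.\<close>

definition ee :: "real \<Rightarrow> complex" where "ee x = cis (2 * pi * x)"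

lemma ee_add: "ee (x + y) = ee x * ee y"
  by (simp add: ee_def cis_mult algebra_simps)

lemma ee_minus: "ee (- x) = cnj (ee x)"
  by (simp add: ee_def cis_cnj)

lemma ee_diff: "ee (t * (x - y)) = ee (t * x) * cnj (ee (t * y))"
  by (simp add: right_diff_distrib flip: ee_minus ee_add)

lemma norm_ee [simp]: "norm (ee x) = 1"
  by (simp add: ee_def)

lemma ee_int [simp]: "ee (of_int k) = 1"
  unfolding ee_def using cis_multiple_2pi[of "of_int k"] by simp

lemma ee_frac: "ee (of_int z * frac x) = ee (of_int z * x)"
proof -
  have "of_int z * x = of_int z * frac x + of_int (z * \<lfloor>x\<rfloor>)"
    by (simp add: frac_def algebra_simps)
  then show ?thesis by (simp only: ee_add ee_int mult_1_right)
qed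

lemma ee_power: "ee x ^ n = ee (real n * x)"
  by (simp add: ee_def Complex.DeMoivre ac_simps)

text \<open>The shape \<open>x * (1 - x)\<close> is chosen because its reciprocal splits as 1/x +
  1/(1 - x), two terms that the kernel estimate sums separately. It follows from the cubic Taylor
  bound on (0, 1/2] and the symmetry between x and 1 - x.\<close>

lemma sin_pi_ge: assumes "0 < x" "x < 1" shows "sin (pi * x) \<ge> x * (1 - x)"
proof -
  have *: "sin (pi * x) \<ge> x * (1 - x)" if "0 < x" "x \<le> 1/2" for x :: real
  proof -
    define w where "w = pi * x"
    have w: "2 * x \<le> w" "w \<le> 2" "0 < w"
      using that pi_less_4 mult_mono[of pi 4 x "1/2"] pi_ge_two by (auto simp: w_def)
    have "\<bar>sin w - (\<Sum>m<3. sin_coeff m * w ^ m)\<bar> \<le> inverse (fact 3) * \<bar>w\<bar> ^ 3"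
      by (rule Maclaurin_sin_bound)
    then have "sin w \<ge> w - w ^ 3 / 6"
      using w by (simp add: numeral_3_eq_3 sin_coeff_def field_simps abs_if split: if_splits)
    also have "w - w^3/6 = w * (1 - w^2/6)" by (simp add: algebra_simps power3_eq_cube power2_eq_square)
    finally have 1: "sin w \<ge> w * (1 - w^2/6)" .
    show ?thesis
    \<comment> \<open>Up to 3/2 the Taylor bound gives sin w >= w/2 >= x; beyond that, w <= 2 still
      gives sin w >= 1/2, an upper bound for x (1 - x).\<close>
    proof (cases "w \<le> 3/2")
      case True
      have "w^2 \<le> (3/2)^2" using True w by (intro power_mono) auto
      then have "w * (1 - w^2/6) \<ge> w * (1/2)" using w by (intro mult_left_mono) (auto simp: power2_eq_square)
      with 1 w have "sin w \<ge> x" by linarith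
      moreover have "x * (1-x) \<le> x * 1" using that by (intro mult_left_mono) auto
      ultimately show ?thesis by (simp add: w_def)
    next
      case False
      have "w^2 \<le> 2^2" using w by (intro power_mono) auto
      then have "w * (1 - w^2/6) \<ge> (3/2) * (1/3)" using False by (intro mult_mono) auto
      moreover have "x * (1-x) \<le> (1/2) * 1" using that by (intro mult_mono) auto
      ultimately show ?thesis using 1 by (simp add: w_def)
    qed
  qed
  show ?thesis
  proof (cases "x \<le> 1/2")
    case True then show ?thesis using * assms by blast
  next
    case False
    have "sin (pi * (1 - x)) = sin (pi * x)" by (simp add: right_diff_distrib sin_diff)
    then show ?thesis using *[of "1 - x"] False assms by (simp add: mult.commute)
  qed
qed

lemma norm_geometric_ee_le:
  assumes "0 < x" "x < 1"
  shows "norm (\<Sum>n<N. ee (real n * x)) \<le> 1 / x + 1 / (1 - x)"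
proof -
  let ?z = "ee x"
  have n2: "norm (1 - ?z)^2 = (2 * sin (pi * x))^2"
  proof -
    have c: "cos (2 * (pi * x)) = 1 - 2 * sin (pi * x)^2" by (simp add: cos_double_sin)
    have "norm (1 - ?z)^2 = (1 - cos (2*(pi*x)))^2 + sin (2*(pi*x))^2"
      by (simp add: ee_def cmod_power2 mult.assoc)
    also have "\<dots> = 2 - 2 * cos (2*(pi*x))"
      using sin_cos_squared_add[of "2*(pi*x)"] by (simp add: power2_eq_square algebra_simps)
    finally show ?thesis by (simp add: c power2_eq_square)
  qed
  have s: "sin (pi * x) \<ge> x * (1 - x)" "x * (1 - x) > 0" using sin_pi_ge assms by auto
  then have nz: "norm (1 - ?z) = 2 * sin (pi * x)"
    by (intro power2_eq_imp_eq[OF n2]) auto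
  have "?z \<noteq> 1" using nz s by auto
  have "(\<Sum>n<N. ee (real n * x)) = (\<Sum>n<N. ?z ^ n)" by (simp add: ee_power)
  also have "\<dots> = (1 - ?z ^ N) / (1 - ?z)" using \<open>?z \<noteq> 1\<close> by (simp add: sum_gp_strict)
  also have "norm \<dots> \<le> 2 / (2 * sin (pi * x))"
  proof -
    have "norm (1 - ?z ^ N) \<le> 2"
      using norm_triangle_ineq4[of 1 "?z^N"] by (simp add: norm_power)
    then show ?thesis unfolding norm_divide nz using s by (intro divide_right_mono) auto
  qed
  also have "\<dots> \<le> 1 / (x * (1 - x))" using s by (simp add: frac_le)
  also have "\<dots> = 1 / x + 1 / (1 - x)" using assms by (simp add: field_simps)
  finally show ?thesis .
qed

text \<open>Rounding \<open>G * x\<close> down sends the spaced points to distinct integers in 1..G,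
  so a harmonic number appears.\<close>

lemma sum_inverse_spaced_le:
  fixes P :: "real set" and G :: nat
  assumes "finite P" "G > 0" and pos: "\<And>x. x \<in> P \<Longrightarrow> 1 / real G \<le> x \<and> x \<le> 1"
    and gap: "\<And>x y. x \<in> P \<Longrightarrow> y \<in> P \<Longrightarrow> x \<noteq> y \<Longrightarrow> 1 / real G \<le> \<bar>x - y\<bar>"
  shows "(\<Sum>x\<in>P. 1 / x) \<le> real G * harm G"
proof -
  define j where "j x = nat \<lfloor>real G * x\<rfloor>" for x
  have G: "real G > 0" using assms by simp
  have jr: "real (j x) = of_int \<lfloor>real G * x\<rfloor>" "1 \<le> j x" "j x \<le> G" if "x \<in> P" for x
  proof -
    have a: "1 \<le> real G * x" "real G * x \<le> real G"
      using pos[OF that] G by (auto simp: field_simps)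
    then have b: "1 \<le> \<lfloor>real G * x\<rfloor>" by simp
    have c: "\<lfloor>real G * x\<rfloor> \<le> int G" using a by linarith
    show "real (j x) = of_int \<lfloor>real G * x\<rfloor>" "1 \<le> j x" "j x \<le> G" using b c unfolding j_def by linarith+
  qed
  have inj: "inj_on j P"
  proof (rule inj_onI, rule ccontr)
    fix x y assume xy: "x \<in> P" "y \<in> P" "j x = j y" "x \<noteq> y"
    have "\<lfloor>real G * x\<rfloor> = \<lfloor>real G * y\<rfloor>" using jr(1)[OF xy(1)] jr(1)[OF xy(2)] xy(3) by simp
    then have "\<bar>real G * x - real G * y\<bar> < 1" by linarith
    moreover have "1 \<le> \<bar>real G * x - real G * y\<bar>"
    proof -
      have "\<bar>real G * x - real G * y\<bar> = real G * \<bar>x - y\<bar>" by (simp add: abs_mult flip: right_diff_distrib)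
      then show ?thesis using gap[OF xy(1,2,4)] G by (simp add: field_simps)
    qed
    ultimately show False by simp
  qed
  have "(\<Sum>x\<in>P. 1 / x) \<le> (\<Sum>x\<in>P. real G * inverse (real (j x)))"
  proof (rule sum_mono)
    fix x assume x: "x \<in> P"
    have "x > 0" using pos[OF x] G by (smt (verit) divide_pos_pos)
    have "real (j x) \<le> real G * x" using jr(1)[OF x] of_int_floor_le[of "real G * x"] by simp
    moreover have "real (j x) > 0" using jr(2)[OF x] by simp
    ultimately show "1 / x \<le> real G * inverse (real (j x))"
      using \<open>x > 0\<close> by (simp add: field_simps)
  qed
  also have "\<dots> = real G * (\<Sum>i\<in>j ` P. inverse (real i))"
    by (simp add: sum_distrib_left sum.reindex[OF inj] o_def)
  also have "\<dots> \<le> real G * harm G"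
    unfolding harm_def using jr assms(1)
    by (intro mult_left_mono sum_mono2) auto
  finally show ?thesis .
qed

text \<open>A row sum of the Dirichlet kernel matrix. The diagonal gives N; the points on each side
  of x give two harmonic sums, one for the distance to x and one for the distance around the circle,
  hence the factor 4.\<close>

lemma sum_kernel_le:
  fixes R :: "real set" and G :: nat
  assumes "finite R" "G > 0" and sub: "R \<subseteq> {0..<1}" and x: "x \<in> R"
    and gap: "\<And>x y. x \<in> R \<Longrightarrow> y \<in> R \<Longrightarrow> x \<noteq> y \<Longrightarrow> 1 / real G \<le> \<bar>x - y\<bar> \<and> 1 / real G \<le> 1 - \<bar>x - y\<bar>"
  shows "(\<Sum>y\<in>R. norm (\<Sum>n<N. ee (real n * (x - y)))) \<le> real N + 4 * real G * harm G"
proof -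
  define L where "L = {y \<in> R. y < x}"
  define U where "U = {y \<in> R. y > x}"
  have fin: "finite L" "finite U" using assms(1) by (auto simp: L_def U_def)
  have R: "R = insert x (L \<union> U)" using x by (auto simp: L_def U_def)
  have e: "(\<Sum>y\<in>R. norm (\<Sum>n<N. ee (real n * (x - y)))) = real N
     + (\<Sum>y\<in>L. norm (\<Sum>n<N. ee (real n * (x - y)))) + (\<Sum>y\<in>U. norm (\<Sum>n<N. ee (real n * (x - y))))"
  proof -
    have "L \<inter> U = {}" "x \<notin> L \<union> U" by (auto simp: L_def U_def)
    moreover have "ee 0 = 1" using ee_int[of 0] by simp
    ultimately show ?thesis unfolding R using fin by (simp add: sum.union_disjoint)
  qed
  have bnd: "(\<Sum>y\<in>Q. 1 / f y) \<le> real G * harm G"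
    if "finite Q" "Q \<subseteq> R" "inj_on f Q" "\<And>y. y \<in> Q \<Longrightarrow> 1 / real G \<le> f y \<and> f y \<le> 1"
      "\<And>y z. \<bar>f y - f z\<bar> = \<bar>y - z\<bar>" for Q and f :: "real \<Rightarrow> real"
  proof -
    have "(\<Sum>y\<in>Q. 1 / f y) = (\<Sum>w\<in>f ` Q. 1 / w)" by (simp add: sum.reindex[OF that(3)])
    also have "\<dots> \<le> real G * harm G"
      using that gap assms(2) by (intro sum_inverse_spaced_le) (auto, blast)
    finally show ?thesis .
  qed
  have range: "0 \<le> y" "y < 1" if "y \<in> R" for y using sub that by auto
  have K: "norm (\<Sum>n<N. ee (real n * (x - y))) \<le> 1 / (x - y) + 1 / (1 - x + y)" if "y \<in> L" for y
    using that range[of y] range[OF x] norm_geometric_ee_le[of "x - y" N] by (auto simp: L_def algebra_simps)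
  have K': "norm (\<Sum>n<N. ee (real n * (x - y))) \<le> 1 / (y - x) + 1 / (1 - y + x)" if "y \<in> U" for y
  proof -
    have "(\<Sum>n<N. ee (real n * (x - y))) = cnj (\<Sum>n<N. ee (real n * (y - x)))"
      by (simp add: ee_diff mult.commute)
    then have "norm (\<Sum>n<N. ee (real n * (x - y))) = norm (\<Sum>n<N. ee (real n * (y - x)))"
      by (metis complex_mod_cnj)
    then show ?thesis using that range[of y] range[OF x] norm_geometric_ee_le[of "y - x" N]
      by (auto simp: U_def algebra_simps)
  qed
  have "(\<Sum>y\<in>L. norm (\<Sum>n<N. ee (real n * (x - y)))) \<le> (\<Sum>y\<in>L. 1 / (x - y)) + (\<Sum>y\<in>L. 1 / (1 - x + y))"
    unfolding sum.distrib[symmetric] by (intro sum_mono K)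
  also have "\<dots> \<le> real G * harm G + real G * harm G"
    using fin gap[OF x] range range[OF x]
    by (intro add_mono bnd) (fastforce simp: L_def inj_on_def)+
  finally have 1: "(\<Sum>y\<in>L. norm (\<Sum>n<N. ee (real n * (x - y)))) \<le> 2 * (real G * harm G)" by linarith
  have "(\<Sum>y\<in>U. norm (\<Sum>n<N. ee (real n * (x - y)))) \<le> (\<Sum>y\<in>U. 1 / (y - x)) + (\<Sum>y\<in>U. 1 / (1 - y + x))"
    unfolding sum.distrib[symmetric] by (intro sum_mono K')
  also have "\<dots> \<le> real G * harm G + real G * harm G"
    using fin gap[OF x] range range[OF x]
    by (intro add_mono bnd) (fastforce simp: U_def inj_on_def)+
  finally have 2: "(\<Sum>y\<in>U. norm (\<Sum>n<N. ee (real n * (x - y)))) \<le> 2 * (real G * harm G)" by linarith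
  show ?thesis using e 1 2 by simp
qed

text \<open>Expanding the square gives a Hermitian form in the kernel. Bounding |b x| |b y| by half
  the sum of squares and using the symmetry of the kernel's modulus reduces it to row sums (Schur's
  test).\<close>

lemma large_sieve_dual:
  fixes R :: "real set" and G :: nat and b :: "real \<Rightarrow> complex"
  assumes "finite R" "G > 0" "R \<subseteq> {0..<1}"
    and "\<And>x y. x \<in> R \<Longrightarrow> y \<in> R \<Longrightarrow> x \<noteq> y \<Longrightarrow> 1 / real G \<le> \<bar>x - y\<bar> \<and> 1 / real G \<le> 1 - \<bar>x - y\<bar>"
  shows "(\<Sum>n<N. norm (\<Sum>x\<in>R. b x * ee (real n * x)) ^ 2)
    \<le> (real N + 4 * real G * harm G) * (\<Sum>x\<in>R. norm (b x) ^ 2)"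
proof -
  let ?K = "\<lambda>x y. (\<Sum>n<N. ee (real n * (x - y)))"
  let ?D = "real N + 4 * real G * harm G"
  have "complex_of_real (\<Sum>n<N. norm (\<Sum>x\<in>R. b x * ee (real n * x)) ^ 2)
     = (\<Sum>n<N. (\<Sum>x\<in>R. b x * ee (real n * x)) * cnj (\<Sum>x\<in>R. b x * ee (real n * x)))"
    by (simp only: of_real_sum complex_norm_square)
  also have "\<dots> = (\<Sum>n<N. \<Sum>x\<in>R. \<Sum>y\<in>R. b x * cnj (b y) * ee (real n * (x - y)))"
    unfolding cnj_sum sum_product ee_diff by (intro sum.cong refl) simp
  also have "\<dots> = (\<Sum>x\<in>R. \<Sum>y\<in>R. b x * cnj (b y) * ?K x y)"
    by (subst sum.swap, intro sum.cong refl, subst sum.swap) (simp add: sum_distrib_left)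
  finally have *: "complex_of_real (\<Sum>n<N. norm (\<Sum>x\<in>R. b x * ee (real n * x)) ^ 2)
      = (\<Sum>x\<in>R. \<Sum>y\<in>R. b x * cnj (b y) * ?K x y)" .
  have "(\<Sum>n<N. norm (\<Sum>x\<in>R. b x * ee (real n * x)) ^ 2)
      = norm (complex_of_real (\<Sum>n<N. norm (\<Sum>x\<in>R. b x * ee (real n * x)) ^ 2))"
    unfolding norm_of_real by (intro abs_of_nonneg[symmetric] sum_nonneg) simp
  also have "\<dots> = norm (\<Sum>x\<in>R. \<Sum>y\<in>R. b x * cnj (b y) * ?K x y)"
    by (simp only: *)
  also have "\<dots> \<le> (\<Sum>x\<in>R. \<Sum>y\<in>R. norm (b x) * norm (b y) * norm (?K x y))"
    by (rule order_trans[OF norm_sum], rule sum_mono, rule order_trans[OF norm_sum]) (simp add: norm_mult)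
  also have "\<dots> \<le> (\<Sum>x\<in>R. \<Sum>y\<in>R. (norm (b x)^2 / 2 + norm (b y)^2 / 2) * norm (?K x y))"
  proof (intro sum_mono mult_right_mono)
    fix x y show "norm (b x) * norm (b y) \<le> norm (b x)^2 / 2 + norm (b y)^2 / 2"
      using sum_squares_bound[of "norm (b x)" "norm (b y)"] by (simp add: power2_eq_square)
  qed auto
  also have "\<dots> = (\<Sum>x\<in>R. \<Sum>y\<in>R. norm (b x)^2 / 2 * norm (?K x y)) + (\<Sum>x\<in>R. \<Sum>y\<in>R. norm (b y)^2 / 2 * norm (?K x y))"
    by (simp add: distrib_right sum.distrib)
  also have "(\<Sum>x\<in>R. \<Sum>y\<in>R. norm (b y)^2 / 2 * norm (?K x y)) = (\<Sum>x\<in>R. \<Sum>y\<in>R. norm (b x)^2 / 2 * norm (?K x y))"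
  proof (subst sum.swap, intro sum.cong refl)
    fix x y 
    have "?K x y = cnj (?K y x)"
      by (simp add: ee_diff mult.commute)
    then have "norm (?K x y) = norm (?K y x)" by (metis complex_mod_cnj)
    then show "norm (b x)^2 / 2 * norm (?K y x) = norm (b x)^2 / 2 * norm (?K x y)" by simp
  qed
  also have "(\<Sum>x\<in>R. \<Sum>y\<in>R. norm (b x)^2 / 2 * norm (?K x y)) + (\<Sum>x\<in>R. \<Sum>y\<in>R. norm (b x)^2 / 2 * norm (?K x y))
     = (\<Sum>x\<in>R. norm (b x)^2 * (\<Sum>y\<in>R. norm (?K x y)))"
    by (simp add: sum_distrib_left flip: sum.distrib)
  also have "\<dots> \<le> (\<Sum>x\<in>R. norm (b x)^2 * ?D)"
    by (intro sum_mono mult_left_mono sum_kernel_le assms) auto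
  also have "\<dots> = ?D * (\<Sum>x\<in>R. norm (b x) ^ 2)"
    by (simp only: sum_distrib_right[symmetric] mult.commute)
  finally show ?thesis .
qed

text \<open>Duality: Cauchy-Schwarz over S and the dual inequality with coefficients
  \<open>cnj (f x)\<close> bound V^2 by a multiple of V. The logarithm \<open>harm G\<close> lost
  against the sharp constant is later absorbed by \<open>\<Lambda>\<close>.\<close>

lemma large_sieve:
  fixes R :: "real set" and G :: nat and S :: "nat set"
  assumes "finite R" "G > 0" "R \<subseteq> {0..<1}" "S \<subseteq> {..<N}"
    and "\<And>x y. x \<in> R \<Longrightarrow> y \<in> R \<Longrightarrow> x \<noteq> y \<Longrightarrow> 1 / real G \<le> \<bar>x - y\<bar> \<and> 1 / real G \<le> 1 - \<bar>x - y\<bar>"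
  shows "(\<Sum>x\<in>R. norm (\<Sum>s\<in>S. ee (real s * x)) ^ 2)
    \<le> (real N + 4 * real G * harm G) * real (card S)"
proof -
  let ?D = "real N + 4 * real G * harm G"
  define f where "f x = (\<Sum>s\<in>S. ee (real s * x))" for x
  define V where "V = (\<Sum>x\<in>R. norm (f x) ^ 2)"
  have V0: "V \<ge> 0" by (auto simp: V_def intro: sum_nonneg)
  have finS: "finite S" using assms(4) finite_subset by blast
  have "complex_of_real V = (\<Sum>x\<in>R. cnj (f x) * (\<Sum>s\<in>S. ee (real s * x)))"
    unfolding V_def of_real_sum complex_norm_square f_def by (simp only: mult.commute)
  also have "\<dots> = (\<Sum>s\<in>S. \<Sum>x\<in>R. cnj (f x) * ee (real s * x))"
    unfolding sum_distrib_left by (rule sum.swap)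
  finally have "V = norm (\<Sum>s\<in>S. \<Sum>x\<in>R. cnj (f x) * ee (real s * x))"
    using V0 by (metis abs_of_nonneg norm_of_real)
  also have "\<dots> \<le> (\<Sum>s\<in>S. norm (\<Sum>x\<in>R. cnj (f x) * ee (real s * x)) * 1)"
    by (simp add: norm_sum)
  finally have "V^2 \<le> (\<Sum>s\<in>S. norm (\<Sum>x\<in>R. cnj (f x) * ee (real s * x)) * 1)^2"
    using V0 by (intro power_mono)
  also have "\<dots> \<le> (\<Sum>s\<in>S. norm (\<Sum>x\<in>R. cnj (f x) * ee (real s * x))^2) * (\<Sum>s\<in>S. 1^2)"
    by (rule Cauchy_Schwarz_ineq_sum)
  also have "\<dots> \<le> (\<Sum>s<N. norm (\<Sum>x\<in>R. cnj (f x) * ee (real s * x))^2) * real (card S)"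
    using assms(4) by (auto intro!: mult_mono sum_mono2 sum_nonneg)
  also have "\<dots> \<le> (?D * (\<Sum>x\<in>R. norm (cnj (f x))^2)) * real (card S)"
    using assms by (intro mult_right_mono large_sieve_dual) auto
  also have "\<dots> = ?D * V * real (card S)" by (simp add: V_def)
  finally have *: "V * V \<le> (?D * real (card S)) * V" by (simp add: power2_eq_square algebra_simps)
  have D0: "?D \<ge> 0" by (simp add: harm_nonneg)
  have "V \<le> ?D * real (card S)"
  proof (cases "V = 0")
    case False
    then show ?thesis using * V0 by (simp add: mult_le_cancel_right)
  qed (use D0 in simp)
  then show ?thesis by (simp add: V_def f_def)
qed

section \<open>Ramanujan sums and moduli composed of distinct primes\<close>

text \<open>For a set \<open>D\<close> of primes, \<open>ramsum D\<close> is the Ramanujan sum of the squarefree modulus \<open>\<Prod>D\<close>;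
  \<open>fracpt D a\<close> runs modulo 1 through the reduced fractions with that denominator, and
  \<open>sieve_form D S\<close> is the corresponding term \<open>\<Sum>|\<Sum>s\<in>S. e(s \<alpha>)|\<^sup>2\<close> of the large sieve.\<close>

definition ramsum :: "nat set \<Rightarrow> int \<Rightarrow> real" where
  "ramsum D z = (\<Prod>p\<in>D. if int p dvd z then real p - 1 else - 1)"

definition numerators :: "nat set \<Rightarrow> (nat \<Rightarrow> nat) set" where
  "numerators D = PiE D (\<lambda>p. {1..<p})"

definition fracpt :: "nat set \<Rightarrow> (nat \<Rightarrow> nat) \<Rightarrow> real" where
  "fracpt D a = (\<Sum>p\<in>D. real (a p) / real p)"

definition sieve_form :: "nat set \<Rightarrow> nat set \<Rightarrow> real" where
  "sieve_form D S = (\<Sum>s\<in>S. \<Sum>s'\<in>S. ramsum D (int s - int s'))"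

lemma ee_sum: "ee (\<Sum>x\<in>A. f x) = (\<Prod>x\<in>A. ee (f x))"
proof (induction A rule: infinite_finite_induct)
  case (insert x A) then show ?case by (simp add: ee_add)
qed (use ee_int[of 0] in auto)

lemma sum_ee_complete:
  assumes "p > 0"
  shows "(\<Sum>a\<in>{1..<p}. ee (of_int z * (real a / real p))) = (if int p dvd z then of_nat p - 1 else - 1)"
proof -
  let ?w = "ee (of_int z / real p)"
  have pw: "ee (of_int z * (real a / real p)) = ?w ^ a" for a
    by (simp add: ee_power mult.commute)
  have split: "(\<Sum>a<p. ?w ^ a) = 1 + (\<Sum>a\<in>{1..<p}. ?w ^ a)"
    using assms by (simp add: lessThan_atLeast0 sum.atLeast_Suc_lessThan)
  have "?w ^ p = ee (of_int z)" using assms by (simp add: ee_power)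
  then have wp: "?w ^ p = 1" by simp
  have "(\<Sum>a<p. ?w ^ a) = (if int p dvd z then of_nat p else 0)"
  proof (cases "int p dvd z")
    case True
    then obtain k where "z = int p * k" by blast
    then have "?w = ee (of_int k)" using assms by simp
    then show ?thesis using True by simp
  next
    case False
    have "?w \<noteq> 1"
    proof
      assume "?w = 1"
      then have "cos (2 * pi * (of_int z / real p)) = 1" by (simp add: ee_def complex_eq_iff)
      then obtain k :: int where k: "2 * pi * (of_int z / real p) = of_int k * (2 * pi)"
        by (auto simp: cos_one_2pi_int)
      then have "2 * pi * (of_int z / real p) = 2 * pi * of_int k" by (simp only: mult.commute)
      then have "of_int z / real p = of_int k" by (subst (asm) mult_cancel_left) simp
      then have "of_int z = (of_int (k * int p) :: real)" using assms by (simp add: field_simps)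
      then have "z = k * int p" by (simp only: of_int_eq_iff)
      then show False using False by simp
    qed
    then show ?thesis using False wp by (simp add: sum_gp_strict)
  qed
  then show ?thesis unfolding pw using split by (auto simp: algebra_simps add_eq_0_iff)
qed

text \<open>Expanding the product over the primes is the Chinese remainder theorem: one nonzero
  numerator for each prime amounts to one reduced fraction modulo 1.\<close>

lemma ramsum_ee:
  assumes "finite D" "\<And>p. p \<in> D \<Longrightarrow> p > 0"
  shows "complex_of_real (ramsum D z) = (\<Sum>a\<in>numerators D. ee (of_int z * fracpt D a))"
proof -
  have "complex_of_real (ramsum D z) = (\<Prod>p\<in>D. \<Sum>a\<in>{1..<p}. ee (of_int z * (real a / real p)))"
    unfolding ramsum_def of_real_prod
  proof (intro prod.cong refl)
    fix p assume "p \<in> D"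
    then show "complex_of_real (if int p dvd z then real p - 1 else - 1)
        = (\<Sum>a\<in>{1..<p}. ee (of_int z * (real a / real p)))"
      using sum_ee_complete[OF assms(2), of p z] by simp
  qed
  also have "\<dots> = (\<Sum>a\<in>numerators D. \<Prod>p\<in>D. ee (of_int z * (real (a p) / real p)))"
    unfolding numerators_def using assms by (subst prod_sum_PiE) auto
  also have "\<dots> = (\<Sum>a\<in>numerators D. ee (of_int z * fracpt D a))"
    by (simp add: fracpt_def sum_distrib_left ee_sum)
  finally show ?thesis .
qed

lemma sieve_form_eq_sum_squares:
  assumes "finite D" "\<And>p. p \<in> D \<Longrightarrow> p > 0"
  shows "sieve_form D S = (\<Sum>a\<in>numerators D. norm (\<Sum>s\<in>S. ee (real s * fracpt D a)) ^ 2)"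
proof -
  have "complex_of_real (sieve_form D S) = (\<Sum>s\<in>S. \<Sum>s'\<in>S. \<Sum>a\<in>numerators D. ee (of_int (int s - int s') * fracpt D a))"
    by (simp add: sieve_form_def ramsum_ee assms)
  also have "\<dots> = (\<Sum>a\<in>numerators D. \<Sum>s\<in>S. \<Sum>s'\<in>S. ee (of_int (int s - int s') * fracpt D a))"
    by (subst sum.swap[of _ S]) (subst sum.swap[of _ S], rule refl)
  also have "\<dots> = (\<Sum>a\<in>numerators D. (\<Sum>s\<in>S. ee (real s * fracpt D a)) * cnj (\<Sum>s\<in>S. ee (real s * fracpt D a)))"
    unfolding cnj_sum sum_product
    by (intro sum.cong refl) (simp add: left_diff_distrib flip: ee_minus ee_add)
  also have "\<dots> = complex_of_real (\<Sum>a\<in>numerators D. norm (\<Sum>s\<in>S. ee (real s * fracpt D a)) ^ 2)"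
    by (simp only: of_real_sum complex_norm_square)
  finally show ?thesis by (simp only: of_real_eq_iff)
qed

text \<open>Multiplying by the product P of the other primes makes every term except the one at q
  integral. So q divides \<open>P * b q\<close>, and q does not divide P.\<close>

lemma prime_dvd_if_sum_fractions_int:
  fixes b :: "nat \<Rightarrow> int"
  assumes "finite D" "\<And>p. p \<in> D \<Longrightarrow> prime p" "(\<Sum>p\<in>D. of_int (b p) / real p) \<in> \<int>" "q \<in> D"
  shows "int q dvd b q"
proof -
  have pos: "p > 0" if "p \<in> D" for p using assms(2)[OF that] by (simp add: prime_gt_0_nat)
  define P where "P = \<Prod>(D - {q})"
  have "real P * (\<Sum>p\<in>D. of_int (b p) / real p) \<in> \<int>" using assms(3) by simp
  also have "real P * (\<Sum>p\<in>D. of_int (b p) / real p)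
     = real P * of_int (b q) / real q + (\<Sum>p\<in>D - {q}. real P * of_int (b p) / real p)"
    using assms(1,4) by (simp add: sum.remove distrib_left sum_distrib_left)
  also have "(\<Sum>p\<in>D - {q}. real P * of_int (b p) / real p) = of_int (\<Sum>p\<in>D - {q}. int (P div p) * b p)"
    unfolding of_int_sum
  proof (intro sum.cong refl)
    fix p assume p: "p \<in> D - {q}"
    then have "p dvd P" unfolding P_def using assms(1) by (intro dvd_prodI) auto
    then show "real P * of_int (b p) / real p = of_int (int (P div p) * b p)"
      using pos p by (simp add: real_of_nat_div)
  qed
  finally have "real P * of_int (b q) / real q + of_int (\<Sum>p\<in>D - {q}. int (P div p) * b p)
      - of_int (\<Sum>p\<in>D - {q}. int (P div p) * b p) \<in> \<int>" by (intro Ints_diff Ints_of_int)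
  then have "real P * of_int (b q) / real q \<in> \<int>" by (simp only: add_diff_cancel_right')
  then obtain k :: int where "real P * of_int (b q) / real q = of_int k" by (auto elim: Ints_cases)
  then have "of_int (int P * b q) = (of_int (int q * k) :: real)"
    using pos[OF assms(4)] by (simp add: field_simps)
  then have "int P * b q = int q * k" by (simp only: of_int_eq_iff)
  then have "int q dvd int P * b q" by simp
  moreover have "\<not> int q dvd int P"
  proof
    assume "int q dvd int P"
    then have "q dvd \<Prod>(D - {q})" by (simp only: P_def int_dvd_int_iff)
    then obtain p where "p \<in> D - {q}" "q dvd p"
      using assms(1,2,4) by (auto simp: prime_dvd_prod_iff)
    then show False using assms(2,4) primes_dvd_imp_eq by blast
  qed
  moreover have "prime (int q)" using assms(2,4) by simp
  ultimately show ?thesis using prime_dvd_mult_iff by blast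
qed

lemma fracpt_times_int:
  assumes "finite D" "\<And>p. p \<in> D \<Longrightarrow> p > 0"
  shows "real (\<Prod>D) * fracpt D a \<in> \<int>"
proof -
  have "real (\<Prod>D) * fracpt D a = of_int (\<Sum>p\<in>D. int (\<Prod>D div p) * int (a p))"
    unfolding fracpt_def sum_distrib_left of_int_sum
  proof (intro sum.cong refl)
    fix p assume p: "p \<in> D"
    then have "p dvd \<Prod>D" using assms(1) by (intro dvd_prodI) auto
    then show "real (\<Prod>D) * (real (a p) / real p) = of_int (int (\<Prod>D div p) * int (a p))"
      using assms p by (simp add: real_of_nat_div)
  qed
  then show ?thesis by (simp only: Ints_of_int)
qed

text \<open>The difference is a sum of fractions \<open>c p / p\<close>, so every p divides
  \<open>c p\<close>, while |c p| < p. As numerators start at 1, a prime in only one of D and E is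
  impossible. Fractions of different moduli are thus distinct points for the large sieve.\<close>

lemma fracpt_inject:
  assumes D: "finite D" "\<And>p. p \<in> D \<Longrightarrow> prime p" "a \<in> numerators D"
    and E: "finite E" "\<And>p. p \<in> E \<Longrightarrow> prime p" "b \<in> numerators E"
    and "fracpt D a - fracpt E b \<in> \<int>"
  shows "D = E \<and> a = b"
proof -
  define c where "c p = (if p \<in> D then int (a p) else 0) - (if p \<in> E then int (b p) else 0)" for p
  have "fracpt D a = (\<Sum>p\<in>D \<union> E. (if p \<in> D then real (a p) else 0) / real p)"
    unfolding fracpt_def by (rule sum.mono_neutral_cong_left) (use D E in auto)
  moreover have "fracpt E b = (\<Sum>p\<in>D \<union> E. (if p \<in> E then real (b p) else 0) / real p)"
    unfolding fracpt_def by (rule sum.mono_neutral_cong_left) (use D E in auto)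
  ultimately have "fracpt D a - fracpt E b = (\<Sum>p\<in>D \<union> E. of_int (c p) / real p)"
    by (simp only: sum_subtractf[symmetric]) (auto intro!: sum.cong simp: c_def diff_divide_distrib)
  then have "int p dvd c p" if "p \<in> D \<union> E" for p
    using that D E assms(7) by (intro prime_dvd_if_sum_fractions_int[of "D \<union> E"]) auto
  moreover have ra: "1 \<le> a p" "a p < p" if "p \<in> D" for p using D(3) that by (auto simp: numerators_def PiE_def Pi_def)
  moreover have rb: "1 \<le> b p" "b p < p" if "p \<in> E" for p using E(3) that by (auto simp: numerators_def PiE_def Pi_def)
  have "\<bar>c p\<bar> < int p" if "p \<in> D \<union> E" for p using ra[of p] rb[of p] that by (auto simp: c_def)
  ultimately have c0: "c p = 0" if "p \<in> D \<union> E" for p using that zdvd_not_zless[of "\<bar>c p\<bar>" "int p"] by force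
  have DE: "D = E"
  proof (intro equalityI subsetI)
    fix p assume "p \<in> D" then show "p \<in> E" using c0[of p] ra[of p] by (auto simp: c_def split: if_splits)
  next
    fix p assume "p \<in> E" then show "p \<in> D" using c0[of p] rb[of p] by (auto simp: c_def split: if_splits)
  qed
  have "a = b"
  proof (rule PiE_ext)
    show "a \<in> PiE D (\<lambda>p. {1..<p})" "b \<in> PiE D (\<lambda>p. {1..<p})" using D(3) E(3) DE by (auto simp: numerators_def)
    show "a p = b p" if "p \<in> D" for p using c0[of p] that DE by (auto simp: c_def)
  qed
  with DE show ?thesis by simp
qed

lemma finite_numerators: "finite D \<Longrightarrow> finite (numerators D)"
  by (simp add: numerators_def finite_PiE)

text \<open>Fractions with denominators at most F are separated by 1/F^2 modulo 1, so the large
  sieve with \<open>G = F^2\<close> treats all moduli of the family at once.\<close>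

lemma sum_sieve_form_le:
  assumes "finite \<D>" and D: "\<And>D. D \<in> \<D> \<Longrightarrow> finite D \<and> (\<forall>p\<in>D. prime p) \<and> \<Prod>D \<le> F"
    and "S \<subseteq> {..<N}"
  shows "(\<Sum>D\<in>\<D>. sieve_form D S) \<le> (real N + 4 * real (F^2) * harm (F^2)) * real (card S)"
proof (cases "\<D> = {}")
  case True
  then show ?thesis by (simp add: harm_nonneg)
next
  case False
  have pos: "p > 0" if "D \<in> \<D>" "p \<in> D" for p D using D that by (auto simp: prime_gt_0_nat)
  have pD: "\<Prod>D > 0" if "D \<in> \<D>" for D using pos[OF that] by (simp add: prod_pos)
  then have F: "F > 0" using False D by (metis all_not_in_conv gr0I not_le)
  define Q where "Q = Sigma \<D> numerators"
  define pt where "pt = (\<lambda>(D, a). frac (fracpt D a))"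
  have finQ: "finite Q" unfolding Q_def using assms(1) D by (auto intro: finite_numerators)
  have inj: "inj_on pt Q"
  proof (rule inj_onI)
    fix x y assume xy: "x \<in> Q" "y \<in> Q" "pt x = pt y"
    obtain D1 a where x: "x = (D1, a)" by (cases x)
    obtain E b where y: "y = (E, b)" by (cases y)
    have "fracpt D1 a - fracpt E b = of_int (\<lfloor>fracpt D1 a\<rfloor> - \<lfloor>fracpt E b\<rfloor>)"
      using xy(3) by (simp add: x y pt_def frac_def)
    then have "fracpt D1 a - fracpt E b \<in> \<int>" by (metis Ints_of_int)
    then show "x = y" using xy(1,2) D fracpt_inject[of D1 a E b] by (auto simp: x y Q_def)
  qed
  have gap: "1 / real (F^2) \<le> \<bar>u - w\<bar> \<and> 1 / real (F^2) \<le> 1 - \<bar>u - w\<bar>"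
    if uw: "u \<in> pt ` Q" "w \<in> pt ` Q" "u \<noteq> w" for u w
  proof -
    obtain D1 a E b where u: "u = frac (fracpt D1 a)" "D1 \<in> \<D>" and w: "w = frac (fracpt E b)" "E \<in> \<D>"
      using uw by (auto simp: pt_def Q_def)
    define M where "M = real (\<Prod>D1) * real (\<Prod>E)"
    have M0: "M > 0" unfolding M_def using pD u w by (intro mult_pos_pos) (auto simp del: of_nat_prod)
    have MF: "M \<le> real (F^2)"
    proof -
      have "real (\<Prod>D1) \<le> real F" "real (\<Prod>E) \<le> real F" using D u w by (auto simp del: of_nat_prod)
      then have "M \<le> real F * real F" unfolding M_def by (intro mult_mono) (auto simp del: of_nat_prod)
      then show ?thesis by (simp add: power2_eq_square)
    qed
    have i1: "real (\<Prod>D1) * fracpt D1 a \<in> \<int>" "real (\<Prod>E) * fracpt E b \<in> \<int>"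
      using D u w pos by (auto intro!: fracpt_times_int simp del: of_nat_prod)
    \<comment> \<open>M is a common denominator, so this is a nonzero integer, which gives the
      spacing. The same argument for 1 - |u - w| gives the spacing around the circle.\<close>
    have "M * (u - w) = real (\<Prod>E) * (real (\<Prod>D1) * fracpt D1 a) - real (\<Prod>D1) * (real (\<Prod>E) * fracpt E b)
       - real (\<Prod>D1) * real (\<Prod>E) * of_int (\<lfloor>fracpt D1 a\<rfloor> - \<lfloor>fracpt E b\<rfloor>)"
      unfolding u w M_def frac_def by (simp add: algebra_simps del: of_nat_prod)
    also have "\<dots> \<in> \<int>" by (intro Ints_diff Ints_mult[OF Ints_of_nat i1(1)] Ints_mult[OF Ints_of_nat i1(2)]
          Ints_mult[OF Ints_mult[OF Ints_of_nat Ints_of_nat] Ints_of_int])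
    finally obtain k :: int where k: "M * (u - w) = of_int k" by (auto elim: Ints_cases)
    have "\<bar>of_int k :: real\<bar> = M * \<bar>u - w\<bar>" using M0 by (simp flip: k add: abs_mult)
    then have ak: "of_int \<bar>k\<bar> = M * \<bar>u - w\<bar>" by simp
    have "of_int \<bar>k\<bar> > (0::real)" unfolding ak using M0 uw(3) by simp
    then have g1: "1 \<le> M * \<bar>u - w\<bar>" unfolding ak[symmetric] of_int_0_less_iff by linarith
    obtain m :: int where m: "M = of_int m" unfolding M_def by (metis of_int_of_nat_eq of_nat_mult)
    have "\<bar>u - w\<bar> < 1" using frac_lt_1[of "fracpt D1 a"] frac_ge_0[of "fracpt D1 a"] frac_lt_1[of "fracpt E b"] frac_ge_0[of "fracpt E b"]
      unfolding u w by linarith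
    then have "M * (1 - \<bar>u - w\<bar>) > 0" using M0 by simp
    also have mk: "M * (1 - \<bar>u - w\<bar>) = of_int (m - \<bar>k\<bar>)" using ak m by (simp add: algebra_simps)
    finally have g2: "1 \<le> M * (1 - \<bar>u - w\<bar>)" unfolding mk of_int_0_less_iff by linarith
    have *: "1 / real (F^2) \<le> x" if "1 \<le> M * x" for x
    proof -
      have "x \<ge> 0" using that M0 by (smt (verit) mult_nonneg_nonpos)
      then have "1 \<le> real (F^2) * x" using that MF by (meson mult_right_mono order_trans)
      then show ?thesis using F by (simp add: field_simps)
    qed
    show ?thesis using *[OF g1] *[OF g2] by simp
  qed
  have "(\<Sum>D\<in>\<D>. sieve_form D S) = (\<Sum>D\<in>\<D>. \<Sum>a\<in>numerators D. norm (\<Sum>s\<in>S. ee (real s * fracpt D a)) ^ 2)"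
    using D pos by (intro sum.cong refl sieve_form_eq_sum_squares) auto
  also have "\<dots> = (\<Sum>(D,a)\<in>Q. norm (\<Sum>s\<in>S. ee (real s * fracpt D a)) ^ 2)"
    unfolding Q_def using assms(1) D by (subst sum.Sigma) (auto intro: finite_numerators)
  also have "\<dots> = (\<Sum>z\<in>Q. norm (\<Sum>s\<in>S. ee (real s * pt z)) ^ 2)"
    using ee_frac[of "int _"] by (intro sum.cong refl) (auto simp: pt_def)
  also have "\<dots> = (\<Sum>x\<in>pt ` Q. norm (\<Sum>s\<in>S. ee (real s * x)) ^ 2)"
    by (simp add: sum.reindex[OF inj])
  also have "\<dots> \<le> (real N + 4 * real (F^2) * harm (F^2)) * real (card S)"
  proof (rule large_sieve)
    show "pt ` Q \<subseteq> {0..<1}" by (auto simp: pt_def frac_lt_1)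
  qed (use finQ F assms(3) gap in auto)
  finally show ?thesis .
qed

lemma ramsum_cong:
  assumes "\<And>p. p \<in> D \<Longrightarrow> int p dvd z \<longleftrightarrow> int p dvd z'"
  shows "ramsum D z = ramsum D z'"
  unfolding ramsum_def using assms by (intro prod.cong refl) auto

text \<open>Subsets of D are the divisors of the squarefree modulus; this is the divisor-sum
  identity by which Ramanujan sums detect divisibility.\<close>

lemma sum_ramsum_Pow:
  assumes "finite D"
  shows "(\<Sum>I\<in>Pow D. ramsum I z) = (if \<forall>p\<in>D. int p dvd z then real (\<Prod>D) else 0)"
proof -
  have "(\<Sum>I\<in>Pow D. ramsum I z) = (\<Prod>p\<in>D. (if int p dvd z then real p - 1 else - 1) + 1)"
    unfolding prod_add[OF assms] by (simp add: ramsum_def)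
  also have "\<dots> = (\<Prod>p\<in>D. if int p dvd z then real p else 0)" by (intro prod.cong) auto
  also have "\<dots> = (if \<forall>p\<in>D. int p dvd z then real (\<Prod>D) else 0)"
    using assms by (auto intro!: prod.cong)
  finally show ?thesis .
qed

lemma sieve_form_nonneg:
  assumes "finite D" "\<And>p. p \<in> D \<Longrightarrow> p > 0"
  shows "0 \<le> sieve_form D S"
  using assms by (subst sieve_form_eq_sum_squares) (auto intro: sum_nonneg)

text \<open>\<open>ramsum D\<close> only sees which p in D divide its argument, so units may be
  divided out. Dividing by v * s turns the argument into u - r * w v, which separates the variables;
  Cauchy-Schwarz over the fractions then leaves the forms of S1 and S2 alone. The residue r and the
  individual s drop out of the bound.\<close>

lemma sum_ramsum_product_le:
  assumes fin: "finite D" and D: "\<And>p. p \<in> D \<Longrightarrow> prime p"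
    and cop: "\<And>p s. p \<in> D \<Longrightarrow> s \<in> S1 \<union> S2 \<union> S3 \<Longrightarrow> \<not> p dvd s"
    and r: "\<And>p. p \<in> D \<Longrightarrow> \<not> int p dvd r"
  shows "\<bar>\<Sum>s\<in>S3. \<Sum>u\<in>S1. \<Sum>v\<in>S2. ramsum D (int (u * v * s) - r)\<bar>
    \<le> real (card S3) * sqrt (sieve_form D S1 * sieve_form D S2)"
proof -
  have pos: "p > 0" if "p \<in> D" for p using D[OF that] by (simp add: prime_gt_0_nat)
  have Dint: "prime (int p)" if "p \<in> D" for p using D[OF that] by simp
  have inner: "\<bar>\<Sum>u\<in>S1. \<Sum>v\<in>S2. ramsum D (int (u * v * s) - r)\<bar>
      \<le> sqrt (sieve_form D S1 * sieve_form D S2)" if s: "s \<in> S3" for s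
  proof -
    have "\<exists>w. \<forall>p\<in>D. int p dvd int v * int s * w - 1" if v: "v \<in> S2" for v
    proof -
      have "coprime (int p) (int v * int s)" if "p \<in> D" for p
        using cop[OF that] Dint[OF that] v s
        by (auto intro!: prime_imp_coprime simp: prime_dvd_mult_iff)
      then have "coprime (int v * int s) (\<Prod>p\<in>D. int p)"
        by (intro prod_coprime_right) (simp add: coprime_commute)
      then obtain w where "[int v * int s * w = 1] (mod (\<Prod>p\<in>D. int p))"
        using cong_solve_coprime_int by blast
      then have "(\<Prod>p\<in>D. int p) dvd int v * int s * w - 1" by (simp add: cong_iff_dvd_diff)
      moreover have "int p dvd (\<Prod>p\<in>D. int p)" if "p \<in> D" for p using fin that by (intro dvd_prodI) auto
      ultimately show ?thesis by (meson dvd_trans)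
    qed
    then obtain w where w: "\<And>v p. v \<in> S2 \<Longrightarrow> p \<in> D \<Longrightarrow> int p dvd int v * int s * w v - 1"
      by metis
    have e1: "ramsum D (int (u * v * s) - r) = ramsum D (int u - r * w v)" if v: "v \<in> S2" for u v
    proof (rule ramsum_cong)
      fix p assume p: "p \<in> D"
      have nd: "\<not> int p dvd int v * int s"
        using cop[OF p] v s Dint[OF p] by (auto simp: prime_dvd_mult_iff)
      have "int (u * v * s) - r = int v * int s * (int u - r * w v) + r * (int v * int s * w v - 1)"
        by (simp add: algebra_simps)
      then have "int p dvd int (u * v * s) - r \<longleftrightarrow> int p dvd int v * int s * (int u - r * w v)"
        using w[OF v p] by (simp add: dvd_add_left_iff)
      also have "\<dots> \<longleftrightarrow> int p dvd int u - r * w v" using nd Dint[OF p] by (simp add: prime_dvd_mult_iff)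
      finally show "int p dvd int (u * v * s) - r \<longleftrightarrow> int p dvd int u - r * w v" .
    qed
    \<comment> \<open>The difference of two inverses is a unit times the difference of the numbers:
      1/(v s) - 1/(v' s) = (v' - v)/(v v' s).\<close>
    have e2: "ramsum D (r * w v - r * w v') = ramsum D (int v - int v')" if v: "v \<in> S2" "v' \<in> S2" for v v'
    proof (rule ramsum_cong)
      fix p assume p: "p \<in> D"
      have nd: "\<not> int p dvd int v * int v' * int s" "\<not> int p dvd int s"
        using cop[OF p] v s Dint[OF p] by (auto simp: prime_dvd_mult_iff)
      have "int p dvd r * w v - r * w v' \<longleftrightarrow> int p dvd w v - w v'"
        using r[OF p] Dint[OF p] by (simp add: prime_dvd_mult_iff flip: right_diff_distrib)
      also have "\<dots> \<longleftrightarrow> int p dvd int v * int v' * int s * (w v - w v')"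
        using nd Dint[OF p] by (simp add: prime_dvd_mult_iff)
      also have "int v * int v' * int s * (w v - w v')
        = int v' * (int v * int s * w v - 1) - int v * (int v' * int s * w v' - 1) - (int v - int v')"
        by (simp add: algebra_simps)
      also have "int p dvd \<dots> \<longleftrightarrow> int p dvd int v - int v'"
        using w[OF v(1) p] w[OF v(2) p] by (simp add: dvd_diff_right_iff dvd_diff_left_iff dvd_diff)
      finally show "int p dvd r * w v - r * w v' \<longleftrightarrow> int p dvd int v - int v'" .
    qed
    define f where "f a = (\<Sum>u\<in>S1. ee (real u * fracpt D a))" for a
    define g where "g a = (\<Sum>v\<in>S2. ee (of_int (- (r * w v)) * fracpt D a))" for a
    have "complex_of_real (\<Sum>u\<in>S1. \<Sum>v\<in>S2. ramsum D (int (u * v * s) - r))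
       = (\<Sum>u\<in>S1. \<Sum>v\<in>S2. \<Sum>a\<in>numerators D. ee (of_int (int u - r * w v) * fracpt D a))"
      unfolding of_real_sum
    proof (intro sum.cong refl)
      fix u v assume v: "v \<in> S2"
      show "complex_of_real (ramsum D (int (u * v * s) - r))
        = (\<Sum>a\<in>numerators D. ee (of_int (int u - r * w v) * fracpt D a))"
        unfolding e1[OF v] by (rule ramsum_ee) (use fin pos in auto)
    qed
    also have "\<dots> = (\<Sum>a\<in>numerators D. \<Sum>u\<in>S1. \<Sum>v\<in>S2. ee (of_int (int u - r * w v) * fracpt D a))"
      by (simp only: sum.swap[of _ "numerators D"])
    also have "\<dots> = (\<Sum>a\<in>numerators D. f a * g a)"
      unfolding f_def g_def sum_product
      by (intro sum.cong refl) (simp add: algebra_simps flip: ee_add)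
    finally have "\<bar>\<Sum>u\<in>S1. \<Sum>v\<in>S2. ramsum D (int (u * v * s) - r)\<bar> = norm (\<Sum>a\<in>numerators D. f a * g a)"
      by (drule_tac arg_cong[of _ _ norm]) (simp only: norm_of_real)
    also have "\<dots> \<le> (\<Sum>a\<in>numerators D. norm (f a) * norm (g a))"
      by (rule order_trans[OF norm_sum]) (simp add: norm_mult)
    also have "\<dots> \<le> sqrt ((\<Sum>a\<in>numerators D. norm (f a) ^ 2) * (\<Sum>a\<in>numerators D. norm (g a) ^ 2))"
      by (intro real_le_rsqrt Cauchy_Schwarz_ineq_sum)
    also have "(\<Sum>a\<in>numerators D. norm (f a) ^ 2) = sieve_form D S1"
      unfolding f_def by (rule sieve_form_eq_sum_squares[symmetric]) (use fin pos in auto)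
    also have "(\<Sum>a\<in>numerators D. norm (g a) ^ 2) = sieve_form D S2"
    proof -
      have "complex_of_real (\<Sum>a\<in>numerators D. norm (g a) ^ 2)
        = (\<Sum>a\<in>numerators D. (\<Sum>v\<in>S2. ee (of_int (- (r * w v)) * fracpt D a)) * cnj (\<Sum>v\<in>S2. ee (of_int (- (r * w v)) * fracpt D a)))"
        by (simp only: of_real_sum complex_norm_square g_def)
      also have "\<dots> = (\<Sum>a\<in>numerators D. \<Sum>v\<in>S2. \<Sum>v'\<in>S2. ee (of_int (r * w v' - r * w v) * fracpt D a))"
        unfolding cnj_sum sum_product
        by (intro sum.cong refl) (simp add: algebra_simps flip: ee_minus ee_add)
      also have "\<dots> = (\<Sum>v\<in>S2. \<Sum>v'\<in>S2. \<Sum>a\<in>numerators D. ee (of_int (r * w v' - r * w v) * fracpt D a))"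
        by (subst (2) sum.swap, subst sum.swap) (rule refl)
      also have "\<dots> = (\<Sum>v\<in>S2. \<Sum>v'\<in>S2. complex_of_real (ramsum D (int v' - int v)))"
      proof (intro sum.cong refl)
        fix v v' assume v: "v \<in> S2" "v' \<in> S2"
        have "(\<Sum>a\<in>numerators D. ee (of_int (r * w v' - r * w v) * fracpt D a))
          = complex_of_real (ramsum D (r * w v' - r * w v))"
          by (rule ramsum_ee[symmetric]) (use fin pos in auto)
        then show "(\<Sum>a\<in>numerators D. ee (of_int (r * w v' - r * w v) * fracpt D a))
          = complex_of_real (ramsum D (int v' - int v))"
          by (simp only: e2[OF v(2,1)])
      qed
      also have "\<dots> = complex_of_real (sieve_form D S2)"
        unfolding sieve_form_def of_real_sum by (rule sum.swap)
      finally show ?thesis by (simp only: of_real_eq_iff)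
    qed
    finally show ?thesis .
  qed
  have "\<bar>\<Sum>s\<in>S3. \<Sum>u\<in>S1. \<Sum>v\<in>S2. ramsum D (int (u * v * s) - r)\<bar>
    \<le> (\<Sum>s\<in>S3. sqrt (sieve_form D S1 * sieve_form D S2))"
    by (rule order_trans[OF sum_abs], intro sum_mono inner)
  then show ?thesis by simp
qed

section \<open>Products of primes from disjoint blocks\<close>

definition prods :: "(nat \<Rightarrow> nat set) \<Rightarrow> nat set \<Rightarrow> nat set" where
  "prods E G = (\<lambda>q. \<Prod>i\<in>G. q i) ` PiE G E"

lemma inj_on_PiE_disjoint:
  assumes "disjoint_family_on A V" "p \<in> PiE V A" "I \<subseteq> V"
  shows "inj_on p I"
proof (rule inj_onI)
  fix i j assume ij: "i \<in> I" "j \<in> I" "p i = p j"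
  have "p i \<in> A i" "p j \<in> A j" using assms ij by (auto simp: PiE_def Pi_def)
  then show "i = j" using ij assms(1,3) by (auto simp: disjoint_family_on_def)
qed

lemma inj_on_image_PiE_disjoint:
  assumes "disjoint_family_on A I"
  shows "inj_on (\<lambda>q. q ` I) (PiE I A)"
proof (rule inj_onI)
  fix p q assume pq: "p \<in> PiE I A" "q \<in> PiE I A" "p ` I = q ` I"
  show "p = q"
  proof (rule PiE_ext[OF pq(1,2)])
    fix i assume i: "i \<in> I"
    then obtain j where j: "j \<in> I" "p i = q j" using pq(3) by blast
    then have "p i \<in> A i \<inter> A j" using pq i by (auto simp: PiE_def Pi_def)
    then have "i = j" using assms i j by (auto simp: disjoint_family_on_def)
    then show "p i = q i" using j by simp
  qed
qed

lemma merge_PiE: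
  assumes "G \<inter> H = {}"
  shows "bij_betw (\<lambda>(a, b) i. if i \<in> G then a i else b i) (PiE G A \<times> PiE H A) (PiE (G \<union> H) A)"
proof (rule bij_betwI[where g = "\<lambda>p. (restrict p G, restrict p H)"])
  show "(\<lambda>(a, b) i. if i \<in> G then a i else b i) \<in> PiE G A \<times> PiE H A \<rightarrow> PiE (G \<union> H) A"
    by (auto simp: PiE_def Pi_def extensional_def)
  show "(\<lambda>p. (restrict p G, restrict p H)) \<in> PiE (G \<union> H) A \<rightarrow> PiE G A \<times> PiE H A"
    by (auto simp: PiE_def Pi_def)
  show "(restrict ((\<lambda>(a, b) i. if i \<in> G then a i else b i) x) G, restrict ((\<lambda>(a, b) i. if i \<in> G then a i else b i) x) H) = x"
    if "x \<in> PiE G A \<times> PiE H A" for x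
    using that assms by (cases x) (auto simp: PiE_def extensional_def fun_eq_iff)
  show "(\<lambda>(a, b) i. if i \<in> G then a i else b i) (restrict p G, restrict p H) = p"
    if "p \<in> PiE (G \<union> H) A" for p
    using that by (auto simp: PiE_def extensional_def fun_eq_iff)
qed

text \<open>Coordinates outside I only contribute their number of choices. An average over the
  moduli thereby becomes an average over their divisors supported on I.\<close>

lemma sum_PiE_image:
  assumes "finite V" "I \<subseteq> V" "\<And>i. i \<in> V \<Longrightarrow> finite (A i)"
  shows "(\<Sum>p\<in>PiE V A. h (p ` I)) = real (\<Prod>i\<in>V - I. card (A i)) * (\<Sum>q\<in>PiE I A. h (q ` I) :: real)"
proof -
  have V: "I \<union> (V - I) = V" using assms(2) by blast
  have fin: "finite I" "finite (V - I)" using assms finite_subset by auto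
  have "(\<Sum>p\<in>PiE V A. h (p ` I)) = (\<Sum>x\<in>PiE I A \<times> PiE (V - I) A. h (fst x ` I))"
    using merge_PiE[of I "V - I" A] unfolding V
    by (subst sum.reindex_bij_betw[symmetric], simp, simp) (intro sum.cong refl arg_cong[of _ _ h], auto)
  also have "\<dots> = (\<Sum>q\<in>PiE I A. \<Sum>t\<in>PiE (V - I) A. h (q ` I))"
    unfolding sum.cartesian_product by (simp add: case_prod_unfold)
  also have "\<dots> = real (card (PiE (V - I) A)) * (\<Sum>q\<in>PiE I A. h (q ` I))"
    by (simp add: sum_distrib_left)
  finally show ?thesis using fin by (simp add: card_PiE)
qed

locale prime_blocks =
  fixes E :: "nat \<Rightarrow> nat set" and U :: "nat set"
  assumes finU: "finite U" and finE: "\<And>i. i \<in> U \<Longrightarrow> finite (E i)"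
    and primeE: "\<And>i p. i \<in> U \<Longrightarrow> p \<in> E i \<Longrightarrow> prime p"
    and disjE: "disjoint_family_on E U"
begin

lemma fin_sub: "G \<subseteq> U \<Longrightarrow> finite G"
  using finU finite_subset by blast

lemma prods_prime_dvd:
  assumes "G \<subseteq> U" "s \<in> prods E G" "prime p" "p dvd s"
  shows "\<exists>i\<in>G. p \<in> E i"
proof -
  obtain q where q: "q \<in> PiE G E" "s = (\<Prod>i\<in>G. q i)" using assms(2) by (auto simp: prods_def)
  then obtain i where i: "i \<in> G" "p dvd q i" using assms by (auto simp: prime_dvd_prod_iff fin_sub)
  then have qi: "q i \<in> E i" using q by auto
  then have "p = q i" using primeE[of i "q i"] assms i by (intro primes_dvd_imp_eq) auto
  then show ?thesis using qi i by auto
qed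

lemma inj_on_prod_PiE:
  assumes "G \<subseteq> U"
  shows "inj_on (\<lambda>q. \<Prod>i\<in>G. q i) (PiE G E)"
proof (rule inj_onI)
  fix p q assume pq: "p \<in> PiE G E" "q \<in> PiE G E" "(\<Prod>i\<in>G. p i) = (\<Prod>i\<in>G. q i)"
  show "p = q"
  proof (rule PiE_ext[OF pq(1,2)])
    fix i assume i: "i \<in> G"
    have pi: "p i \<in> E i" "prime (p i)" using pq i assms primeE[of i "p i"] by auto
    have "p i dvd (\<Prod>i\<in>G. q i)" using i assms unfolding pq(3)[symmetric] by (intro dvd_prodI fin_sub)
    then obtain j where j: "j \<in> G" "p i dvd q j" using pi assms by (auto simp: prime_dvd_prod_iff fin_sub)
    have qj: "q j \<in> E j" "prime (q j)" using pq j assms primeE[of j "q j"] by auto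
    have e: "p i = q j" using primes_dvd_imp_eq[OF pi(2) qj(2) j(2)] .
    then have "i = j" using pi qj i j assms disjE by (auto simp: disjoint_family_on_def)
    then show "p i = q i" using e by simp
  qed
qed

lemma finite_prods: "G \<subseteq> U \<Longrightarrow> finite (prods E G)"
  unfolding prods_def using finE by (intro finite_imageI finite_PiE) (auto simp: fin_sub)

lemma card_prods: "G \<subseteq> U \<Longrightarrow> card (prods E G) = (\<Prod>i\<in>G. card (E i))"
  unfolding prods_def by (simp add: card_image inj_on_prod_PiE card_PiE fin_sub)

lemma prods_pos: "G \<subseteq> U \<Longrightarrow> s \<in> prods E G \<Longrightarrow> s > 0"
proof -
  assume G: "G \<subseteq> U" and "s \<in> prods E G"
  then obtain q where q: "q \<in> PiE G E" "s = (\<Prod>i\<in>G. q i)" by (auto simp: prods_def)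
  show "s > 0" unfolding q(2)
  proof (rule prod_pos)
    fix i assume "i \<in> G"
    then show "0 < q i" using primeE[of i "q i"] q(1) G by (auto intro: prime_gt_0_nat)
  qed
qed

lemma prods_le:
  assumes "G \<subseteq> U" "s \<in> prods E G" "\<And>i p. i \<in> G \<Longrightarrow> p \<in> E i \<Longrightarrow> real p \<le> x i"
  shows "real s \<le> (\<Prod>i\<in>G. x i)"
proof -
  obtain q where q: "q \<in> PiE G E" "s = (\<Prod>i\<in>G. q i)" using assms(2) by (auto simp: prods_def)
  show ?thesis unfolding q(2) of_nat_prod
    using assms(3)[OF _ PiE_mem[OF q(1)]] by (intro prod_mono) auto
qed

lemma sum_prods_union:
  assumes "G \<union> H \<subseteq> U" "G \<inter> H = {}"
  shows "(\<Sum>s\<in>prods E (G \<union> H). F s) = (\<Sum>a\<in>prods E G. \<Sum>b\<in>prods E H. F (a * b))"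
proof -
  have sub: "G \<subseteq> U" "H \<subseteq> U" using assms by auto
  have "prods E (G \<union> H) = (\<lambda>(a, b). a * b) ` (prods E G \<times> prods E H)"
  proof -
    have "PiE (G \<union> H) E = (\<lambda>(a, b) i. if i \<in> G then a i else b i) ` (PiE G E \<times> PiE H E)"
      using merge_PiE[OF assms(2), of E] by (simp add: bij_betw_def)
    moreover have "(\<Prod>i\<in>G \<union> H. if i \<in> G then a i else b i) = (\<Prod>i\<in>G. a i) * (\<Prod>i\<in>H. b i)" for a b :: "nat \<Rightarrow> nat"
    proof -
      have "(\<Prod>i\<in>G \<union> H. if i \<in> G then a i else b i) = (\<Prod>i\<in>G. if i \<in> G then a i else b i) * (\<Prod>i\<in>H. if i \<in> G then a i else b i)"
        using assms fin_sub sub by (intro prod.union_disjoint) auto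
      also have "(\<Prod>i\<in>H. if i \<in> G then a i else b i) = (\<Prod>i\<in>H. b i)"
        using assms by (intro prod.cong) auto
      finally show ?thesis by simp
    qed
    moreover have "(\<lambda>(a, b). a * b) ` (f ` X \<times> g ` Z) = (\<lambda>(a, b). f a * g b) ` (X \<times> Z)"
      for f g :: "(nat \<Rightarrow> nat) \<Rightarrow> nat" and X Z by force
    ultimately show ?thesis
      unfolding prods_def by (simp add: image_image case_prod_unfold)
  qed
  note e = this
  \<comment> \<open>Uniqueness of the splitting is obtained by counting: source and image of the
    multiplication map both have the product of the block sizes as cardinality.\<close>
  have inj: "inj_on (\<lambda>(a, b). a * b) (prods E G \<times> prods E H)"
  proof (rule eq_card_imp_inj_on)
    have "card (prods E (G \<union> H)) = card (prods E G \<times> prods E H)"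
      using assms sub fin_sub by (simp add: card_prods card_cartesian_product prod.union_disjoint)
    then show "card ((\<lambda>(a, b). a * b) ` (prods E G \<times> prods E H)) = card (prods E G \<times> prods E H)"
      by (simp only: e)
  qed (use sub in \<open>simp add: finite_prods\<close>)
  show ?thesis
    unfolding e sum.reindex[OF inj] sum.cartesian_product by (simp add: case_prod_unfold)
qed

end

locale sieve_blocks = prime_blocks E U for E U +
  fixes A :: "nat \<Rightarrow> nat set" and V :: "nat set" and Y :: nat and L :: real and \<Lambda> \<rho> :: real
  assumes VU: "V \<subseteq> U"
    and finA: "\<And>i. i \<in> V \<Longrightarrow> finite (A i)"
    and primeA: "\<And>i p. i \<in> V \<Longrightarrow> p \<in> A i \<Longrightarrow> prime p"
    and disjA: "disjoint_family_on A V"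
    and disjAE: "\<And>i j. i \<in> V \<Longrightarrow> j \<in> U \<Longrightarrow> A i \<inter> E j = {}"
    and leA: "\<And>i p. i \<in> V \<Longrightarrow> p \<in> A i \<Longrightarrow> p \<le> Y"
    and leE: "\<And>i p. i \<in> U \<Longrightarrow> p \<in> E i \<Longrightarrow> p \<le> Y"
    and Lpos: "L > 0"
    and cardA: "\<And>i. i \<in> V \<Longrightarrow> L \<le> real (card (A i))"
    and cardE: "\<And>i. i \<in> U \<Longrightarrow> L \<le> real (card (E i))"
    and cardEA: "\<And>i p. i \<in> V \<Longrightarrow> p \<in> A i \<Longrightarrow> card (E i) \<le> p"
    and Ypos: "Y > 0"
    and Lam: "\<Lambda> \<ge> 2" "\<Lambda> \<ge> 4 * harm (Y ^ (2 * card V))"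
    and rho: "\<And>j l. 1 \<le> l \<Longrightarrow> j + l \<le> card V \<Longrightarrow>
        \<Lambda> * (real Y ^ min (2 * l) ((card U - j) div 2) + real Y ^ (2 * l))
        \<le> \<rho> * L ^ (min (2 * l) ((card U - j) div 2) + l)"
begin

lemma finV: "finite V" using VU finU finite_subset by blast

lemma sum_sieve_form_image_le:
  assumes "I \<subseteq> V" "G \<subseteq> U"
  shows "(\<Sum>q\<in>PiE I A. sieve_form (q ` I) (prods E G))
    \<le> \<Lambda> * (real Y ^ card G + real Y ^ (2 * card I)) * real (card (prods E G))"
proof -
  have fI: "finite I" using assms finV finite_subset by blast
  have dI: "disjoint_family_on A I" using disjA assms(1) by (auto simp: disjoint_family_on_def)
  let ?F = "Y ^ card I"
  have "(\<Sum>q\<in>PiE I A. sieve_form (q ` I) (prods E G)) = (\<Sum>D\<in>(\<lambda>q. q ` I) ` PiE I A. sieve_form D (prods E G))"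
    by (simp add: sum.reindex inj_on_image_PiE_disjoint[OF dI])
  also have "\<dots> \<le> (real (Suc (Y ^ card G)) + 4 * real (?F^2) * harm (?F^2)) * real (card (prods E G))"
  proof (rule sum_sieve_form_le)
    show "finite ((\<lambda>q. q ` I) ` PiE I A)" using fI finA assms by (intro finite_imageI finite_PiE) auto
    show "prods E G \<subseteq> {..<Suc (Y ^ card G)}"
    proof
      fix s assume s: "s \<in> prods E G"
      have "real s \<le> (\<Prod>i\<in>G. real Y)" using leE assms s by (intro prods_le) auto
      then show "s \<in> {..<Suc (Y ^ card G)}" by (simp flip: of_nat_power)
    qed
    fix D assume "D \<in> (\<lambda>q. q ` I) ` PiE I A"
    then obtain q where q: "q \<in> PiE I A" "D = q ` I" by blast
    have inj: "inj_on q I" using inj_on_PiE_disjoint[OF dI q(1)] by simp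
    have mem: "q i \<in> A i" if "i \<in> I" for i using q that by auto
    have "\<Prod>D \<le> (\<Prod>i\<in>I. Y)" unfolding q(2) using leA mem assms(1)
      by (auto simp: prod.reindex[OF inj] simp del: prod_constant intro!: prod_mono)
    then show "finite D \<and> (\<forall>p\<in>D. prime p) \<and> \<Prod>D \<le> ?F" using fI q(2) mem primeA assms(1) by auto
  qed
  also have "\<dots> \<le> (\<Lambda> * (real Y ^ card G + real Y ^ (2 * card I))) * real (card (prods E G))"
  proof (intro mult_right_mono)
    have c: "card I \<le> card V" using assms finV by (simp add: card_mono)
    have "4 * harm (?F^2) \<le> 4 * (harm (Y ^ (2 * card V)) :: real)"
      using c Ypos by (intro mult_left_mono harm_mono) (auto simp flip: power_mult intro!: power_increasing)
    then have h: "4 * harm (?F^2) \<le> \<Lambda>" using Lam by simp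
    have "real (Suc (Y ^ card G)) \<le> 2 * real Y ^ card G" using Ypos by (simp add: Suc_le_eq)
    also have "\<dots> \<le> \<Lambda> * real Y ^ card G" using Lam by (intro mult_right_mono) auto
    finally have 1: "real (Suc (Y ^ card G)) \<le> \<Lambda> * real Y ^ card G" .
    have "4 * real (?F^2) * harm (?F^2) = (4 * harm (?F^2)) * real Y ^ (2 * card I)"
      by (simp add: power_mult[symmetric] mult.commute)
    also have "\<dots> \<le> \<Lambda> * real Y ^ (2 * card I)" using h by (intro mult_right_mono) auto
    finally show "real (Suc (Y ^ card G)) + 4 * real (?F^2) * harm (?F^2) \<le> \<Lambda> * (real Y ^ card G + real Y ^ (2 * card I))"
      using 1 by (simp add: distrib_left)
  qed auto
  finally show ?thesis .
qed

lemma card_prods_ge: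
  assumes "G \<subseteq> U" shows "real (card (prods E G)) \<ge> L ^ card G"
proof -
  have "(\<Prod>i\<in>G. L) \<le> (\<Prod>i\<in>G. real (card (E i)))" using assms cardE Lpos by (intro prod_mono) (auto intro: less_imp_le)
  then show ?thesis by (simp add: card_prods assms)
qed

text \<open>The bilinear bound for the divisor with prime set D, relative to the main term coming
  from the trivial divisor.\<close>

definition rel_err :: "nat set \<Rightarrow> nat set \<Rightarrow> nat set \<Rightarrow> real" where
  "rel_err D G H = sqrt (sieve_form D (prods E G) * sieve_form D (prods E H))
     / (real (card (prods E G)) * real (card (prods E H)))"

text \<open>Cauchy-Schwarz over the divisors lets the large sieve act on G and H separately. The
  total is at most \<open>W / L ^ card G\<close>, which \<open>rho\<close> compares with the number
  of divisors, at least \<open>L ^ card I\<close>.\<close>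

lemma sum_rel_err_le:
  assumes I: "I \<subseteq> V" "I \<noteq> {}" and J: "J \<subseteq> V" "I \<inter> J = {}" and G: "G \<subseteq> U" "H \<subseteq> U"
    and g: "card G = min (2 * card I) ((card U - card J) div 2)" "card H = card G"
  shows "(\<Sum>p\<in>PiE V A. rel_err (p ` I) G H) \<le> \<rho> * real (card (PiE V A))"
proof -
  have fI: "finite I" "finite J" using assms finV finite_subset by blast+
  define S where "S = real (card (prods E G))"
  define T where "T = real (card (prods E H))"
  have "L ^ card G > 0" using Lpos by simp
  then have ST: "S \<ge> L ^ card G" "T \<ge> L ^ card G" "S > 0" "T > 0"
    using card_prods_ge[OF G(1)] card_prods_ge[OF G(2)] g(2) unfolding S_def T_def by (auto simp del: of_nat_0_less_iff)
  define W where "W = \<Lambda> * (real Y ^ card G + real Y ^ (2 * card I))"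
  have W0: "W \<ge> 0" using Lam by (simp add: W_def)
  have pos: "0 < p" if "q \<in> PiE I A" "p \<in> q ` I" for q p
    using that primeA I by (fastforce simp: prime_gt_0_nat)
  have nn: "0 \<le> sieve_form (q ` I) Q" if "q \<in> PiE I A" for q Q
    using that fI pos by (intro sieve_form_nonneg) auto
  have "(\<Sum>q\<in>PiE I A. sqrt (sieve_form (q ` I) (prods E G) * sieve_form (q ` I) (prods E H)))
     = (\<Sum>q\<in>PiE I A. sqrt (sieve_form (q ` I) (prods E G)) * sqrt (sieve_form (q ` I) (prods E H)))"
    by (simp add: real_sqrt_mult)
  also have "\<dots> \<le> sqrt ((\<Sum>q\<in>PiE I A. sqrt (sieve_form (q ` I) (prods E G))^2) * (\<Sum>q\<in>PiE I A. sqrt (sieve_form (q ` I) (prods E H))^2))"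
    by (intro real_le_rsqrt Cauchy_Schwarz_ineq_sum)
  also have "\<dots> = sqrt ((\<Sum>q\<in>PiE I A. sieve_form (q ` I) (prods E G)) * (\<Sum>q\<in>PiE I A. sieve_form (q ` I) (prods E H)))"
    using nn by (intro arg_cong[of _ _ sqrt] arg_cong2[of _ _ _ _ "(*)"] sum.cong) auto
  also have "\<dots> \<le> sqrt ((W * S) * (W * T))"
    unfolding W_def S_def T_def using sum_sieve_form_image_le[OF I(1) G(1)] sum_sieve_form_image_le[OF I(1) G(2)] g(2) Lam
    by (intro real_sqrt_le_mono mult_mono sum_nonneg nn) auto
  also have "\<dots> = W * sqrt (S * T)"
  proof -
    have "(W * S) * (W * T) = W^2 * (S * T)" by (simp add: power2_eq_square)
    then show ?thesis using W0 by (simp add: real_sqrt_mult)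
  qed
  finally have 1: "(\<Sum>q\<in>PiE I A. sqrt (sieve_form (q ` I) (prods E G) * sieve_form (q ` I) (prods E H))) \<le> W * sqrt (S * T)" .
  have "(\<Sum>q\<in>PiE I A. rel_err (q ` I) G H) = (\<Sum>q\<in>PiE I A. sqrt (sieve_form (q ` I) (prods E G) * sieve_form (q ` I) (prods E H))) / (S * T)"
    by (simp add: rel_err_def S_def T_def sum_divide_distrib)
  also have "\<dots> \<le> W * sqrt (S * T) / (S * T)" using 1 ST by (intro divide_right_mono) auto
  also have "\<dots> = W / sqrt (S * T)"
  proof -
    define w where "w = sqrt (S * T)"
    have w: "w * w = S * T" "w > 0" using ST by (auto simp: w_def)
    have "W * w / (w * w) = W / w" using w(2) by simp
    then show ?thesis unfolding w(1) unfolding w_def .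
  qed
  also have "\<dots> \<le> W / L ^ card G"
  proof -
    have "L ^ card G * L ^ card G \<le> S * T" using ST Lpos by (intro mult_mono) auto
    then have "L ^ card G \<le> sqrt (S * T)" by (intro real_le_rsqrt) (simp add: power2_eq_square)
    then show ?thesis using W0 Lpos ST by (intro divide_left_mono mult_pos_pos) auto
  qed
  also have WL: "\<dots> \<le> \<rho> * L ^ card I"
  proof -
    have "card I \<noteq> 0" using I fI by simp
    then have "card I \<ge> 1" by linarith
    moreover have "card J + card I \<le> card V"
    proof -
      have "card J + card I = card (J \<union> I)" using J fI by (subst card_Un_disjoint) auto
      also have "\<dots> \<le> card V" using I J finV by (intro card_mono) auto
      finally show ?thesis .
    qed
    ultimately have "W \<le> \<rho> * L ^ (card G + card I)" using rho[of "card I" "card J"] g by (simp add: W_def)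
    then have "W / L ^ card G \<le> \<rho> * L ^ (card G + card I) / L ^ card G"
      using Lpos by (intro divide_right_mono) auto
    then show ?thesis using Lpos by (simp add: power_add)
  qed
  finally have 2: "(\<Sum>q\<in>PiE I A. rel_err (q ` I) G H) \<le> \<rho> * L ^ card I" .
  have "\<rho> \<ge> 0"
  proof -
    have "0 \<le> W / L ^ card G" using W0 Lpos by simp
    then have "0 \<le> \<rho> * L ^ card I" using WL by linarith
    then show ?thesis using zero_less_power[OF Lpos, of "card I"] by (auto simp: zero_le_mult_iff)
  qed
  have "L ^ card I \<le> (\<Prod>i\<in>I. real (card (A i)))"
  proof -
    have "(\<Prod>i\<in>I. L) \<le> (\<Prod>i\<in>I. real (card (A i)))" using I cardA Lpos by (intro prod_mono) (auto intro: less_imp_le)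
    then show ?thesis by simp
  qed
  then have 3: "(\<Sum>q\<in>PiE I A. rel_err (q ` I) G H) \<le> \<rho> * (\<Prod>i\<in>I. real (card (A i)))"
    using order_trans[OF 2 mult_left_mono[OF _ \<open>\<rho> \<ge> 0\<close>]] by blast
  define P where "P = real (\<Prod>i\<in>V - I. card (A i))"
  define Q where "Q = (\<Prod>i\<in>I. real (card (A i)))"
  have PQ: "P * Q = real (card (PiE V A))"
    using prod.subset_diff[OF I(1) finV, of "\<lambda>i. real (card (A i))"] finV by (simp add: card_PiE P_def Q_def)
  have "P \<ge> 0" unfolding P_def by (rule of_nat_0_le_iff)
  have "(\<Sum>p\<in>PiE V A. rel_err (p ` I) G H) = P * (\<Sum>q\<in>PiE I A. rel_err (q ` I) G H)"
    unfolding P_def by (rule sum_PiE_image[OF finV I(1) finA])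
  also have "\<dots> \<le> P * (\<rho> * Q)"
    using 3 \<open>P \<ge> 0\<close> unfolding Q_def by (rule mult_left_mono)
  also have "\<dots> = \<rho> * real (card (PiE V A))" unfolding PQ[symmetric] by (simp only: ac_simps)
  finally show ?thesis .
qed

end

lemma ex_disjoint_subsets:
  assumes "finite W" "2 * g \<le> card W"
  shows "\<exists>G H. G \<subseteq> W \<and> H \<subseteq> W \<and> G \<inter> H = {} \<and> card G = g \<and> card H = g"
proof -
  obtain G where G: "G \<subseteq> W" "card G = g" "finite G"
    using obtain_subset_with_card_n[of g W] assms by (metis le_trans mult_2 le_add1)
  have "g \<le> card (W - G)" using G assms by (simp add: card_Diff_subset)
  then obtain H where "H \<subseteq> W - G" "card H = g" using obtain_subset_with_card_n by metis
  then show ?thesis using G by blast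
qed

lemma prod_distinct_primes_dvd:
  fixes p :: "nat \<Rightarrow> nat" and z :: int
  assumes "finite Q" "inj_on p Q" "\<And>i. i \<in> Q \<Longrightarrow> prime (p i)" "\<And>i. i \<in> Q \<Longrightarrow> int (p i) dvd z"
  shows "int (\<Prod>i\<in>Q. p i) dvd z"
  using assms
proof (induction Q rule: finite_induct)
  case (insert i Q)
  have "coprime (p i) (\<Prod>j\<in>Q. p j)"
  proof (rule prod_coprime_right)
    fix j assume "j \<in> Q"
    then show "coprime (p i) (p j)" using insert by (intro primes_coprime) (auto simp: inj_on_def)
  qed
  then have "coprime (int (p i)) (int (\<Prod>j\<in>Q. p j))" by (simp only: coprime_int_iff)
  moreover have "int (p i) dvd z" "int (\<Prod>j\<in>Q. p j) dvd z" using insert by auto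
  ultimately have "int (p i) * int (\<Prod>j\<in>Q. p j) dvd z" by (intro divides_mult)
  then show ?case using insert.hyps by simp
qed simp

section \<open>Equidistribution in residue classes for almost all moduli\<close>

context sieve_blocks
begin

definition part_card :: "nat set \<Rightarrow> nat set \<Rightarrow> nat" where
  "part_card J I = min (2 * card I) ((card U - card J) div 2)"

text \<open>The choice depends on J and I but not on the primes, so that the error of a fixed pair
  (J, I) can be averaged over all moduli.\<close>

definition parts :: "nat set \<Rightarrow> nat set \<Rightarrow> nat set \<times> nat set" where
  "parts J I = (SOME (G, H). G \<subseteq> U - J \<and> H \<subseteq> U - J \<and> G \<inter> H = {} \<and> card G = part_card J I \<and> card H = part_card J I)"

definition total_err :: "(nat \<Rightarrow> nat) \<Rightarrow> nat set \<Rightarrow> real" where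
  "total_err p J = (\<Sum>I\<in>Pow (V - J) - {{}}. rel_err (p ` I) (fst (parts J I)) (snd (parts J I)))"

lemma parts:
  fixes I
  assumes "J \<subseteq> V"
  defines "G \<equiv> fst (parts J I)" and "H \<equiv> snd (parts J I)"
  shows "G \<subseteq> U - J" "H \<subseteq> U - J" "G \<inter> H = {}" "card G = part_card J I" "card H = part_card J I"
proof -
  have "finite J" "J \<subseteq> U" using assms(1) VU finV finite_subset by blast+
  then have "card (U - J) = card U - card J" by (simp add: card_Diff_subset)
  moreover have "part_card J I \<le> (card U - card J) div 2" by (simp add: part_card_def)
  ultimately have "2 * part_card J I \<le> card (U - J)" by linarith
  then have "\<exists>G H. G \<subseteq> U - J \<and> H \<subseteq> U - J \<and> G \<inter> H = {} \<and> card G = part_card J I \<and> card H = part_card J I"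
    using finU by (intro ex_disjoint_subsets) auto
  then have "\<exists>x. case x of (G, H) \<Rightarrow> G \<subseteq> U - J \<and> H \<subseteq> U - J \<and> G \<inter> H = {} \<and> card G = part_card J I \<and> card H = part_card J I"
    by auto
  from someI_ex[OF this] show "G \<subseteq> U - J" "H \<subseteq> U - J" "G \<inter> H = {}" "card G = part_card J I" "card H = part_card J I"
    by (auto simp: parts_def[symmetric] G_def H_def split: prod.splits)
qed

lemma rel_err_nonneg:
  assumes "p \<in> PiE V A" "I \<subseteq> V"
  shows "0 \<le> rel_err (p ` I) G H"
proof -
  have "finite (p ` I)" using assms(2) finV finite_subset by blast
  moreover have "q > 0" if q: "q \<in> p ` I" for q
  proof -
    obtain i where "i \<in> V" "q \<in> A i" using q assms by auto
    then show ?thesis using primeA prime_gt_0_nat by blast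
  qed
  ultimately show ?thesis
    unfolding rel_err_def by (intro divide_nonneg_nonneg real_sqrt_ge_zero mult_nonneg_nonneg sieve_form_nonneg) auto
qed

lemma total_err_nonneg:
  assumes "p \<in> PiE V A" shows "0 \<le> total_err p J"
  unfolding total_err_def using assms by (intro sum_nonneg rel_err_nonneg) auto

lemma rho_nonneg: "V \<noteq> {} \<Longrightarrow> \<rho> \<ge> 0"
proof -
  assume "V \<noteq> {}"
  then have "card V > 0" using finV by (simp add: card_gt_0_iff)
  then have *: "\<Lambda> * (real Y ^ min (2 * 1) ((card U - 0) div 2) + real Y ^ (2 * 1))
        \<le> \<rho> * L ^ (min (2 * 1) ((card U - 0) div 2) + 1)" by (intro rho) auto
  have "0 \<le> \<Lambda> * (real Y ^ min (2 * 1) ((card U - 0) div 2) + real Y ^ (2 * 1))"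
    using Lam by (intro mult_nonneg_nonneg add_nonneg_nonneg) auto
  then have "0 \<le> \<rho> * L ^ (min (2 * 1) ((card U - 0) div 2) + 1)" using * by linarith
  then show ?thesis using zero_less_power[OF Lpos, of "min (2 * 1) ((card U - 0) div 2) + 1"]
    by (auto simp: zero_le_mult_iff)
qed

text \<open>The factor \<open>4 ^ card V\<close> is a crude count of the pairs (J, I). It is
  affordable because \<open>\<rho>\<close> will carry a saving of y^(-1/2).\<close>

lemma sum_total_err_le:
  assumes "V \<noteq> {}"
  shows "(\<Sum>p\<in>PiE V A. \<Sum>J\<in>Pow V. total_err p J) \<le> 4 ^ card V * \<rho> * real (card (PiE V A))"
proof -
  let ?N = "\<rho> * real (card (PiE V A))"
  have N0: "?N \<ge> 0" using rho_nonneg[OF assms] by simp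
  have "(\<Sum>p\<in>PiE V A. \<Sum>J\<in>Pow V. total_err p J)
     = (\<Sum>J\<in>Pow V. \<Sum>I\<in>Pow (V - J) - {{}}. \<Sum>p\<in>PiE V A. rel_err (p ` I) (fst (parts J I)) (snd (parts J I)))"
    unfolding total_err_def by (simp only: sum.swap[of _ _ "PiE V A"])
  also have "\<dots> \<le> (\<Sum>J\<in>Pow V. \<Sum>I\<in>Pow (V - J) - {{}}. ?N)"
  proof (intro sum_mono)
    fix J I assume J: "J \<in> Pow V" and I: "I \<in> Pow (V - J) - {{}}"
    note P = parts[of J I]
    show "(\<Sum>p\<in>PiE V A. rel_err (p ` I) (fst (parts J I)) (snd (parts J I))) \<le> ?N"
      by (rule sum_rel_err_le[where J = J]) (use J I P in \<open>auto simp: part_card_def\<close>)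
  qed
  also have "\<dots> \<le> (\<Sum>J\<in>Pow V. 2 ^ card V * ?N)"
  proof (intro sum_mono)
    fix J assume "J \<in> Pow V"
    have "card (Pow (V - J) - {{}}) \<le> card (Pow V)" using finV by (intro card_mono) auto
    then have "real (card (Pow (V - J) - {{}})) \<le> real (card (Pow V))" by (simp only: of_nat_le_iff)
    also have "\<dots> = 2 ^ card V" by (simp add: card_Pow finV)
    finally have "real (card (Pow (V - J) - {{}})) \<le> 2 ^ card V" .
    then show "(\<Sum>I\<in>Pow (V - J) - {{}}. ?N) \<le> 2 ^ card V * ?N"
      unfolding sum_constant using N0 by (rule mult_right_mono)
  qed
  also have "\<dots> = 4 ^ card V * ?N"
    by (simp add: card_Pow finV flip: power_mult_distrib)
  finally show ?thesis by (simp only: mult.assoc)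
qed

text \<open>The indicator of \<open>k dvd s - r\<close> is expanded into Ramanujan sums over the divisors of \<open>k\<close>; the trivial
  divisor gives the main term.\<close>

lemma residue_class_count:
  assumes p: "p \<in> PiE V A" and J: "J \<subseteq> V" and e: "total_err p J \<le> 1 / 2"
    and r: "\<And>i. i \<in> V - J \<Longrightarrow> \<not> int (p i) dvd r"
  shows "real (card (prods E (U - J))) \<le> 2 * real (\<Prod>i\<in>V - J. p i)
    * real (card {s \<in> prods E (U - J). \<forall>i\<in>V - J. int (p i) dvd int s - r})"
proof -
  let ?S = "prods E (U - J)"
  let ?T = "{s \<in> ?S. \<forall>i\<in>V - J. int (p i) dvd int s - r}"
  define W where "W = V - J"
  have W: "finite W" "W \<subseteq> V" using finV by (auto simp: W_def)
  have inj: "inj_on p W" using inj_on_PiE_disjoint[OF disjA p] W by blast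
  have finS: "finite ?S" by (rule finite_prods) auto
  have pA: "p i \<in> A i" if "i \<in> V" for i using p that by auto
  have main: "real (card ?S) - (\<Sum>s\<in>?S. \<Sum>I\<in>Pow W. ramsum (p ` I) (int s - r)) \<le> real (card ?S) / 2"
  proof -
    have one: "\<bar>\<Sum>s\<in>?S. ramsum (p ` I) (int s - r)\<bar> \<le> real (card ?S) * rel_err (p ` I) (fst (parts J I)) (snd (parts J I))"
      if I: "I \<in> Pow W - {{}}" for I
    proof -
      define G where "G = fst (parts J I)"
      define H where "H = snd (parts J I)"
      \<comment> \<open>The blocks outside G and H form the third factor, over which only the
        triangle inequality is used.\<close>
      define K where "K = (U - J) - (G \<union> H)"
      note P = parts[OF J, of I, folded G_def H_def]
      have U: "K \<union> (G \<union> H) = U - J" "K \<inter> (G \<union> H) = {}" using P by (auto simp: K_def)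
      have sub: "K \<subseteq> U" "G \<subseteq> U" "H \<subseteq> U" "K \<union> (G \<union> H) \<subseteq> U" "G \<union> H \<subseteq> U" using P by (auto simp: K_def)
      have "(\<Sum>s\<in>?S. ramsum (p ` I) (int s - r))
        = (\<Sum>c\<in>prods E K. \<Sum>a\<in>prods E G. \<Sum>b\<in>prods E H. ramsum (p ` I) (int (a * b * c) - r))"
        unfolding U(1)[symmetric] sum_prods_union[OF sub(4) U(2)] sum_prods_union[OF sub(5) P(3)]
        by (simp only: mult.commute)
      also have "\<bar>\<dots>\<bar> \<le> real (card (prods E K)) * sqrt (sieve_form (p ` I) (prods E G) * sieve_form (p ` I) (prods E H))"
      proof (rule sum_ramsum_product_le)
        show "finite (p ` I)" using I W finite_subset by (intro finite_imageI) blast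
        fix q assume "q \<in> p ` I"
        then obtain i where i: "i \<in> I" "q = p i" "i \<in> V" "i \<in> V - J" using I W by (auto simp: W_def)
        show "prime q" using primeA[OF i(3)] pA[OF i(3)] i(2) by simp
        show "\<not> int q dvd r" using r[OF i(4)] i(2) by simp
        fix s assume "s \<in> prods E G \<union> prods E H \<union> prods E K"
        then obtain Q where Q: "Q \<subseteq> U" "s \<in> prods E Q" using sub by auto
        show "\<not> q dvd s"
        proof
          assume "q dvd s"
          then obtain j where "j \<in> Q" "q \<in> E j" using prods_prime_dvd[OF Q \<open>prime q\<close>] by blast
          then show False using disjAE[OF i(3), of j] pA[OF i(3)] i(2) Q(1) by auto
        qed
      qed
      also have "\<dots> = real (card ?S) * rel_err (p ` I) G H"
      proof -
        have "real (card ?S) = real (card (prods E K)) * (real (card (prods E G)) * real (card (prods E H)))"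
        proof -
          have fin: "finite K" "finite G" "finite H" using sub fin_sub by blast+
          show ?thesis unfolding U(1)[symmetric] using sub U(2) P(3) fin
            by (simp add: card_prods prod.union_disjoint)
        qed
        moreover have "card (prods E G) > 0" "card (prods E H) > 0"
          using zero_less_power[OF Lpos] card_prods_ge[OF sub(2)] card_prods_ge[OF sub(3)]
          by (metis less_le_trans of_nat_0_less_iff)+
        ultimately show ?thesis by (simp add: rel_err_def)
      qed
      finally show ?thesis by (simp add: G_def H_def)
    qed
    have "(\<Sum>s\<in>?S. \<Sum>I\<in>Pow W. ramsum (p ` I) (int s - r)) = (\<Sum>I\<in>Pow W. \<Sum>s\<in>?S. ramsum (p ` I) (int s - r))"
      by (rule sum.swap)
    also have "\<dots> = (\<Sum>s\<in>?S. ramsum (p ` {}) (int s - r)) + (\<Sum>I\<in>Pow W - {{}}. \<Sum>s\<in>?S. ramsum (p ` I) (int s - r))"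
      using W by (intro sum.remove) auto
    also have "(\<Sum>s\<in>?S. ramsum (p ` {}) (int s - r)) = real (card ?S)" by (simp add: ramsum_def)
    finally have "real (card ?S) - (\<Sum>s\<in>?S. \<Sum>I\<in>Pow W. ramsum (p ` I) (int s - r))
      \<le> \<bar>\<Sum>I\<in>Pow W - {{}}. \<Sum>s\<in>?S. ramsum (p ` I) (int s - r)\<bar>" by linarith
    also have "\<dots> \<le> (\<Sum>I\<in>Pow W - {{}}. \<bar>\<Sum>s\<in>?S. ramsum (p ` I) (int s - r)\<bar>)" by (rule sum_abs)
    also have "\<dots> \<le> (\<Sum>I\<in>Pow W - {{}}. real (card ?S) * rel_err (p ` I) (fst (parts J I)) (snd (parts J I)))"
      by (intro sum_mono one)
    also have "\<dots> = real (card ?S) * total_err p J" by (simp only: total_err_def sum_distrib_left W_def)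
    also have "\<dots> \<le> real (card ?S) * (1 / 2)" using e by (intro mult_left_mono) auto
    finally show ?thesis by simp
  qed
  have "(\<Sum>s\<in>?S. \<Sum>I\<in>Pow W. ramsum (p ` I) (int s - r))
     = (\<Sum>s\<in>?S. if \<forall>i\<in>W. int (p i) dvd int s - r then real (\<Prod>i\<in>W. p i) else 0)"
  proof (intro sum.cong refl)
    fix s
    have "(\<Sum>I\<in>Pow W. ramsum (p ` I) (int s - r)) = (\<Sum>I\<in>Pow (p ` W). ramsum I (int s - r))"
      using inj_on_image_Pow[OF inj] by (subst image_Pow_surj[OF refl, symmetric]) (simp add: sum.reindex)
    also have "\<dots> = (if \<forall>q\<in>p ` W. int q dvd int s - r then real (\<Prod>(p ` W)) else 0)"
      using W by (intro sum_ramsum_Pow) auto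
    finally show "(\<Sum>I\<in>Pow W. ramsum (p ` I) (int s - r)) = (if \<forall>i\<in>W. int (p i) dvd int s - r then real (\<Prod>i\<in>W. p i) else 0)"
      by (simp add: prod.reindex[OF inj])
  qed
  also have "\<dots> = real (card ?T) * real (\<Prod>i\<in>W. p i)"
    using finS by (simp add: sum.If_cases Int_def W_def)
  finally show ?thesis using main by (simp add: W_def mult.commute)
qed

text \<open>The residue \<open>r\<close> need not be coprime to \<open>k\<close>: if \<open>g = gcd r k\<close> then \<open>s = g * s'\<close>, where \<open>s'\<close> omits
  the blocks that contribute to \<open>g\<close>. This is why the error is summed over all \<open>J \<subseteq> V\<close>.\<close>

lemma equidistribution:
  assumes "V \<noteq> {}"
    and x: "\<And>i p. i \<in> V \<Longrightarrow> p \<in> A i \<Longrightarrow> real p \<le> x i" "\<And>i p. i \<in> U \<Longrightarrow> p \<in> E i \<Longrightarrow> real p \<le> x i"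
  obtains Bad where "Bad \<subseteq> PiE V A"
    "real (card Bad) \<le> 2 * 4 ^ card V * \<rho> * real (card (PiE V A))"
    "\<And>p r. p \<in> PiE V A - Bad \<Longrightarrow> \<exists>S. finite S
       \<and> (\<forall>s\<in>S. s > 0 \<and> real s \<le> (\<Prod>i\<in>U. x i) \<and> (\<forall>q. prime q \<and> q dvd s \<longrightarrow> q \<le> Y)
            \<and> int (\<Prod>i\<in>V. p i) dvd int s - r)
       \<and> real (card (prods E U)) \<le> 2 * real (\<Prod>i\<in>V. p i) * real (card S)"
proof
  define err where "err p = (\<Sum>J\<in>Pow V. total_err p J)" for p
  \<comment> \<open>Markov's inequality. Summing the error over every J beforehand makes the bad set
    independent of the residue r and of its gcd with the modulus.\<close>
  define Bad where "Bad = {p \<in> PiE V A. err p > 1 / 2}"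
  show "Bad \<subseteq> PiE V A" by (auto simp: Bad_def)
  have finP: "finite (PiE V A)" using finV finA by (intro finite_PiE)
  have err0: "err p \<ge> 0" if "p \<in> PiE V A" for p unfolding err_def using that by (intro sum_nonneg total_err_nonneg)
  have "real (card Bad) * (1 / 2) = (\<Sum>p\<in>Bad. 1 / 2)" by simp
  also have "\<dots> \<le> (\<Sum>p\<in>Bad. err p)" by (intro sum_mono) (auto simp: Bad_def)
  also have "\<dots> \<le> (\<Sum>p\<in>PiE V A. err p)" using finP err0 by (intro sum_mono2) (auto simp: Bad_def)
  also have "\<dots> \<le> 4 ^ card V * \<rho> * real (card (PiE V A))" unfolding err_def by (rule sum_total_err_le[OF assms(1)])
  finally show "real (card Bad) \<le> 2 * 4 ^ card V * \<rho> * real (card (PiE V A))" by simp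
  fix p and r :: int
  assume pp: "p \<in> PiE V A - Bad"
  then have p: "p \<in> PiE V A" and e: "err p \<le> 1 / 2" by (auto simp: Bad_def)
  define J where "J = {i \<in> V. int (p i) dvd r}"
  have J: "J \<subseteq> V" "J \<subseteq> U" "finite J" using VU finV by (auto simp: J_def)
  have pA: "p i \<in> A i" if "i \<in> V" for i using p that by auto
  have pp: "prime (p i)" if "i \<in> V" for i using primeA[OF that pA[OF that]] .
  have injV: "inj_on p V" using inj_on_PiE_disjoint[OF disjA p] by blast
  have dvdI: "int (\<Prod>i\<in>Q. p i) dvd z" if "Q \<subseteq> V" "\<And>i. i \<in> Q \<Longrightarrow> int (p i) dvd z" for Q z
    using that finV injV pp finite_subset inj_on_subset
    by (intro prod_distinct_primes_dvd) blast+
  have "total_err p J \<le> err p"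
    unfolding err_def using J finV total_err_nonneg[OF p] by (intro member_le_sum) auto
  then have eJ: "total_err p J \<le> 1 / 2" using e by linarith
  define g where "g = (\<Prod>i\<in>J. p i)"
  have "int g dvd r" unfolding g_def by (rule dvdI) (use J in \<open>auto simp: J_def\<close>)
  then obtain r' where r': "r = int g * r'" by blast
  have g0: "g > 0" unfolding g_def using pp J prime_gt_0_nat by (intro prod_pos) blast
  define T where "T = {s \<in> prods E (U - J). \<forall>i\<in>V - J. int (p i) dvd int s - r'}"
  have finT: "finite T" unfolding T_def using finite_prods[of "U - J"] by auto
  have cT: "real (card (prods E (U - J))) \<le> 2 * real (\<Prod>i\<in>V - J. p i) * real (card T)"
    unfolding T_def
  proof (rule residue_class_count[OF p J(1) eJ])
    fix i assume "i \<in> V - J"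
    then show "\<not> int (p i) dvd r'" unfolding J_def r' by auto
  qed
  have Vsplit: "(\<Prod>i\<in>V. p i) = (\<Prod>i\<in>V - J. p i) * g" unfolding g_def using finV J by (metis prod.subset_diff)
  show "\<exists>S. finite S
       \<and> (\<forall>s\<in>S. s > 0 \<and> real s \<le> (\<Prod>i\<in>U. x i) \<and> (\<forall>q. prime q \<and> q dvd s \<longrightarrow> q \<le> Y)
            \<and> int (\<Prod>i\<in>V. p i) dvd int s - r)
       \<and> real (card (prods E U)) \<le> 2 * real (\<Prod>i\<in>V. p i) * real (card S)"
  proof (intro exI[of _ "(\<lambda>s. g * s) ` T"] conjI ballI)
    show "finite ((\<lambda>s. g * s) ` T)" using finT by simp
    have "card ((\<lambda>s. g * s) ` T) = card T" using g0 by (intro card_image) (auto simp: inj_on_def)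
    moreover have "real (card (prods E U)) \<le> 2 * real (\<Prod>i\<in>V. p i) * real (card T)"
    proof -
      have "card (prods E U) = (\<Prod>i\<in>U - J. card (E i)) * (\<Prod>i\<in>J. card (E i))"
        unfolding card_prods[OF order_refl] using finU J by (metis prod.subset_diff)
      also have "(\<Prod>i\<in>U - J. card (E i)) = card (prods E (U - J))" by (simp add: card_prods)
      \<comment> \<open>The dropped blocks offered at most g choices by \<open>cardEA\<close>, and
        removing g makes the modulus smaller by exactly the factor g.\<close>
      also have "card (prods E (U - J)) * (\<Prod>i\<in>J. card (E i)) \<le> card (prods E (U - J)) * g"
        unfolding g_def using J cardEA pA by (intro mult_left_mono prod_mono) auto
      finally have "real (card (prods E U)) \<le> real (card (prods E (U - J))) * real g"
        unfolding of_nat_mult[symmetric] by (simp only: of_nat_le_iff)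
      also have "\<dots> \<le> (2 * real (\<Prod>i\<in>V - J. p i) * real (card T)) * real g"
        using cT by (intro mult_right_mono) auto
      finally show ?thesis unfolding Vsplit of_nat_mult by (simp only: ac_simps)
    qed
    ultimately show "real (card (prods E U)) \<le> 2 * real (\<Prod>i\<in>V. p i) * real (card ((\<lambda>s. g * s) ` T))" by simp
    fix n assume "n \<in> (\<lambda>s. g * s) ` T"
    then obtain s where s: "s \<in> prods E (U - J)" "n = g * s" "\<And>i. i \<in> V - J \<Longrightarrow> int (p i) dvd int s - r'"
      by (auto simp: T_def)
    have "s > 0" using prods_pos[OF _ s(1)] by blast
    then show "n > 0" using s g0 by simp
    \<comment> \<open>\<open>x i\<close> bounds the primes of \<open>A i\<close> and of
      \<open>E i\<close> alike, so p i may stand in for the dropped block without enlarging the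
      value.\<close>
    have "real g \<le> (\<Prod>i\<in>J. x i)" unfolding g_def of_nat_prod using J x(1) pA by (intro prod_mono) auto
    moreover have "real s \<le> (\<Prod>i\<in>U - J. x i)" using s(1) x(2) by (intro prods_le) auto
    ultimately have "real g * real s \<le> (\<Prod>i\<in>J. x i) * (\<Prod>i\<in>U - J. x i)" by (intro mult_mono) auto
    also have "\<dots> = (\<Prod>i\<in>U. x i)" using finU J prod.subset_diff[of J U x] by (simp add: mult.commute)
    finally show "real n \<le> (\<Prod>i\<in>U. x i)" by (simp add: s(2))
    have "int (\<Prod>i\<in>V - J. p i) dvd int s - r'" by (rule dvdI) (use s in auto)
    then have "int (\<Prod>i\<in>V - J. p i) * int g dvd (int s - r') * int g" by (rule mult_dvd_mono) simp
    then show "int (\<Prod>i\<in>V. p i) dvd int n - r" unfolding Vsplit s(2) r' by (simp add: algebra_simps)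
    show "\<forall>q. prime q \<and> q dvd n \<longrightarrow> q \<le> Y"
    proof (intro allI impI, elim conjE)
      fix q :: nat assume q: "prime q" "q dvd n"
      then consider "q dvd g" | "q dvd s" unfolding s(2) using prime_dvd_mult_nat by blast
      then show "q \<le> Y"
      proof cases
        case 1
        then obtain i where i: "i \<in> J" "q dvd p i" unfolding g_def using J(3) q(1) prime_dvd_prod_iff by blast
        then have "i \<in> V" using J by blast
        have "q = p i" using primes_dvd_imp_eq[OF q(1) pp[OF \<open>i \<in> V\<close>] i(2)] .
        then show ?thesis using leA[OF \<open>i \<in> V\<close> pA[OF \<open>i \<in> V\<close>]] by simp
      next
        case 2
        then obtain i where "i \<in> U - J" "q \<in> E i" using prods_prime_dvd[OF _ s(1) q(1)] by blast
        then show ?thesis using leE by blast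
      qed
    qed
  qed
qed

end

section \<open>Representations by binary forms\<close>

definition coeff_reps :: "nat \<Rightarrow> int \<Rightarrow> int \<Rightarrow> int \<Rightarrow> int \<Rightarrow> (nat \<Rightarrow> int) set" where
  "coeff_reps d H a b t = {c \<in> PiE {..<d} (\<lambda>_. {-H..H}). (\<Sum>i<d. c i * a ^ (d - i - 1) * b ^ i) = t}"

lemma finite_coeff_reps: "finite (coeff_reps d H a b t)"
  unfolding coeff_reps_def by (rule finite_subset[of _ "PiE {..<d} (\<lambda>_. {-H..H})"]) (auto intro: finite_PiE)

lemma case_nat_in_coeff_reps:
  assumes "c \<in> coeff_reps d H a b t'" "\<bar>x\<bar> \<le> H" "t = x * a ^ d + b * t'"
  shows "case_nat x c \<in> coeff_reps (Suc d) H a b t"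
proof -
  have c: "c \<in> PiE {..<d} (\<lambda>_. {-H..H})" "(\<Sum>i<d. c i * a ^ (d - i - 1) * b ^ i) = t'"
    using assms by (auto simp: coeff_reps_def)
  have "case_nat x c \<in> PiE {..<Suc d} (\<lambda>_. {-H..H})"
    using c(1) assms(2) by (auto simp: PiE_def Pi_def extensional_def split: nat.split)
  moreover have "(\<Sum>i<Suc d. case_nat x c i * a ^ (Suc d - i - 1) * b ^ i) = t"
    unfolding sum.lessThan_Suc_shift using assms(3) c(2)
    by (simp add: sum_distrib_left ac_simps del: sum.lessThan_Suc flip: c(2))
  ultimately show ?thesis by (simp add: coeff_reps_def)
qed

text \<open>Choosing the leading coefficient of the same sign as \<open>t\<close> keeps the remaining target in range, so
  that no factor depending on \<open>d\<close> is lost to the growth of partial sums.\<close>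

lemma card_coeff_reps_ge:
  fixes a b t :: int
  assumes "coprime a b" "0 \<le> a" "a < b" "\<bar>t\<bar> \<le> int q * b * b ^ d"
  shows "q ^ d \<le> card (coeff_reps (Suc d) (int q * b) a b t)"
  using assms(4)
proof (induction d arbitrary: t)
  case 0
  then have "(\<lambda>i\<in>{..<Suc 0}. t) \<in> coeff_reps (Suc 0) (int q * b) a b t"
    by (auto simp: coeff_reps_def)
  then have "card (coeff_reps (Suc 0) (int q * b) a b t) \<noteq> 0"
    using finite_coeff_reps by (metis card_eq_0_iff empty_iff)
  then show ?case by simp
next
  case (Suc d)
  define \<sigma> :: int where "\<sigma> = (if t \<ge> 0 then 1 else -1)"
  have \<sigma>: "\<sigma> * \<sigma> = 1" "\<bar>\<sigma>\<bar> = 1" "\<sigma> * t = \<bar>t\<bar>" by (auto simp: \<sigma>_def)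
  have b: "b > 0" using assms by simp
  have "coprime (a ^ Suc d) b" using assms(1) by simp
  then obtain y where y: "[a ^ Suc d * y = 1] (mod b)" using cong_solve_coprime_int by blast
  \<comment> \<open>The representative in 1..b of |t| / a^(Suc d) modulo b. Adding multiples of b to
    it gives q leading coefficients of absolute value at most q b, each leaving a remainder
    divisible by b.\<close>
  define x0 where "x0 = (y * \<bar>t\<bar> - 1) mod b + 1"
  have x0: "1 \<le> x0" "x0 \<le> b" using pos_mod_bound[OF b, of "y * \<bar>t\<bar> - 1"] pos_mod_sign[OF b, of "y * \<bar>t\<bar> - 1"]
    unfolding x0_def by linarith+
  have x0t: "b dvd \<bar>t\<bar> - x0 * a ^ Suc d"
  proof -
    have "b dvd (y * \<bar>t\<bar>) - x0"
      unfolding x0_def by (metis (no_types, lifting) diff_diff_eq2 diff_add_eq add.commute dvd_minus_mod diff_diff_eq)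
    then have "b dvd a ^ Suc d * (y * \<bar>t\<bar> - x0)" by simp
    moreover have "b dvd (a ^ Suc d * y - 1) * \<bar>t\<bar>" using y by (simp add: cong_iff_dvd_diff)
    ultimately have "b dvd a ^ Suc d * (y * \<bar>t\<bar> - x0) - (a ^ Suc d * y - 1) * \<bar>t\<bar>" by (rule dvd_diff)
    then show ?thesis by (simp add: algebra_simps)
  qed
  define x where "x j = \<sigma> * (x0 + b * int j)" for j
  define t' where "t' j = (t - x j * a ^ Suc d) div b" for j
  have t': "t = x j * a ^ Suc d + b * t' j" for j
  proof -
    have "b dvd \<sigma> * (\<bar>t\<bar> - x0 * a ^ Suc d) - b * (\<sigma> * int j * a ^ Suc d)" using x0t by (intro dvd_diff) auto
    also have "\<sigma> * (\<bar>t\<bar> - x0 * a ^ Suc d) - b * (\<sigma> * int j * a ^ Suc d) = t - x j * a ^ Suc d"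
      using \<sigma> by (simp add: x_def algebra_simps flip: \<sigma>(3))
    finally show ?thesis by (simp add: t'_def)
  qed
  have xj: "1 \<le> x0 + b * int j" "x0 + b * int j \<le> int q * b" if "j < q" for j
  proof -
    show "1 \<le> x0 + b * int j" using x0 b by (simp add: add_increasing2)
    have "x0 + b * int j \<le> b * (int j + 1)" using x0 by (simp add: algebra_simps)
    also have "\<dots> \<le> b * int q" using that b by (intro mult_left_mono) auto
    finally show "x0 + b * int j \<le> int q * b" by (simp add: mult.commute)
  qed
  have bound: "\<bar>t' j\<bar> \<le> int q * b * b ^ d" if j: "j < q" for j
  proof -
    have "\<sigma> * (b * t' j) = \<bar>t\<bar> - (x0 + b * int j) * a ^ Suc d"
    proof -
      have "b * t' j = t - x j * a ^ Suc d" using t'[of j] by linarith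
      then have "\<sigma> * (b * t' j) = \<sigma> * t - (\<sigma> * \<sigma>) * ((x0 + b * int j) * a ^ Suc d)"
        by (simp only: x_def right_diff_distrib mult.assoc)
      then show ?thesis by (simp only: \<sigma> mult_1)
    qed
    moreover have "0 \<le> (x0 + b * int j) * a ^ Suc d" using xj[OF j] assms(2) by simp
    moreover have "(x0 + b * int j) * a ^ Suc d \<le> (int q * b) * b ^ Suc d"
      using xj[OF j] assms(2,3) b by (intro mult_mono power_mono) auto
    \<comment> \<open>Both |t| and the subtracted term lie between 0 and the bound, hence so does
      the absolute value of their difference.\<close>
    ultimately have "\<bar>\<sigma> * (b * t' j)\<bar> \<le> int q * b * b ^ Suc d" using Suc.prems by linarith
    then have "b * \<bar>t' j\<bar> \<le> b * (int q * b * b ^ d)" using \<sigma>(2) b by (simp add: abs_mult algebra_simps)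
    then show ?thesis using b by simp
  qed
  let ?S = "Sigma {..<q} (\<lambda>j. coeff_reps (Suc d) (int q * b) a b (t' j))"
  let ?f = "\<lambda>(j, c). case_nat (x j) c"
  have inj: "inj_on ?f ?S"
  proof (rule inj_onI, clarify)
    fix j c k e assume "case_nat (x j) c = case_nat (x k) e"
    then have *: "case_nat (x j) c n = case_nat (x k) e n" for n by simp
    have "x j = x k" using *[of 0] by simp
    then have "\<sigma> * (\<sigma> * (b * int j)) = \<sigma> * (\<sigma> * (b * int k))" by (simp add: x_def algebra_simps)
    then have "j = k" using \<sigma>(1) b by (simp flip: mult.assoc)
    moreover have "c = e" using *[of "Suc _"] by auto
    ultimately show "j = k \<and> c = e" by simp
  qed
  have sub: "?f ` ?S \<subseteq> coeff_reps (Suc (Suc d)) (int q * b) a b t"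
  proof clarify
    fix j c assume j: "j < q" and c: "c \<in> coeff_reps (Suc d) (int q * b) a b (t' j)"
    show "case_nat (x j) c \<in> coeff_reps (Suc (Suc d)) (int q * b) a b t"
      using xj[OF j] \<sigma>(2) t'[of j] by (intro case_nat_in_coeff_reps[OF c]) (auto simp: x_def abs_mult)
  qed
  have "q ^ Suc d = (\<Sum>j<q. q ^ d)" by simp
  also have "\<dots> \<le> (\<Sum>j<q. card (coeff_reps (Suc d) (int q * b) a b (t' j)))"
    using Suc.IH bound by (intro sum_mono) auto
  also have "\<dots> = card ?S" by (simp add: finite_coeff_reps)
  also have "\<dots> = card (?f ` ?S)" by (simp add: card_image[OF inj])
  also have "\<dots> \<le> card (coeff_reps (Suc (Suc d)) (int q * b) a b t)"
    by (intro card_mono finite_coeff_reps sub)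
  finally show ?case .
qed

section \<open>Primes in intervals\<close>

definition primes_upto :: "nat \<Rightarrow> nat set" where "primes_upto n = {p. prime p \<and> p \<le> n}"

lemma finite_primes_upto [simp]: "finite (primes_upto n)"
  unfolding primes_upto_def by (rule finite_subset[of _ "{..n}"]) auto

lemma multiplicity_eq_sum_dvd:
  fixes p n N :: nat
  assumes "prime p" "0 < n" "n \<le> N"
  shows "multiplicity p n = (\<Sum>i\<in>{1..N}. if p ^ i dvd n then 1 else 0)"
proof -
  have p: "p > 1" using assms(1) prime_gt_1_nat by blast
  have *: "p ^ i dvd n \<longleftrightarrow> i \<le> multiplicity p n" for i
    using assms p by (intro power_dvd_iff_le_multiplicity) auto
  have "p ^ multiplicity p n \<le> n" using assms(2) multiplicity_dvd by (intro dvd_imp_le) auto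
  moreover have "multiplicity p n < p ^ multiplicity p n" using p by (intro power_gt_expt) auto 
  ultimately have "multiplicity p n \<le> N" using assms(3) by linarith
  then have "{i \<in> {1..N}. i \<le> multiplicity p n} = {1..multiplicity p n}" by auto
  then show ?thesis unfolding * by (simp flip: sum.inter_filter)
qed

lemma legendre_formula:
  assumes "prime p" "n \<le> N"
  shows "multiplicity p (fact n :: nat) = (\<Sum>i\<in>{1..N}. n div p ^ i)"
  using assms(2)
proof (induction n)
  case (Suc n)
  have "multiplicity p (fact (Suc n) :: nat) = multiplicity p (Suc n) + multiplicity p (fact n :: nat)"
    unfolding fact_Suc using assms(1) by (subst prime_elem_multiplicity_mult_distrib) auto
  also have "\<dots> = (\<Sum>i\<in>{1..N}. (if p ^ i dvd Suc n then 1 else 0) + n div p ^ i)"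
    using Suc multiplicity_eq_sum_dvd[OF assms(1) _ Suc.prems] by (simp add: sum.distrib)
  also have "\<dots> = (\<Sum>i\<in>{1..N}. Suc n div p ^ i)"
    by (intro sum.cong refl) (auto simp: div_Suc dvd_eq_mod_eq_0)
  finally show ?case .
qed auto

text \<open>By Legendre's formula the exponent is the sum over i of floor(2n/p^i) - 2 floor(n/p^i).
  Each summand is at most 1, and it vanishes once p^i > 2n.\<close>

lemma prime_power_central_binomial_le:
  assumes "prime p" "n > 0"
  shows "p ^ multiplicity p (2 * n choose n) \<le> 2 * n"
proof -
  have p: "p > 1" using assms(1) prime_gt_1_nat by blast
  define S where "S = {i \<in> {1..2*n}. p ^ i \<le> 2 * n}"
  have finS: "finite S" by (simp add: S_def)
  have "multiplicity p (fact (2 * n) :: nat) = multiplicity p ((2 * n choose n) * fact n * fact n)"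
    using binomial_fact_lemma[of n "2 * n"] by (simp add: ac_simps)
  also have "\<dots> = multiplicity p (2 * n choose n) + multiplicity p (fact n :: nat) + multiplicity p (fact n :: nat)"
    using assms(1) by (subst prime_elem_multiplicity_mult_distrib, auto)+
  finally have "multiplicity p (2 * n choose n) + 2 * (\<Sum>i\<in>{1..2*n}. n div p ^ i) = (\<Sum>i\<in>{1..2*n}. 2 * n div p ^ i)"
    using legendre_formula[OF assms(1), of n "2 * n"] legendre_formula[OF assms(1), of "2 * n" "2 * n"] by simp
  also have "\<dots> \<le> (\<Sum>i\<in>{1..2*n}. 2 * (n div p ^ i) + (if p ^ i \<le> 2 * n then 1 else 0))"
  proof (intro sum_mono)
    fix i
    have "2 * n div p ^ i \<le> 2 * (n div p ^ i) + 1"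
    proof -
      have "p ^ i > 0" using p by simp
      then have "n < p ^ i * (n div p ^ i + 1)" by (simp add: dividend_less_times_div)
      then have "2 * n < (2 * (n div p ^ i) + 2) * p ^ i" by (simp add: algebra_simps)
      then have "2 * n div p ^ i < 2 * (n div p ^ i) + 2" by (simp add: less_mult_imp_div_less)
      then show ?thesis by simp
    qed
    then show "2 * n div p ^ i \<le> 2 * (n div p ^ i) + (if p ^ i \<le> 2 * n then 1 else 0)" by auto
  qed
  also have "\<dots> = 2 * (\<Sum>i\<in>{1..2*n}. n div p ^ i) + card S"
    by (simp add: sum.distrib sum_distrib_left S_def flip: sum.inter_filter)
  finally have m: "multiplicity p (2 * n choose n) \<le> card S" by simp
  show ?thesis
  proof (cases "S = {}")
    case True
    then show ?thesis using m assms by simp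
  next
    case False
    have "S \<subseteq> {1..Max S}" using finS by (auto simp: S_def)
    then have "card S \<le> Max S" using card_mono[of "{1..Max S}" S] by simp
    then have "p ^ multiplicity p (2 * n choose n) \<le> p ^ Max S" using m p by (intro power_increasing) auto
    also have "\<dots> \<le> 2 * n" using Max_in[OF finS False] by (simp add: S_def)
    finally show ?thesis .
  qed
qed

lemma central_binomial_le_primes:
  assumes "n > 0"
  shows "(2 * n choose n) \<le> (2 * n) ^ card (primes_upto (2 * n))"
proof -
  let ?C = "2 * n choose n"
  have C: "?C > 0" by simp
  have sub: "prime_factors ?C \<subseteq> primes_upto (2 * n)"
  proof
    fix p assume "p \<in> prime_factors ?C"
    then have p: "prime p" "p dvd ?C" by (auto simp: in_prime_factors_iff)
    have "?C dvd fact (2 * n)" using binomial_fact_lemma[of n "2 * n"] by (metis dvd_triv_right le_add2 mult_2)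
    then have "p dvd fact (2 * n)" using p by (rule_tac dvd_trans)
    then show "p \<in> primes_upto (2 * n)" using p by (simp add: prime_dvd_fact_iff primes_upto_def)
  qed
  have "?C = (\<Prod>p\<in>prime_factors ?C. p ^ multiplicity p ?C)"
    using prime_factorization_nat[OF C] .
  also have "\<dots> \<le> (\<Prod>p\<in>prime_factors ?C. 2 * n)"
    using assms by (intro prod_mono) (auto simp: in_prime_factors_iff prime_power_central_binomial_le)
  also have "\<dots> = (2 * n) ^ card (prime_factors ?C)" by (rule prod_constant)
  also have "\<dots> \<le> (2 * n) ^ card (primes_upto (2 * n))"
    using assms sub by (intro power_increasing card_mono) auto
  finally show ?thesis .
qed

lemma primes_upto_lower:
  assumes "n > 0"
  shows "real n * ln 4 \<le> (real (card (primes_upto (2 * n))) + 1) * ln (real (2 * n))"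
proof -
  have "4 ^ n / (2 * real n) \<le> real (2 * n choose n)" using central_binomial_lower_bound[OF assms] by simp
  also have "\<dots> \<le> real (2 * n) ^ card (primes_upto (2 * n))"
    using central_binomial_le_primes[OF assms] by (simp flip: of_nat_power of_nat_mult del: of_nat_mult)
  finally have "4 ^ n \<le> real (2 * n) ^ Suc (card (primes_upto (2 * n)))"
    using assms by (simp add: field_simps)
  then have "ln (4 ^ n :: real) \<le> ln (real (2 * n) ^ Suc (card (primes_upto (2 * n))))"
    using assms by (subst ln_le_cancel_iff) auto
  then show ?thesis using assms by (simp only: ln_realpow) (simp add: algebra_simps)
qed

text \<open>Erdos's induction: for n = 2m + 1 the primes in (m + 1, 2m + 1] all divide a binomial
  coefficient of size at most 4^m, and an even n > 2 adds no prime.\<close>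

lemma primorial_le: "\<Prod>(primes_upto n) \<le> 4 ^ n"
proof (induction n rule: less_induct)
  case (less n)
  consider "n \<le> 2" | "even n" "n > 2" | "odd n" "n > 2" by linarith
  then show ?case
  proof cases
    case 1
    then have "primes_upto n = (if n = 2 then {2} else {})"
      by (auto simp: primes_upto_def dest: prime_ge_2_nat)
    then show ?thesis using 1 by auto
  next
    case 2
    then have "\<not> prime n" using prime_odd_nat by blast
    then have "primes_upto n = primes_upto (n - 1)" using 2
      by (auto simp: primes_upto_def) (metis Suc_pred le_Suc_eq less_imp_le_nat not_gr0 not_less_eq_eq zero_le)
    also have "\<Prod>\<dots> \<le> 4 ^ (n - 1)" using less[of "n - 1"] 2 by simp
    also have "\<dots> \<le> 4 ^ n" by (intro power_increasing) auto
    finally show ?thesis .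
  next
    case 3
    then obtain m where m: "n = 2 * m + 1" by (elim oddE)
    then have "m > 0" using 3 by auto
    define Q where "Q = {p. prime p \<and> m + 1 < p \<and> p \<le> 2 * m + 1}"
    have fQ: "finite Q" unfolding Q_def by (rule finite_subset[of _ "{..2*m+1}"]) auto
    have split: "primes_upto n = primes_upto (m + 1) \<union> Q" "primes_upto (m + 1) \<inter> Q = {}"
      using \<open>m > 0\<close> by (auto simp: primes_upto_def Q_def m)
    have "\<Prod>Q dvd (2 * m + 1 choose m)"
    proof -
      have "p dvd (2 * m + 1 choose m)" if "p \<in> Q" for p
      proof -
        have p: "prime p" "m + 1 < p" "p \<le> 2 * m + 1" using that by (auto simp: Q_def)
        have "fact m * fact (2 * m + 1 - m) * (2 * m + 1 choose m) = fact (2 * m + 1)"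
          by (rule binomial_fact_lemma) simp
        moreover have "2 * m + 1 - m = m + 1" by simp
        moreover have "p dvd fact (2 * m + 1)" using p by (simp only: prime_dvd_fact_iff)
        ultimately have "p dvd fact m * fact (m + 1) * (2 * m + 1 choose m)" by (simp only:)
        then show ?thesis using p by (simp only: prime_dvd_mult_iff prime_dvd_fact_iff) auto
      qed
      then have "int (\<Prod>i\<in>Q. i) dvd int (2 * m + 1 choose m)"
        using fQ by (intro prod_distinct_primes_dvd) (auto simp: Q_def)
      then show ?thesis by (simp only: int_dvd_int_iff)
    qed
    then have "\<Prod>Q \<le> (2 * m + 1 choose m)" by (intro dvd_imp_le) auto
    also have "\<dots> \<le> 4 ^ m"
    proof -
      have "2 * (2 * m + 1 choose m) = (2 * m + 1 choose m) + (2 * m + 1 choose (m + 1))"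
        using binomial_symmetric[of m "2 * m + 1"] by simp
      also have "\<dots> = (\<Sum>k\<in>{m, m + 1}. 2 * m + 1 choose k)" by simp
      also have "\<dots> \<le> (\<Sum>k\<le>2 * m + 1. 2 * m + 1 choose k)" by (intro sum_mono2) auto
      also have "\<dots> = 2 ^ (2 * m + 1)" by (rule choose_row_sum)
      also have "\<dots> = 2 * 4 ^ m" by (simp add: power_mult)
      finally show ?thesis by simp
    qed
    finally have "\<Prod>Q \<le> 4 ^ m" .
    moreover have "\<Prod>(primes_upto (m + 1)) \<le> 4 ^ (m + 1)" using less[of "m + 1"] m \<open>m > 0\<close> by simp
    ultimately have "\<Prod>(primes_upto n) \<le> 4 ^ (m + 1) * 4 ^ m"
      unfolding split(1) using split(2) fQ by (subst prod.union_disjoint) (auto intro: mult_mono)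
    then show ?thesis by (simp add: m mult_2 power_add)
  qed
qed

text \<open>Each prime above sqrt n contributes at least sqrt n to the primorial, which limits their
  number; the remaining primes are at most sqrt n in number.\<close>

lemma primes_upto_upper:
  assumes "n \<ge> 2"
  shows "real (card (primes_upto n)) \<le> sqrt (real n) + 2 * real n * ln 4 / ln (real n)"
proof -
  define Q where "Q = {p \<in> primes_upto n. sqrt (real n) < real p}"
  define R where "R = {p \<in> primes_upto n. \<not> sqrt (real n) < real p}"
  have fin: "finite Q" "finite R" by (auto simp: Q_def R_def)
  have ln: "ln (real n) > 0" using assms by simp
  have "sqrt (real n) ^ card Q = (\<Prod>p\<in>Q. sqrt (real n))" by simp
  also have "\<dots> \<le> (\<Prod>p\<in>Q. real p)" by (intro prod_mono) (auto simp: Q_def)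
  also have "\<dots> = real (\<Prod>Q)" by simp
  also have "\<dots> \<le> real (\<Prod>(primes_upto n))"
  proof -
    have "\<Prod>Q dvd \<Prod>(primes_upto n)" by (rule prod_dvd_prod_subset) (auto simp: Q_def)
    moreover have "\<Prod>(primes_upto n) > 0" by (rule prod_pos) (auto simp: primes_upto_def prime_gt_0_nat)
    ultimately show ?thesis by (simp only: of_nat_le_iff dvd_imp_le)
  qed
  also have "\<dots> \<le> real (4 ^ n)" by (simp only: of_nat_le_iff primorial_le)
  finally have "sqrt (real n) ^ card Q \<le> 4 ^ n" by simp
  then have "ln (sqrt (real n) ^ card Q) \<le> ln (4 ^ n)" using assms by (subst ln_le_cancel_iff) auto
  then have "real (card Q) * (ln (real n) / 2) \<le> real n * ln 4" using assms by (simp add: ln_realpow ln_sqrt)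
  then have 1: "real (card Q) \<le> 2 * real n * ln 4 / ln (real n)" using ln by (simp add: field_simps)
  have "R \<subseteq> {1..nat \<lfloor>sqrt (real n)\<rfloor>}"
    by (auto simp: R_def primes_upto_def le_nat_floor Suc_le_eq prime_gt_0_nat)
  then have "card R \<le> nat \<lfloor>sqrt (real n)\<rfloor>" using card_mono[of "{1..nat \<lfloor>sqrt (real n)\<rfloor>}" R] by simp
  then have 2: "real (card R) \<le> sqrt (real n)"
    using of_nat_floor[of "sqrt (real n)"] by (simp add: order_trans[OF of_nat_mono])
  have "primes_upto n = Q \<union> R" "Q \<inter> R = {}" by (auto simp: Q_def R_def)
  then have "card (primes_upto n) = card Q + card R" using fin by (simp add: card_Un_disjoint)
  then show ?thesis using 1 2 by simp
qed

text \<open>In units of ln 4 * z / ln z the two Chebyshev-type bounds give 1/2 for the primes up to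
  z and 1/8 for those up to z/16. With these constants a ratio of 4 would leave no surplus; 16
  leaves ample room, and 10 is a generous constant.\<close>

lemma many_primes_in_interval:
  "\<forall>\<^sub>F z in at_top. z / (10 * ln z) \<le> real (card {p::nat. prime p \<and> z / 16 < real p \<and> real p \<le> z})"
proof -
  have 1: "\<forall>\<^sub>F z::real in at_top. z / (10 * ln z) + 1 + sqrt (z / 16) \<le> (z / 2 - 1) / ln z - z / (8 * ln (z / 16 - 1))"
    by real_asymp
  have "\<forall>\<^sub>F z::real in at_top. z \<ge> 100" by (rule eventually_ge_at_top)
  then show ?thesis using 1
  proof eventually_elim
    case (elim z)
    define n where "n = nat \<lfloor>z / 2\<rfloor>"
    define k where "k = nat \<lfloor>z / 16\<rfloor>"
    have n: "z / 2 - 1 \<le> real n" "real n \<le> z / 2" "n > 0" using elim(1) by (auto simp: n_def) linarith+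
    have k: "z / 16 - 1 \<le> real k" "real k \<le> z / 16" "k \<ge> 2" using elim(1) by (auto simp: k_def) linarith+
    let ?P = "{p::nat. prime p \<and> z / 16 < real p \<and> real p \<le> z}"
    have sub: "primes_upto (2 * n) \<subseteq> primes_upto k \<union> ?P"
    proof
      fix p assume p: "p \<in> primes_upto (2 * n)"
      then have "real p \<le> z" using n by (auto simp: primes_upto_def)
      moreover have "p \<le> k" if "\<not> z / 16 < real p" using that by (simp add: k_def le_nat_floor)
      ultimately show "p \<in> primes_upto k \<union> ?P" using p by (auto simp: primes_upto_def)
    qed
    have fin: "finite ?P" by (rule finite_subset[of _ "{..nat \<lfloor>z\<rfloor>}"]) (auto simp: le_nat_floor)
    have "card (primes_upto (2 * n)) \<le> card (primes_upto k \<union> ?P)" using sub fin by (intro card_mono) auto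
    also have "\<dots> \<le> card (primes_upto k) + card ?P" by (rule card_Un_le)
    finally have c: "real (card (primes_upto (2 * n))) \<le> real (card (primes_upto k)) + real (card ?P)" by simp
    have lz: "ln z > 0" using elim(1) by simp
    have "(z / 2 - 1) * ln 4 \<le> real n * ln 4" using n by (intro mult_right_mono) auto
    also have "\<dots> \<le> (real (card (primes_upto (2 * n))) + 1) * ln (real (2 * n))" by (rule primes_upto_lower[OF n(3)])
    also have "\<dots> \<le> (real (card (primes_upto (2 * n))) + 1) * ln z" using n elim(1) by (intro mult_left_mono) auto
    finally have lo: "(z / 2 - 1) / ln z * ln 4 \<le> real (card (primes_upto (2 * n))) + 1"
      using lz by (simp add: field_simps)
    have "real (card (primes_upto k)) \<le> sqrt (real k) + 2 * real k * ln 4 / ln (real k)" by (rule primes_upto_upper[OF k(3)])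
    also have "\<dots> \<le> sqrt (z / 16) + 2 * (z / 16) * ln 4 / ln (z / 16 - 1)"
      using k elim(1) by (intro add_mono real_sqrt_le_mono frac_le mult_right_mono mult_left_mono) auto
    finally have up: "real (card (primes_upto k)) \<le> sqrt (z / 16) + z / (8 * ln (z / 16 - 1)) * ln 4" by simp
    have l4: "ln (4::real) \<ge> 1" using exp_le ln_ge_iff[of 4 1] by simp
    have "0 \<le> z / (10 * ln z)" "0 \<le> sqrt (z / 16)" using lz elim(1) by auto
    then have "0 \<le> (z / 2 - 1) / ln z - z / (8 * ln (z / 16 - 1))" using elim(2) by linarith
    then have "((z / 2 - 1) / ln z - z / (8 * ln (z / 16 - 1))) * 1 \<le> ((z / 2 - 1) / ln z - z / (8 * ln (z / 16 - 1))) * ln 4"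
      using l4 by (rule_tac mult_left_mono)
    then show ?case using elim(2) lo up c unfolding left_diff_distrib by linarith
  qed
qed

section \<open>From residue classes to smooth values\<close>

lemma coeff_reps_disjoint:
  "t \<noteq> t' \<Longrightarrow> coeff_reps d H a b t \<inter> coeff_reps d H a b t' = {}"
  by (auto simp: coeff_reps_def)

text \<open>A union bound over the prime factors of k. It is efficient because the moduli have few
  prime factors, all of them large.\<close>

lemma coprime_count:
  fixes k :: nat and \<alpha> \<beta> w :: real
  assumes "k > 0" "\<alpha> \<le> \<beta>" "w > 0" and v: "card (prime_factors k) \<le> v" and w: "\<And>p. prime p \<Longrightarrow> p dvd k \<Longrightarrow> w \<le> real p"
  shows "(\<beta> - \<alpha>) - 1 - real v * ((\<beta> - \<alpha>) / w + 1) \<le> real (card {b::int. \<alpha> \<le> of_int b \<and> of_int b \<le> \<beta> \<and> coprime b (int k)})"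
proof -
  define I where "I = {b::int. \<alpha> \<le> of_int b \<and> of_int b \<le> \<beta>}"
  have I: "I = {\<lceil>\<alpha>\<rceil>..\<lfloor>\<beta>\<rfloor>}" by (auto simp: I_def ceiling_le_iff le_floor_iff)
  have mult: "real (card {b \<in> I. int p dvd b}) \<le> (\<beta> - \<alpha>) / real p + 1" if p: "p > 0" for p :: nat
  proof -
    let ?J = "{\<lceil>\<alpha> / real p\<rceil>..\<lfloor>\<beta> / real p\<rfloor>}"
    have "{b \<in> I. int p dvd b} \<subseteq> (\<lambda>j. int p * j) ` ?J"
    proof
      fix b assume b: "b \<in> {b \<in> I. int p dvd b}"
      then obtain j where "b = int p * j" by blast
      then show "b \<in> (\<lambda>j. int p * j) ` ?J" using b p
        by (auto simp: I_def ceiling_le_iff le_floor_iff field_simps intro!: image_eqI[of _ _ j])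
    qed
    then have "card {b \<in> I. int p dvd b} \<le> card ?J" by (rule surj_card_le[rotated]) simp
    also have "card ?J = nat (\<lfloor>\<beta> / real p\<rfloor> - \<lceil>\<alpha> / real p\<rceil> + 1)" by simp
    finally have "real (card {b \<in> I. int p dvd b}) \<le> real (nat (\<lfloor>\<beta> / real p\<rfloor> - \<lceil>\<alpha> / real p\<rceil> + 1))" by simp
    also have "\<dots> \<le> \<beta> / real p - \<alpha> / real p + 1"
    proof -
      have "\<alpha> / real p \<le> \<beta> / real p" using assms(2) p by (simp add: divide_right_mono)
      then show ?thesis by linarith
    qed
    finally show ?thesis by (simp add: diff_divide_distrib)
  qed
  have "I \<subseteq> {b \<in> I. coprime b (int k)} \<union> (\<Union>p\<in>prime_factors k. {b \<in> I. int p dvd b})"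
  proof
    fix b assume b: "b \<in> I"
    show "b \<in> {b \<in> I. coprime b (int k)} \<union> (\<Union>p\<in>prime_factors k. {b \<in> I. int p dvd b})"
    proof (cases "coprime b (int k)")
      case False
      then obtain c where c: "c dvd b" "c dvd int k" "\<not> is_unit c" by (auto elim: not_coprimeE)
      have "c \<noteq> 0" using c(2) assms(1) by auto
      then obtain q where q: "q dvd c" "prime q" using c(3) prime_divisor_exists by blast
      then have "q > 0" using prime_gt_0_int by blast
      define p where "p = nat q"
      have qp: "q = int p" using \<open>q > 0\<close> by (simp add: p_def)
      have "int p dvd int k" "int p dvd b"
        using dvd_trans[OF q(1) c(2)] dvd_trans[OF q(1) c(1)] by (simp_all only: qp)
      then have "prime p" "p dvd k" "int p dvd b" using q(2) by (auto simp: qp)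
      then show ?thesis using b assms(1) by (auto simp: in_prime_factors_iff)
    qed (use b in auto)
  qed
  note sub = this
  have finI: "finite I" by (simp add: I)
  have "card I \<le> card ({b \<in> I. coprime b (int k)} \<union> (\<Union>p\<in>prime_factors k. {b \<in> I. int p dvd b}))"
    by (rule card_mono[OF _ sub]) (simp add: finI)
  also have "\<dots> \<le> card {b \<in> I. coprime b (int k)} + card (\<Union>p\<in>prime_factors k. {b \<in> I. int p dvd b})"
    by (rule card_Un_le)
  also have "card (\<Union>p\<in>prime_factors k. {b \<in> I. int p dvd b}) \<le> (\<Sum>p\<in>prime_factors k. card {b \<in> I. int p dvd b})"
    by (rule card_UN_le) simp
  finally have "card I \<le> card {b \<in> I. coprime b (int k)} + (\<Sum>p\<in>prime_factors k. card {b \<in> I. int p dvd b})"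
    by simp
  from of_nat_mono[OF this, where 'a = real]
  have "real (card I) \<le> real (card {b \<in> I. coprime b (int k)}) + (\<Sum>p\<in>prime_factors k. real (card {b \<in> I. int p dvd b}))"
    by (simp only: of_nat_sum of_nat_add)
  also have "(\<Sum>p\<in>prime_factors k. real (card {b \<in> I. int p dvd b})) \<le> (\<Sum>p\<in>prime_factors k. (\<beta> - \<alpha>) / w + 1)"
  proof (intro sum_mono)
    fix p assume "p \<in> prime_factors k"
    then have p: "prime p" "p dvd k" by (auto simp: in_prime_factors_iff)
    have "(\<beta> - \<alpha>) / real p \<le> (\<beta> - \<alpha>) / w" using w[OF p] assms by (intro divide_left_mono) auto
    then show "real (card {b \<in> I. int p dvd b}) \<le> (\<beta> - \<alpha>) / w + 1"
      using mult[of p] p by (simp add: prime_gt_0_nat)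
  qed
  also have "\<dots> \<le> real v * ((\<beta> - \<alpha>) / w + 1)"
    using v assms by (simp add: mult_right_mono)
  finally have "real (card I) \<le> real (card {b \<in> I. coprime b (int k)}) + real v * ((\<beta> - \<alpha>) / w + 1)" by simp
  moreover have "\<beta> - \<alpha> - 1 \<le> real (card I)"
  proof -
    have "real (card I) = real (nat (\<lfloor>\<beta>\<rfloor> - \<lceil>\<alpha>\<rceil> + 1))" by (simp add: I)
    then show ?thesis by linarith
  qed
  ultimately show ?thesis by (simp add: I_def conj_assoc)
qed

section \<open>From smooth numbers in residue classes to points of the random polynomial\<close>

lemma finite_Xset: "finite (Xset n m d c \<sigma> \<beta> \<beta>')"
proof -
  let ?N = "\<lceil>Lf (real n) (1/3) \<sigma> / 2\<rceil>"
  have "Xset n m d c \<sigma> \<beta> \<beta>' \<subseteq> {0..?N} \<times> {-?N..?N}"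
  proof clarify
    fix a b assume "(a, b) \<in> Xset n m d c \<sigma> \<beta> \<beta>'"
    then have "0 \<le> a" "a < \<bar>b\<bar>" "real_of_int \<bar>b\<bar> \<le> Lf (real n) (1/3) \<sigma> / 2" by (auto simp: Xset_def)
    moreover from this have "\<bar>b\<bar> \<le> ?N" by linarith
    ultimately show "a \<in> {0..?N} \<and> b \<in> {-?N..?N}" by auto
  qed
  then show ?thesis by (rule finite_subset) auto
qed

lemma finite_Mset: "finite (Mset n \<delta> d)"
proof -
  have "Mset n \<delta> d \<subseteq> {\<lfloor>2 powr (- 1 / real d) * Lf (real n) (2/3) (1/\<delta>)\<rfloor>..\<lceil>Lf (real n) (2/3) (1/\<delta>)\<rceil>}"
    unfolding Mset_def by (auto simp: floor_le_iff le_ceiling_iff)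
  then show ?thesis by (rule finite_subset) auto
qed

lemma finite_Iset: "finite (Iset L)"
proof -
  have "Iset L \<subseteq> {\<lfloor>- L / 2\<rfloor>..\<lceil>L / 2\<rceil>}"
    unfolding Iset_def by (auto simp: floor_le_iff le_ceiling_iff)
  then show ?thesis by (rule finite_subset) auto
qed

lemma finite_Cset: "finite (Cset n \<delta> \<kappa> d)"
  unfolding Cset_def by (intro finite_PiE) (auto simp: finite_Iset)

lemma smooth_of_nat:
  assumes "k > 0" "\<And>q. prime q \<Longrightarrow> q dvd k \<Longrightarrow> real q \<le> y"
  shows "smooth y (int k)" "smooth y (- int k)"
proof -
  have "real_of_int p \<le> y" if "prime p" "p dvd int k" for p :: int
  proof -
    have "p = int (nat p)" using prime_gt_0_int[OF that(1)] by simp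
    then show ?thesis using that assms(2)[of "nat p"]
      by (metis int_dvd_int_iff of_int_of_nat_eq prime_int_nat_transfer prime_nat_int_transfer)
  qed
  then show "smooth y (int k)" "smooth y (- int k)" using assms(1) by (auto simp: smooth_def)
qed

lemma fhat_bounds:
  assumes "m > 0" "0 \<le> a" "a \<le> b"
  shows "0 \<le> fhat n m d a b" "fhat n m d a b \<le> int (d + 1) * (m * b ^ d)"
proof -
  have dig: "0 \<le> digit n m i" "digit n m i \<le> m" for i
    using assms(1) by (auto simp: digit_def intro: less_imp_le)
  have *: "0 \<le> digit n m i * a ^ i * b ^ (d - i)" "digit n m i * a ^ i * b ^ (d - i) \<le> m * b ^ d" if "i \<le> d" for i
  proof -
    show "0 \<le> digit n m i * a ^ i * b ^ (d - i)" using dig assms by auto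
    have "digit n m i * a ^ i * b ^ (d - i) \<le> m * b ^ i * b ^ (d - i)"
      using dig assms by (intro mult_mono power_mono) auto
    also have "\<dots> = m * b ^ d" using that by (simp add: mult.assoc flip: power_add)
    finally show "digit n m i * a ^ i * b ^ (d - i) \<le> m * b ^ d" .
  qed
  show "0 \<le> fhat n m d a b" unfolding fhat_def using * by (intro sum_nonneg) auto
  have "fhat n m d a b \<le> (\<Sum>i=0..d. m * b ^ d)" unfolding fhat_def using * by (intro sum_mono) auto
  then show "fhat n m d a b \<le> int (d + 1) * (m * b ^ d)" by simp
qed

lemma fpoly_eq:
  assumes "(\<Sum>i<d. c i * a ^ (d - i - 1) * b ^ i) = t"
  shows "fpoly n m d c a b = fhat n m d a b + (a - b * m) * t"
  unfolding fpoly_def assms[symmetric] sum_distrib_left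
  by (intro arg_cong2[of _ _ _ _ "(+)"] sum.cong refl) (simp add: algebra_simps)

text \<open>Triples (k, b, c) inject into triples (m, c, (a, b)) by m = ceiling(k / b) and a = b m -
  k, since k is recovered as b m - a. The interval for b forces m into \<open>Mset\<close>, and
  coprimality of b and k gives that of a and b. The conditions on q and X allot half of the
  attainable range of k t to the base-m value r and half to s.\<close>

lemma sum_card_Xset_ge:
  fixes n d q :: nat and K :: "nat set" and B :: "nat \<Rightarrow> int set" and \<delta> \<kappa> :: real
  defines "M \<equiv> Lf (real n) (2/3) (1/\<delta>)"
    and "CC \<equiv> Lf (real n) (2/3) (\<kappa> - 1/\<delta>)"
  assumes d: "d > 0" and M: "M \<ge> 4"
    and K: "finite K" "\<And>k. k \<in> K \<Longrightarrow> k > 0" "\<And>k. k \<in> K \<Longrightarrow> Z / 2 \<le> real k \<and> real k \<le> Z"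
      "\<And>k p. k \<in> K \<Longrightarrow> prime p \<Longrightarrow> p dvd k \<Longrightarrow> real p \<le> Lf (real n) (1/3) \<beta>"
    and B: "\<And>k b. k \<in> K \<Longrightarrow> b \<in> B k \<Longrightarrow> real k / (M - 1) \<le> of_int b \<and> of_int b \<le> 2 powr (1 / real d) * (real k / M) \<and> coprime b (int k)"
      "\<And>k. k \<in> K \<Longrightarrow> \<beta>0 \<le> real (card (B k))" "\<beta>0 \<ge> 0"
    and Z: "2 * Z / M \<le> Lf (real n) (1/3) \<sigma> / 2" "Z > 0"
    and q: "q \<ge> 4 * (d + 1)" "real q * (2 * Z / M) < CC"
    and X: "X \<le> real q / 2 * (Z / 2) * (Z / (2 * M)) ^ d"
    and S: "\<And>k r. k \<in> K \<Longrightarrow> \<exists>S. finite S \<and> (\<forall>s\<in>S. s > 0 \<and> real s \<le> X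
        \<and> (\<forall>p. prime p \<and> p dvd s \<longrightarrow> real p \<le> Lf (real n) (1/3) \<beta>') \<and> int k dvd int s - r) \<and> \<sigma>0 \<le> real (card S)" "\<sigma>0 \<ge> 0"
  shows "real (card K) * \<beta>0 * \<sigma>0 * real q ^ (d - 1)
    \<le> (\<Sum>m\<in>Mset n \<delta> d. \<Sum>c\<in>Cset n \<delta> \<kappa> d. real (card (Xset n m d c \<sigma> \<beta> \<beta>')))"
proof -
  define mm where "mm k b = \<lceil>real k / of_int b\<rceil>" for k :: nat and b :: int
  define aa where "aa k b = b * mm k b - int k" for k :: nat and b :: int
  define rr where "rr k b = fhat n (mm k b) d (aa k b) b" for k :: nat and b :: int
  define P where "P k r S \<longleftrightarrow> finite S \<and> (\<forall>s\<in>S. s > 0 \<and> real s \<le> X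
        \<and> (\<forall>p. prime p \<and> p dvd s \<longrightarrow> real p \<le> Lf (real n) (1/3) \<beta>') \<and> int k dvd int s - r) \<and> \<sigma>0 \<le> real (card S)"
    for k :: nat and r :: int and S :: "nat set"
  define SS where "SS k r = (SOME S. P k r S)" for k r
  have "P k r (SS k r)" if "k \<in> K" for k r
    unfolding SS_def using S(1)[OF that, of r] by (intro someI_ex[of "P k r"]) (simp add: P_def)
  then have SS: "\<And>k r. k \<in> K \<Longrightarrow> finite (SS k r)"
    "\<And>k r s. k \<in> K \<Longrightarrow> s \<in> SS k r \<Longrightarrow> s > 0 \<and> real s \<le> X
        \<and> (\<forall>p. prime p \<and> p dvd s \<longrightarrow> real p \<le> Lf (real n) (1/3) \<beta>') \<and> int k dvd int s - r"
    "\<And>k r. k \<in> K \<Longrightarrow> \<sigma>0 \<le> real (card (SS k r))"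
    unfolding P_def by blast+
  define tt where "tt k b s = (rr k b - int s) div int k" for k b s
  define RR where "RR k b s = coeff_reps d (int q * b) (aa k b) b (tt k b s)" for k b s
  define RU where "RU k b = (\<Union>s\<in>SS k (rr k b). RR k b s)" for k b
  have basic: "b > 0 \<and> 0 \<le> aa k b \<and> aa k b < b \<and> mm k b \<ge> 2 \<and> mm k b \<in> Mset n \<delta> d \<and> coprime (aa k b) b
       \<and> real_of_int b \<le> 2 * Z / M \<and> Z / (2 * M) \<le> of_int b"
    if kb: "k \<in> K" "b \<in> B k" for k b
  proof -
    note k = K(2)[OF kb(1)] K(3)[OF kb(1)]
    note b = B(1)[OF kb]
    have "real k / (M - 1) > 0" using k(1) M by simp
    then have rb: "real_of_int b > 0" using b by linarith
    have b0: "b > 0" using rb by simp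
    \<comment> \<open>The bound is M - 1 and not M because m rounds k / b up.\<close>
    have 1: "real k / of_int b \<le> M - 1" using b rb M by (simp add: field_simps)
    have p2: "2 powr (- 1 / real d) * 2 powr (1 / real d) = 1" by (simp flip: powr_add)
    have "2 powr (- 1 / real d) * of_int b \<le> 2 powr (- 1 / real d) * (2 powr (1 / real d) * (real k / M))"
      using b by (intro mult_left_mono) auto
    also have "\<dots> = real k / M" using p2 by (simp flip: mult.assoc)
    finally have 2: "2 powr (- 1 / real d) * M \<le> real k / of_int b" using rb M by (simp add: field_simps)
    have m1: "real k / of_int b \<le> of_int (mm k b)" "of_int (mm k b) < real k / of_int b + 1"
      unfolding mm_def by linarith+
    have d1: "1 / real d \<le> 1" using d by simp
    have "2 powr (- 1 / real d) \<ge> 2 powr (- 1)" using d1 by (intro powr_mono) auto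
    then have half: "2 powr (- 1 / real d) \<ge> 1 / 2" by (simp add: powr_minus)
    then have "2 powr (- 1 / real d) * M \<ge> 1 / 2 * 4" using M by (intro mult_mono) auto
    then have "of_int (mm k b) \<ge> (2::real)" using 2 m1 by linarith
    then have m2: "mm k b \<ge> 2" by simp
    have mM: "mm k b \<in> Mset n \<delta> d" using 1 2 m1 by (simp add: Mset_def M_def)
    have "real k \<le> of_int (b * mm k b)" using m1(1) rb by (simp add: field_simps)
    then have a0: "0 \<le> aa k b" unfolding aa_def by linarith
    have "of_int (b * mm k b) < real k + of_int b" using m1(2) rb by (simp add: field_simps)
    then have a1: "aa k b < b" unfolding aa_def by linarith
    have cop: "coprime (aa k b) b"
    proof -
      have "gcd b (b * mm k b - int k) = gcd b (int k)"
        by (metis add_uminus_conv_diff diff_minus_eq_add gcd_add_mult gcd_neg2_int mult.commute add.commute)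
      then show ?thesis using b unfolding aa_def by (simp add: coprime_iff_gcd_eq_1 gcd.commute)
    qed
    have "2 powr (1 / real d) \<le> 2 powr 1" using d1 by (intro powr_mono) auto
    then have "2 powr (1 / real d) * (real k / M) \<le> 2 * (Z / M)" using k M by (intro mult_mono divide_right_mono) auto
    then have up: "real_of_int b \<le> 2 * Z / M" using b by simp
    have "Z / (2 * M) \<le> real k / M" using k M by (simp add: field_simps)
    also have "\<dots> \<le> real k / (M - 1)" using M by (intro divide_left_mono) auto
    also have "\<dots> \<le> of_int b" using b by simp
    finally show ?thesis using b0 a0 a1 m2 mM cop up by auto
  qed
  have tts: "rr k b - int s = int k * tt k b s" if "k \<in> K" "s \<in> SS k (rr k b)" for k b s
  proof -
    have "int k dvd int s - rr k b" using SS(2)[OF that] by blast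
    then have "int k dvd rr k b - int s" by (simp add: dvd_diff_commute)
    then show ?thesis by (simp add: tt_def)
  qed
  have tbound: "\<bar>tt k b s\<bar> \<le> int q * b * b ^ (d - 1)" if kb: "k \<in> K" "b \<in> B k" "s \<in> SS k (rr k b)" for k b s
  proof -
    note k = K(2)[OF kb(1)] K(3)[OF kb(1)]
    note bb = basic[OF kb(1,2)]
    have rb: "real_of_int b > 0" using bb by simp
    have rk: "real k > 0" using k by simp
    have fh: "0 \<le> rr k b" "rr k b \<le> int (d + 1) * (mm k b * b ^ d)"
      unfolding rr_def using fhat_bounds[of "mm k b" "aa k b" b n d] bb by linarith+
    have "int k = b * mm k b - aa k b" by (simp add: aa_def)
    moreover have "2 * b \<le> b * mm k b" using bb by (simp add: mult.commute mult_left_mono)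
    ultimately have kk: "b * mm k b \<le> 2 * int k" using bb by linarith
    have "2 * rr k b \<le> int (d + 1) * (2 * (mm k b * b ^ d))" using fh by simp
    also have "2 * (mm k b * b ^ d) = 2 * (b * mm k b) * b ^ (d - 1)" using d by (cases d) auto
    also have "int (d + 1) * \<dots> \<le> int (d + 1) * (2 * (2 * int k) * b ^ (d - 1))"
      using kk bb by (intro mult_left_mono mult_right_mono) auto
    also have "\<dots> = int (4 * (d + 1)) * b ^ (d - 1) * int k" by (simp add: algebra_simps)
    also have "\<dots> \<le> int q * b ^ (d - 1) * int k" using q(1) bb by (intro mult_right_mono) (auto simp del: of_nat_mult of_nat_add)
    also have "\<dots> \<le> int q * b ^ d * int k"
      using bb by (intro mult_right_mono mult_left_mono power_increasing) auto
    finally have r1: "2 * rr k b \<le> int q * b ^ d * int k" .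
    have "real s \<le> real q / 2 * (Z / 2) * (Z / (2 * M)) ^ d" using SS(2)[OF kb(1,3)] X by auto
    also have "\<dots> \<le> real q / 2 * real k * of_int b ^ d"
      using bb k Z M by (intro mult_mono power_mono) auto
    finally have "2 * real s \<le> of_int (int q * b ^ d * int k)" by (simp add: algebra_simps)
    then have s1: "2 * int s \<le> int q * b ^ d * int k" by linarith
    have "\<bar>rr k b - int s\<bar> \<le> int q * b ^ d * int k" using r1 s1 fh(1) by linarith
    then have "int k * \<bar>tt k b s\<bar> \<le> int k * (int q * b ^ d)"
      unfolding tts[OF kb(1,3)] abs_mult by (simp add: mult.commute)
    then have "\<bar>tt k b s\<bar> \<le> int q * b ^ d" using k by simp
    then show ?thesis using d by (cases d) (auto simp: algebra_simps)
  qed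
  have mem: "c \<in> Cset n \<delta> \<kappa> d \<and> (aa k b, b) \<in> Xset n (mm k b) d c \<sigma> \<beta> \<beta>'"
    if kb: "k \<in> K" "b \<in> B k" "s \<in> SS k (rr k b)" "c \<in> RR k b s" for k b s c
  proof -
    note bb = basic[OF kb(1,2)]
    have c: "c \<in> PiE {..<d} (\<lambda>_. {- (int q * b)..int q * b})" "(\<Sum>i<d. c i * aa k b ^ (d - i - 1) * b ^ i) = tt k b s"
      using kb(4) by (auto simp: RR_def coeff_reps_def)
    have "real q * of_int b \<le> real q * (2 * Z / M)" using bb by (intro mult_left_mono) auto
    \<comment> \<open>Strictness matters: it puts the upper end of the symmetric range inside the
      half-open interval \<open>Iset (2 * CC)\<close>.\<close>
    then have qb: "real_of_int (int q * b) < CC" using q(2) by simp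
    have "{- (int q * b)..int q * b} \<subseteq> Iset (2 * CC)"
    proof
      fix z assume "z \<in> {- (int q * b)..int q * b}"
      then have "real_of_int z \<le> of_int (int q * b)" "- of_int (int q * b) \<le> real_of_int z"
        by (simp_all only: of_int_le_iff of_int_minus[symmetric] atLeastAtMost_iff)
      then show "z \<in> Iset (2 * CC)" using qb unfolding Iset_def by simp
    qed
    then have "c \<in> Cset n \<delta> \<kappa> d" unfolding Cset_def CC_def[symmetric]
      using c(1) PiE_mono[of "{..<d}" "\<lambda>_. {- (int q * b)..int q * b}" "\<lambda>_. Iset (2 * CC)"] by blast
    moreover have ak: "aa k b - b * mm k b = - int k" by (simp add: aa_def)
    have "fpoly n (mm k b) d c (aa k b) b = int s"
      unfolding fpoly_eq[OF c(2)] ak using tts[OF kb(1,3)] by (simp add: rr_def)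
    then have "(aa k b, b) \<in> Xset n (mm k b) d c \<sigma> \<beta> \<beta>'"
      unfolding Xset_def using bb Z(1) SS(2)[OF kb(1,3)] smooth_of_nat(2)[OF K(2)[OF kb(1)] K(4)[OF kb(1)]]
        smooth_of_nat(1)[of s] by (auto simp: ak)
    ultimately show ?thesis by blast
  qed
  have finB: "finite (B k)" if "k \<in> K" for k
  proof -
    have "B k \<subseteq> {1..\<lceil>2 * Z / M\<rceil>}"
    proof
      fix b assume "b \<in> B k"
      then have "b > 0" "of_int b \<le> 2 * Z / M" using basic[OF that] by auto
      then show "b \<in> {1..\<lceil>2 * Z / M\<rceil>}" by (auto simp: le_ceiling_iff)
    qed
    then show ?thesis by (rule finite_subset) simp
  qed
  have cardRU: "\<sigma>0 * real q ^ (d - 1) \<le> real (card (RU k b))" if kb: "k \<in> K" "b \<in> B k" for k b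
  proof -
    note bb = basic[OF kb]
    have disj: "RR k b s \<inter> RR k b s' = {}" if "s \<in> SS k (rr k b)" "s' \<in> SS k (rr k b)" "s \<noteq> s'" for s s'
    proof -
      have ne: "tt k b s \<noteq> tt k b s'"
      proof
        assume "tt k b s = tt k b s'"
        then have "rr k b - int s = rr k b - int s'"
          by (simp only: tts[OF kb(1) that(1)] tts[OF kb(1) that(2)])
        then show False using that(3) by simp
      qed
      show ?thesis unfolding RR_def by (rule coeff_reps_disjoint[OF ne])
    qed
    have "card (RU k b) = (\<Sum>s\<in>SS k (rr k b). card (RR k b s))"
      unfolding RU_def
    proof (rule card_UN_disjoint)
      show "finite (SS k (rr k b))" by (rule SS(1)[OF kb(1)])
      show "\<forall>s\<in>SS k (rr k b). finite (RR k b s)" unfolding RR_def using finite_coeff_reps by blast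
      show "\<forall>s\<in>SS k (rr k b). \<forall>s'\<in>SS k (rr k b). s \<noteq> s' \<longrightarrow> RR k b s \<inter> RR k b s' = {}"
        using disj by blast
    qed
    also have "\<dots> \<ge> (\<Sum>s\<in>SS k (rr k b). q ^ (d - 1))"
    proof (intro sum_mono)
      fix s assume s: "s \<in> SS k (rr k b)"
      show "q ^ (d - 1) \<le> card (RR k b s)"
        using card_coeff_reps_ge[of "aa k b" b "tt k b s" q "d - 1"] bb tbound[OF kb s] d by (simp add: RR_def)
    qed
    finally have "card (SS k (rr k b)) * q ^ (d - 1) \<le> card (RU k b)" by simp
    from of_nat_mono[OF this, where 'a = real]
    have "real (card (SS k (rr k b))) * real q ^ (d - 1) \<le> real (card (RU k b))"
      by (simp only: of_nat_power of_nat_mult)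
    moreover have "\<sigma>0 * real q ^ (d - 1) \<le> real (card (SS k (rr k b))) * real q ^ (d - 1)"
      using SS(3)[OF kb(1)] by (intro mult_right_mono) auto
    ultimately show ?thesis by linarith
  qed
  have finRU: "finite (RU k b)" if "k \<in> K" for k b
    unfolding RU_def RR_def using SS(1)[OF that] finite_coeff_reps by blast
  let ?W = "Sigma K (\<lambda>k. Sigma (B k) (\<lambda>b. RU k b))"
  let ?O = "Sigma (Mset n \<delta> d) (\<lambda>m. Sigma (Cset n \<delta> \<kappa> d) (\<lambda>c. Xset n m d c \<sigma> \<beta> \<beta>'))"
  let ?f = "\<lambda>(k, b, c). (mm k b, c, (aa k b, b))"
  have inj: "inj_on ?f ?W"
  proof (rule inj_onI)
    fix x y assume eq: "?f x = ?f y"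
    obtain k b c where x: "x = (k, b, c)" by (cases x)
    obtain k' b' c' where y: "y = (k', b', c')" by (cases y)
    have e: "mm k b = mm k' b'" "aa k b = aa k' b'" "b = b'" "c = c'" using eq unfolding x y prod.case prod.inject by blast+
    have "int k = int k'" using e(2) unfolding aa_def e(1) unfolding e(3) by simp
    then show "x = y" using e by (simp add: x y)
  qed
  have sub: "?f ` ?W \<subseteq> ?O"
  proof (rule image_subsetI)
    fix x assume xW: "x \<in> ?W"
    obtain k b c where x: "x = (k, b, c)" by (cases x)
    have kb: "k \<in> K" "b \<in> B k" "c \<in> RU k b" using xW by (simp_all add: x)
    then obtain s where s: "s \<in> SS k (rr k b)" "c \<in> RR k b s" unfolding RU_def by blast
    show "?f x \<in> ?O" using mem[OF kb(1,2) s] basic[OF kb(1,2)] by (simp add: x)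
  qed
  have "real (card K) * \<beta>0 * \<sigma>0 * real q ^ (d - 1) = (\<Sum>k\<in>K. \<beta>0 * (\<sigma>0 * real q ^ (d - 1)))"
    by simp
  also have "\<dots> \<le> (\<Sum>k\<in>K. \<Sum>b\<in>B k. \<sigma>0 * real q ^ (d - 1))"
    using B(2) S(2) by (intro sum_mono) (simp add: mult_right_mono)
  also have "\<dots> \<le> (\<Sum>k\<in>K. \<Sum>b\<in>B k. real (card (RU k b)))"
    using cardRU by (intro sum_mono)
  also have "\<dots> = real (card ?W)"
    using K(1) finB finRU by simp
  also have "\<dots> = real (card (?f ` ?W))" by (simp add: card_image[OF inj])
  also have "\<dots> \<le> real (card ?O)"
    using sub by (intro of_nat_mono card_mono) (auto intro!: finite_SigmaI simp: finite_Mset finite_Cset finite_Xset)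
  also have "\<dots> = (\<Sum>m\<in>Mset n \<delta> d. \<Sum>c\<in>Cset n \<delta> \<kappa> d. real (card (Xset n m d c \<sigma> \<beta> \<beta>')))"
    by (simp add: finite_Mset finite_Cset finite_Xset)
  finally show ?thesis .
qed

section \<open>The expectation for fixed parameters\<close>

definition prime_block :: "real \<Rightarrow> nat set" where
  "prime_block z = {p. prime p \<and> z / 16 < real p \<and> real p \<le> z}"

lemma prime_block_disjoint: "w \<le> z / 16 \<Longrightarrow> prime_block z \<inter> prime_block w = {}"
  by (auto simp: prime_block_def)

lemma finite_prime_block [simp]: "finite (prime_block z)"
  by (rule finite_subset[of _ "{..nat \<lfloor>z\<rfloor>}"]) (auto simp: prime_block_def le_nat_floor)

lemma disjoint_prime_blocks:
  assumes "\<And>i j. i \<in> I \<Longrightarrow> j \<in> I \<Longrightarrow> i < j \<Longrightarrow> z j \<le> z i / 16"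
  shows "disjoint_family_on (\<lambda>i. prime_block (z i)) (I :: nat set)"
  unfolding disjoint_family_on_def
proof (intro ballI impI)
  fix i j assume ij: "i \<in> I" "j \<in> I" "i \<noteq> j"
  then consider "i < j" | "j < i" by linarith
  then show "prime_block (z i) \<inter> prime_block (z j) = {}"
  proof cases
    case 1 then show ?thesis by (intro prime_block_disjoint assms ij)
  next
    case 2 then show ?thesis using prime_block_disjoint[OF assms[OF ij(2,1)]] by (simp add: Int_commute)
  qed
qed

lemma ex_dyadic_class:
  fixes Z x :: real
  assumes "x \<le> Z" "Z / 2 ^ N < x"
  shows "\<exists>j<N. Z / 2 ^ j / 2 < x \<and> x \<le> Z / 2 ^ j"
  using assms
proof (induction N)
  case (Suc N)
  show ?case
  proof (cases "Z / 2 ^ N < x")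
    case True then show ?thesis using Suc by (meson less_Suc_eq)
  next
    case False then show ?thesis using Suc.prems by (intro exI[of _ N]) (auto simp: field_simps)
  qed
qed auto

lemma dyadic_pigeonhole:
  fixes f :: "'a \<Rightarrow> real"
  assumes "finite T" "\<And>p. p \<in> T \<Longrightarrow> f p \<le> Z \<and> Z / 2 ^ N < f p" "N > 0"
  shows "\<exists>j<N. card T \<le> N * card {p \<in> T. Z / 2 ^ j / 2 < f p \<and> f p \<le> Z / 2 ^ j}"
proof (rule ccontr)
  let ?T = "\<lambda>j. {p \<in> T. Z / 2 ^ j / 2 < f p \<and> f p \<le> Z / 2 ^ j}"
  assume "\<not> ?thesis"
  then have *: "N * card (?T j) < card T" if "j < N" for j using that by (auto simp: not_le)
  have "T \<subseteq> (\<Union>j<N. ?T j)" using ex_dyadic_class[of "f _" Z N] assms(2) by fastforce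
  then have "card T \<le> card (\<Union>j<N. ?T j)" using assms(1) by (intro card_mono) auto
  also have "\<dots> \<le> (\<Sum>j<N. card (?T j))" by (rule card_UN_le) simp
  finally have "N * card T \<le> (\<Sum>j<N. N * card (?T j))" by (simp add: sum_distrib_left flip: sum_distrib_left)
  also have "\<dots> < (\<Sum>j<N. card T)" using assms(3) * by (intro sum_strict_mono) auto
  finally show False by simp
qed

text \<open>Exponents of y are compared. If g = 2 l, the right side offers (1 - h) 3 l against 2 l,
  and l >= 1 leaves 1/2 to spare. Otherwise g is about half of the remaining blocks, and u >= 2 v
  makes g + l reach 2 l even when the divisor is all of the modulus. The term 6 h v pays for blocks
  of size y^(1 - h) instead of y.\<close>

lemma sieve_exponent_bound:
  fixes y h L Lam Yr :: real
  assumes y: "y \<ge> 1" and h: "0 \<le> h" "h \<le> 1 / 6" and L: "L = y powr (1 - h)"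
    and u: "2 * real v + 6 * h * real v + 2 \<le> real u" and Lam: "0 \<le> Lam" and Yr: "0 \<le> Yr" "Yr \<le> y" 
    and l: "1 \<le> l" "j + l \<le> v" and g: "g = min (2 * l) ((u - j) div 2)"
  shows "Lam * (Yr ^ g + Yr ^ (2 * l)) \<le> 2 * Lam * y powr (- 1 / 2) * L ^ (g + l)"
proof -
  have "Yr ^ g \<le> y ^ g" "Yr ^ (2 * l) \<le> y ^ (2 * l)" using Yr by (auto intro: power_mono)
  moreover have "y ^ g \<le> y ^ (2 * l)" using y g by (intro power_increasing) auto
  ultimately have "Yr ^ g + Yr ^ (2 * l) \<le> 2 * y ^ (2 * l)" by linarith
  also have "y ^ (2 * l) = y powr (2 * real l)" using y by (simp flip: powr_realpow)
  also have "2 * \<dots> \<le> 2 * y powr (- 1 / 2 + (1 - h) * real (g + l))"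
  proof (intro mult_left_mono powr_mono y)
    have hl: "h * real l \<le> h * real v" using h l by (intro mult_left_mono) auto
    have l1: "real l \<ge> 1" using l by simp
    show "2 * real l \<le> - 1 / 2 + (1 - h) * real (g + l)"
    proof (cases "2 * l \<le> (u - j) div 2")
      case True
      then have "g = 2 * l" by (simp add: g)
      then have "(1 - h) * real (g + l) = 3 * real l - 3 * (h * real l)" by (simp add: algebra_simps)
      moreover have "h * real l \<le> 1 / 6 * real l" using h by (intro mult_right_mono) auto
      ultimately show ?thesis using l1 by linarith
    next
      case False
      then have g': "g = (u - j) div 2" "g \<le> 2 * l" by (auto simp: g)
      have "2 * g + 1 \<ge> u - j" using g'(1) by linarith
      then have g1: "2 * real g + 1 \<ge> real u - real j" by linarith
      have "h * real (g + l) \<le> h * real (3 * l)" using g'(2) h by (intro mult_left_mono) auto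
      also have "\<dots> \<le> 3 * (h * real v)" using hl by simp
      finally have "h * real (g + l) \<le> 3 * (h * real v)" .
      moreover have "real j + real l \<le> real v" using l(2) by linarith
      ultimately show ?thesis using g1 u by (simp add: algebra_simps)
    qed
  qed auto
  also have "y powr (- 1 / 2 + (1 - h) * real (g + l)) = y powr (- 1 / 2) * L ^ (g + l)"
    unfolding powr_add L using y by (simp add: powr_powr flip: powr_realpow)
  finally have "Yr ^ g + Yr ^ (2 * l) \<le> 2 * (y powr (- 1 / 2) * L ^ (g + l))" .
  from mult_left_mono[OF this Lam] show ?thesis by (simp add: ac_simps)
qed

lemma card_Mset_le: "Lf (real n) (2/3) (1/\<delta>) = M \<Longrightarrow> real (card (Mset n \<delta> d)) \<le> M"
proof -
  assume M: "Lf (real n) (2/3) (1/\<delta>) = M"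
  have M0: "M > 0" using M by (auto simp: Lf_def)
  have "Mset n \<delta> d \<subseteq> {1..\<lfloor>M\<rfloor>}"
  proof
    fix m assume m: "m \<in> Mset n \<delta> d"
    have "0 < 2 powr (- 1 / real d) * M" using M0 by simp
    then have "0 < real_of_int m" "real_of_int m \<le> M" using m M by (auto simp: Mset_def)
    then show "m \<in> {1..\<lfloor>M\<rfloor>}" by (simp add: le_floor_iff)
  qed
  then have "card (Mset n \<delta> d) \<le> card {1..\<lfloor>M\<rfloor>}" by (intro card_mono) auto
  then have "real (card (Mset n \<delta> d)) \<le> real (nat \<lfloor>M\<rfloor>)" by simp
  then show ?thesis using M0 by linarith
qed

lemma card_Cset_le:
  assumes "Lf (real n) (2/3) (\<kappa> - 1/\<delta>) = C" "C \<ge> 1"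
  shows "real (card (Cset n \<delta> \<kappa> d)) \<le> (3 * C) ^ d"
proof -
  have "Iset (2 * C) \<subseteq> {\<lceil>- C\<rceil>..\<lfloor>C\<rfloor>}" by (auto simp: Iset_def ceiling_le_iff le_floor_iff)
  then have "card (Iset (2 * C)) \<le> card {\<lceil>- C\<rceil>..\<lfloor>C\<rfloor>}" by (intro card_mono) auto
  then have "real (card (Iset (2 * C))) \<le> real (nat (\<lfloor>C\<rfloor> - \<lceil>- C\<rceil> + 1))" by simp
  also have "\<dots> \<le> 3 * C" using assms(2) by linarith
  finally have "real (card (Iset (2 * C))) ^ d \<le> (3 * C) ^ d" by (intro power_mono) auto
  then show ?thesis using assms(1) by (simp add: Cset_def card_PiE)
qed

text \<open>The b belonging to a given k thus fill an interval of relative length of order 1/d. The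
  constant is 2/3 - 1/6 = 1/2, from ln 2 >= 2/3 and 1/(M - 1) <= 1/(6 d).\<close>

lemma interval_length_bound:
  fixes M :: real
  assumes "d > 0" "M \<ge> 6 * real d + 4" "t > 0"
  shows "t / (2 * real d) \<le> 2 powr (1 / real d) * t - t * M / (M - 1)"
proof -
  have d: "real d \<ge> 1" using assms(1) by simp
  have "1 + ln 2 / real d \<le> exp (ln 2 / real d)" by (rule exp_ge_add_one_self)
  also have "\<dots> = 2 powr (1 / real d)" by (simp add: powr_def)
  finally have 1: "1 + ln 2 / real d \<le> 2 powr (1 / real d)" .
  have "ln 2 / real d \<ge> (2 / 3) / real d" using ln2_ge_two_thirds by (intro divide_right_mono) auto
  then have 2: "2 powr (1 / real d) \<ge> 1 + 2 / (3 * real d)" using 1 by simp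
  have "M / (M - 1) = 1 + 1 / (M - 1)" using assms d by (simp add: field_simps)
  also have "1 / (M - 1) \<le> 1 / (6 * real d)" using assms d by (intro divide_left_mono) auto
  finally have 3: "M / (M - 1) \<le> 1 + 1 / (6 * real d)" by simp
  have "1 / (2 * real d) = 2 / (3 * real d) - 1 / (6 * real d)" using d by (simp add: field_simps)
  then have "1 / (2 * real d) \<le> 2 powr (1 / real d) - M / (M - 1)" using 2 3 by linarith
  from mult_left_mono[OF this, of t] show ?thesis using assms(3) by (simp add: algebra_simps)
qed

text \<open>The blocks of the moduli have tops \<open>Y / 256 ^ i\<close> for \<open>i < v\<close>; the smooth values use the \<open>v\<close> blocks
  just below these and \<open>u'\<close> further blocks with tops \<open>Y' / 16 ^ i\<close>. Here \<open>Y'\<close> depends on the dyadic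
  interval \<open>j\<close> to which the moduli are restricted, since the range of the values must be matched up to
  a factor exponential in \<open>d\<close>, not in \<open>d * v\<close>.\<close>

lemma expectX_ge:
  fixes n v u' :: nat and \<delta> \<kappa> \<sigma> \<beta> h z0 Y :: real
  defines "M \<equiv> Lf (real n) (2/3) (1/\<delta>)" and "C \<equiv> Lf (real n) (2/3) (\<kappa> - 1/\<delta>)"
    and "R \<equiv> Lf (real n) (1/3) \<sigma> / 2" and "y \<equiv> Lf (real n) (1/3) \<beta>" and "d \<equiv> deg \<delta> n"
    and "L \<equiv> Lf (real n) (1/3) \<beta> powr (1 - h)"
  assumes z0: "z0 \<ge> 2" "\<And>z. z \<ge> z0 \<Longrightarrow> z / (10 * ln z) \<le> real (card (prime_block z))"
    and pos: "d > 0" "v > 0"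
    and y: "ln y \<ge> 1" and L0: "L \<ge> z0" "L \<ge> 2 * real v"
    and Y: "(\<Prod>i<v. Y / 256 ^ i) = R * M / 2" "0 < Y" "Y \<le> y" "160 * ln y * L \<le> Y / 256 ^ v"
    and Y': "\<And>j. j < 4 * v \<Longrightarrow> \<exists>Y'>0. (\<Prod>i<u'. Y' / 16 ^ i) * (R * M / 2)
          = C * (R * M / 2 / 2 ^ j) * (R / (4 * 2 ^ j)) ^ (d - 1) / 64
        \<and> Y' \<le> Y / 256 ^ v \<and> 160 * ln y * L \<le> Y' / 16 ^ u'"
    and h: "0 \<le> h" "h \<le> 1 / 6" "2 * real v + 6 * h * real v + 2 \<le> real (v + u')"
    and Lam: "32 * real v * 4 ^ v * (2 + 4 * harm (nat \<lfloor>y\<rfloor> ^ (2 * v))) \<le> y powr (1 / 2)"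
    and sizes: "8 * real d * (1 + real v) \<le> R / (4 * 16 ^ v)" "(32 * real (d + 1) + 8) * R \<le> 4 * C"
      "M \<ge> 6 * real d + 4" "C \<ge> 1"
  shows "(1 / (160 * ln y)) ^ (2 * v + u') * R ^ 2 / 16 ^ v / (65536 * real v * real d * 48 ^ d)
    \<le> expectX n \<delta> \<kappa> \<sigma> \<beta> \<beta>"
proof -
  have M0: "M > 0" and C0: "C > 0" and R0: "R > 0" and yp: "y > 0" by (auto simp: M_def C_def R_def y_def Lf_def)
  have y1: "y \<ge> 1" using y yp by (smt (verit) ln_ge_zero_iff)
  have L1: "L > 0" using L0 z0 by linarith
  \<comment> \<open>A block with top z has at least z / (10 ln y) primes. The further factor 16
    covers the blocks \<open>E i\<close> whose top is only \<open>x i / 16\<close>, so that one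
    density serves all blocks.\<close>
  define \<mu> where "\<mu> = 1 / (160 * ln y)"
  have \<mu>0: "\<mu> > 0" using y by (simp add: \<mu>_def)
  have count: "\<mu> * (16 * z) \<le> real (card (prime_block z))" if "10 * ln y * L \<le> z" "z \<le> y" for z
  proof -
    have "L \<le> 10 * ln y * L" using y L1 by simp
    then have z: "z \<ge> z0" using that L0 by linarith
    have lz: "0 < ln z" "ln z \<le> ln y" using z z0 that yp by auto
    have ly: "0 < ln y" using y by simp
    have "\<mu> * (16 * z) = z / (10 * ln y)" by (simp add: \<mu>_def)
    also have "\<dots> \<le> z / (10 * ln z)" using lz ly z z0 by (intro divide_left_mono mult_pos_pos) auto
    also have "\<dots> \<le> real (card (prime_block z))" by (rule z0(2)[OF z])
    finally show ?thesis .
  qed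
  \<comment> \<open>With k at most Z, every admissible b is at most 2 Z / M = R, the bound imposed
    on |b|.\<close>
  define Z where "Z = R * M / 2"
  have Zp: "Z > 0" using R0 M0 by (simp add: Z_def)
  define A where "A i = prime_block (Y / 256 ^ i)" for i :: nat
  define V where "V = {..<v}"
  have Yi: "Y / 256 ^ v \<le> Y / 256 ^ i" "Y / 256 ^ i \<le> y" if "i \<le> v" for i
  proof -
    show "Y / 256 ^ v \<le> Y / 256 ^ i" using that Y by (intro divide_left_mono power_increasing) auto
    have "Y / 256 ^ i \<le> Y / 1" using Y by (intro divide_left_mono) auto
    then show "Y / 256 ^ i \<le> y" using Y by simp
  qed
  have cardA: "\<mu> * (Y / 256 ^ i) \<le> real (card (A i))" "L \<le> real (card (A i))" if i: "i < v" for i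
  proof -
    have ii: "i \<le> v" using i by simp
    have a: "160 * ln y * L \<le> Y / 256 ^ i" using Yi(1)[OF ii] Y(4) by linarith
    have "0 \<le> ln y * L" using y L1 by simp
    then have "\<mu> * (16 * (Y / 256 ^ i)) \<le> real (card (A i))"
      unfolding A_def using a Yi(2)[OF ii] by (intro count) auto
    moreover have "\<mu> * (Y / 256 ^ i) \<le> \<mu> * (16 * (Y / 256 ^ i))"
    proof (rule mult_left_mono)
      have "0 \<le> Y / 256 ^ i" using Y by simp
      then show "Y / 256 ^ i \<le> 16 * (Y / 256 ^ i)" by linarith
    qed (use \<mu>0 in simp)
    ultimately show "\<mu> * (Y / 256 ^ i) \<le> real (card (A i))" by linarith
    have "L = \<mu> * (160 * ln y * L)" using y by (simp add: \<mu>_def)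
    also have "\<dots> \<le> \<mu> * (Y / 256 ^ i)" using a \<mu>0 by (intro mult_left_mono) auto
    finally show "L \<le> real (card (A i))" using \<open>\<mu> * (Y / 256 ^ i) \<le> real (card (A i))\<close> by linarith
  qed
  have primeA: "prime p" "Y / 256 ^ i / 16 < real p" "real p \<le> Y / 256 ^ i" if "p \<in> A i" for p i
    using that by (auto simp: A_def prime_block_def)
  have step: "Y / 256 ^ j \<le> Y / 256 ^ i / 256" if "i < j" for i j :: nat
  proof -
    have "Y / 256 ^ j \<le> Y / 256 ^ Suc i" using that Y by (intro divide_left_mono power_increasing) auto
    then show ?thesis by simp
  qed
  have le16: "a \<le> w / 16" "a / 16 \<le> w / 16 / 16" if "a \<le> w / 256" "0 \<le> w" for a w :: real
    using that by linarith+
  have disjA: "disjoint_family_on A V"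
    unfolding A_def
  proof (rule disjoint_prime_blocks)
    fix i j :: nat assume "i < j"
    have "0 \<le> Y / 256 ^ i" using Y by simp
    then show "Y / 256 ^ j \<le> Y / 256 ^ i / 16" by (rule le16(1)[OF step[OF \<open>i < j\<close>]])
  qed
  interpret PA: prime_blocks A V
  proof unfold_locales
    show "finite V" by (simp add: V_def)
    show "finite (A i)" for i by (simp add: A_def)
    show "prime p" if "p \<in> A i" for p i using primeA that by blast
    show "disjoint_family_on A V" by (rule disjA)
  qed
  define T where "T = PiE V A"
  define f where "f p = (\<Prod>i<v. p i)" for p :: "nat \<Rightarrow> nat"
  have finT: "finite T" unfolding T_def by (intro finite_PiE) (simp_all add: V_def A_def)
  have injf: "inj_on f T" using PA.inj_on_prod_PiE[OF order_refl] by (simp add: f_def[abs_def] T_def V_def)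
  have pA: "p i \<in> A i" if "p \<in> T" "i < v" for p i using that by (auto simp: T_def V_def)
  have cardT: "\<mu> ^ v * Z \<le> real (card T)"
  proof -
    have "\<mu> ^ v * Z = (\<Prod>i<v. \<mu> * (Y / 256 ^ i))" unfolding Z_def Y(1)[symmetric] by (simp only: prod.distrib prod_constant card_lessThan)
    also have "\<dots> \<le> (\<Prod>i<v. real (card (A i)))" using cardA(1) \<mu>0 Y by (intro prod_mono) auto
    finally show ?thesis by (simp add: T_def V_def card_PiE)
  qed
  \<comment> \<open>Each prime is within a factor 16 of its top, so k is within 16^v = 2^(4 v) of Z;
    this is the number of dyadic classes.\<close>
  have frange: "real (f p) \<le> Z \<and> Z / 2 ^ (4 * v) < real (f p)" if p: "p \<in> T" for p
  proof
    have "real (f p) \<le> (\<Prod>i<v. Y / 256 ^ i)" unfolding f_def of_nat_prod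
      using primeA(3)[OF pA[OF p]] by (intro prod_mono) auto
    then show "real (f p) \<le> Z" by (simp add: Z_def Y(1))
    have "(\<Prod>i<v. Y / 256 ^ i / 16) < (\<Prod>i<v. real (p i))"
      using primeA(2)[OF pA[OF p]] prime_gt_0_nat[OF primeA(1)[OF pA[OF p]]] pos Y
      by (intro prod_mono_strict) (auto intro: less_imp_le)
    moreover have "(\<Prod>i<v. Y / 256 ^ i / 16) = Z / 2 ^ (4 * v)"
    proof -
      have "(16::real) ^ v = 2 ^ (4 * v)" by (simp add: power_mult)
      then show ?thesis
        unfolding Z_def Y(1)[symmetric] by (simp only: prod_dividef prod_constant card_lessThan)
    qed
    ultimately show "Z / 2 ^ (4 * v) < real (f p)" by (simp add: f_def)
  qed
  obtain j where j: "j < 4 * v" "card T \<le> 4 * v * card {p \<in> T. Z / 2 ^ j / 2 < real (f p) \<and> real (f p) \<le> Z / 2 ^ j}"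
    using dyadic_pigeonhole[OF finT frange, of "\<lambda>x. x"] pos by auto
  define Tj where "Tj = {p \<in> T. Z / 2 ^ j / 2 < real (f p) \<and> real (f p) \<le> Z / 2 ^ j}"
  define Zj where "Zj = Z / 2 ^ j"
  have Zj: "0 < Zj" "Zj \<le> Z" using Zp by (auto simp: Zj_def field_simps)
  \<comment> \<open>All b belonging to moduli of the chosen dyadic class lie between s and 4
    s.\<close>
  define s where "s = Zj / (2 * M)"
  have s_eq: "s = R / (4 * 2 ^ j)" using M0 by (simp add: s_def Zj_def Z_def)
  have s0: "s > 0" using R0 by (simp add: s_eq)
  obtain Y' where Y': "Y' > 0" "(\<Prod>i<u'. Y' / 16 ^ i) * Z = C * Zj * s ^ (d - 1) / 64"
      "Y' \<le> Y / 256 ^ v" "160 * ln y * L \<le> Y' / 16 ^ u'"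
    using Y'[OF j(1)] unfolding Z_def Zj_def s_eq by blast
  \<comment> \<open>For i < v, \<open>A i\<close> lies in (Y/256^i/16, Y/256^i] and
    \<open>E i\<close> in the next interval of ratio 16 below it, which is why consecutive tops
    differ by 256 = 16^2. \<open>x i\<close> is the common upper bound of both.\<close>
  define zE where "zE i = (if i < v then Y / 256 ^ i / 16 else Y' / 16 ^ (i - v))" for i
  define x where "x i = (if i < v then Y / 256 ^ i else Y' / 16 ^ (i - v))" for i
  define E where "E i = prime_block (zE i)" for i
  define U where "U = {..<v + u'}"
  have VU: "V \<subseteq> U" by (auto simp: V_def U_def)
  have Y'i: "Y' / 16 ^ u' \<le> Y' / 16 ^ i" "Y' / 16 ^ i \<le> Y'" if "i \<le> u'" for i
  proof -
    show "Y' / 16 ^ u' \<le> Y' / 16 ^ i" using that Y' by (intro divide_left_mono power_increasing) auto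
    have "Y' / 16 ^ i \<le> Y' / 1" using Y' by (intro divide_left_mono) auto
    then show "Y' / 16 ^ i \<le> Y'" by simp
  qed
  have x: "0 < x i" "160 * ln y * L \<le> x i" "x i / 16 \<le> zE i" "zE i \<le> x i" "x i \<le> y" if i: "i \<in> U" for i
  proof -
    show x0: "0 < x i" using Y Y' by (simp add: x_def)
    have "zE i = x i / 16 \<or> zE i = x i" unfolding zE_def x_def by (cases "i < v") simp_all
    then show "x i / 16 \<le> zE i" "zE i \<le> x i" using x0 by auto
    show "160 * ln y * L \<le> x i"
    proof (cases "i < v")
      case True
      then show ?thesis using Yi(1)[of i] Y(4) by (simp add: x_def)
    next
      case False
      have "i < v + u'" using i by (simp add: U_def)
      then have iv: "i - v \<le> u'" by linarith
      show ?thesis using order_trans[OF Y'(4) Y'i(1)[OF iv]] False by (simp add: x_def)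
    qed
    show "x i \<le> y"
    proof (cases "i < v")
      case True
      then show ?thesis using Yi(2)[of i] by (simp add: x_def)
    next
      case False
      have "i < v + u'" using i by (simp add: U_def)
      then have iv: "i - v \<le> u'" by linarith
      show ?thesis using order_trans[OF Y'i(2)[OF iv] order_trans[OF Y'(3) Yi(2)[OF order_refl]]] False
        by (simp add: x_def)
    qed
  qed
  have cardE: "\<mu> * x i \<le> real (card (E i))" "L \<le> real (card (E i))" if i: "i \<in> U" for i
  proof -
    have "\<mu> * (16 * zE i) \<le> real (card (E i))"
      unfolding E_def using x[OF i] by (intro count) auto
    moreover have "\<mu> * x i \<le> \<mu> * (16 * zE i)" using x[OF i] \<mu>0 by (intro mult_left_mono) auto
    ultimately show "\<mu> * x i \<le> real (card (E i))" by linarith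
    have "L = \<mu> * (160 * ln y * L)" using y by (simp add: \<mu>_def)
    also have "\<dots> \<le> \<mu> * x i" using x[OF i] \<mu>0 by (intro mult_left_mono) auto
    finally show "L \<le> real (card (E i))" using \<open>\<mu> * x i \<le> real (card (E i))\<close> by linarith
  qed
  have stepE: "zE k \<le> zE i / 16" if "i < k" for i k
  proof -
    consider "k < v" | "i < v" "v \<le> k" | "v \<le> i" using that by linarith
    then show ?thesis
    proof cases
      case 1
      have "0 \<le> Y / 256 ^ i" using Y by simp
      then show ?thesis using le16(2)[OF step[OF that]] 1 that by (simp only: zE_def if_True less_trans[OF that 1])
    next
      case 2
      have "Y' / 16 ^ (k - v) \<le> Y' / 1" using Y' by (intro divide_left_mono) auto
      then have "zE k \<le> Y / 256 ^ v" using 2 Y'(3) by (simp add: zE_def)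
      also have "\<dots> \<le> Y / 256 ^ i / 256" by (rule step[OF 2(1)])
      also have "\<dots> = Y / 256 ^ i / 16 / 16" by simp
      finally show ?thesis using 2 by (simp only: zE_def if_True)
    next
      case 3
      have "Y' / 16 ^ (k - v) \<le> Y' / 16 ^ Suc (i - v)"
        using Y' that 3 by (intro divide_left_mono power_increasing) auto
      then show ?thesis using 3 that by (simp add: zE_def)
    qed
  qed
  have disjE: "disjoint_family_on E U"
    unfolding E_def by (rule disjoint_prime_blocks) (rule stepE)
  have disjAE: "A i \<inter> E k = {}" if i: "i \<in> V" and k: "k \<in> U" for i k
  proof (cases "k < i")
    case True
    then have "k < v" using i by (simp add: V_def)
    then have "Y / 256 ^ i \<le> zE k / 16" using step[OF True] by (simp add: zE_def)
    then show ?thesis using prime_block_disjoint unfolding A_def E_def by (metis Int_commute)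
  next
    case False
    have "zE k \<le> zE i"
    proof (cases "k = i")
      case False
      have "0 \<le> zE i" using Y Y' by (simp add: zE_def)
      then show ?thesis using stepE[of i k] False \<open>\<not> k < i\<close> by linarith
    qed simp
    then have "zE k \<le> Y / 256 ^ i / 16" using i by (simp add: zE_def V_def)
    then show ?thesis unfolding A_def E_def by (rule prime_block_disjoint)
  qed
  define Yn where "Yn = nat \<lfloor>y\<rfloor>"
  have Yn: "real Yn \<le> y" "Yn > 0" using y1 by (auto simp: Yn_def)
  have leYn: "p \<le> Yn" if "real p \<le> y" for p using that by (simp add: Yn_def le_nat_floor)
  define \<Lambda> where "\<Lambda> = 2 + 4 * (harm (Yn ^ (2 * v)) :: real)"
  have \<Lambda>0: "\<Lambda> \<ge> 2" by (simp add: \<Lambda>_def harm_nonneg)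
  define \<rho> where "\<rho> = 2 * \<Lambda> * y powr (- 1 / 2)"
  have cVU: "card V = v" "card U = v + u'" by (auto simp: V_def U_def)
  interpret SB: sieve_blocks E U A V Yn L \<Lambda> \<rho>
  proof unfold_locales
    show "finite U" by (simp add: U_def)
    show "finite (E i)" for i by (simp add: E_def)
    show "prime p" if "p \<in> E i" for p i using that by (simp add: E_def prime_block_def)
    show "disjoint_family_on E U" by (rule disjE)
    show "V \<subseteq> U" by (rule VU)
    show "finite (A i)" for i by (simp add: A_def)
    show "prime p" if "p \<in> A i" for p i using primeA that by blast
    show "disjoint_family_on A V" by (rule disjA)
    show "A i \<inter> E k = {}" if "i \<in> V" "k \<in> U" for i k using disjAE that .
    show "p \<le> Yn" if "i \<in> V" "p \<in> A i" for i p
      using primeA(3)[OF that(2)] Yi(2)[of i] that(1) by (intro leYn) (simp add: V_def)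
    show "p \<le> Yn" if "i \<in> U" "p \<in> E i" for i p
      using x[OF that(1)] that(2) by (intro leYn) (simp add: E_def prime_block_def)
    show "L > 0" by (rule L1)
    show "L \<le> real (card (A i))" if "i \<in> V" for i using cardA(2) that by (simp add: V_def)
    show "L \<le> real (card (E i))" if "i \<in> U" for i using cardE(2) that .
    \<comment> \<open>\<open>E i\<close> lies entirely below \<open>A i\<close>, so it cannot have
      more elements than the size of a prime of \<open>A i\<close>.\<close>
    show "card (E i) \<le> p" if "i \<in> V" "p \<in> A i" for i p
    proof -
      have i: "i < v" using that by (simp add: V_def)
      have "E i \<subseteq> {1..nat \<lfloor>zE i\<rfloor>}"
        by (auto simp: E_def prime_block_def le_nat_floor Suc_le_eq prime_gt_0_nat)
      then have "card (E i) \<le> nat \<lfloor>zE i\<rfloor>" using card_mono[of "{1..nat \<lfloor>zE i\<rfloor>}" "E i"] by simp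
      also have "\<dots> \<le> p"
        using primeA(2)[OF that(2)] i by (simp add: zE_def) linarith
      finally show ?thesis .
    qed
    show "Yn > 0" by (rule Yn)
    show "2 \<le> \<Lambda>" by (rule \<Lambda>0)
    show "4 * harm (Yn ^ (2 * card V)) \<le> \<Lambda>" by (simp add: \<Lambda>_def cVU)
    fix k l :: nat assume kl: "1 \<le> l" "k + l \<le> card V"
    show "\<Lambda> * (real Yn ^ min (2 * l) ((card U - k) div 2) + real Yn ^ (2 * l))
        \<le> \<rho> * L ^ (min (2 * l) ((card U - k) div 2) + l)"
      unfolding \<rho>_def
      by (rule sieve_exponent_bound[where h = h and v = v and u = "v + u'" and j = k])
         (use y1 h \<Lambda>0 Yn kl in \<open>simp_all add: L_def y_def cVU\<close>)
  qed
  obtain Bad where Bad: "Bad \<subseteq> T" "real (card Bad) \<le> 2 * 4 ^ v * \<rho> * real (card T)"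
    "\<And>p r. p \<in> T - Bad \<Longrightarrow> \<exists>S. finite S
       \<and> (\<forall>s\<in>S. s > 0 \<and> real s \<le> (\<Prod>i\<in>U. x i) \<and> (\<forall>q. prime q \<and> q dvd s \<longrightarrow> q \<le> Yn)
            \<and> int (f p) dvd int s - r)
       \<and> real (card (prods E U)) \<le> 2 * real (f p) * real (card S)"
  proof (rule SB.equidistribution[of x])
    show "V \<noteq> {}" using pos by (auto simp: V_def)
    show "real p \<le> x i" if "i \<in> V" "p \<in> A i" for i p
      using primeA(3)[OF that(2)] that(1) by (simp add: x_def V_def)
    show "real p \<le> x i" if "i \<in> U" "p \<in> E i" for i p
      using x[OF that(1)] that(2) by (simp add: E_def prime_block_def)
  qed (auto simp: T_def f_def V_def lessThan_def[symmetric] cVU(1)[unfolded V_def])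
  \<comment> \<open>This is q/2 * (Zj/2) * s^d with q replaced by its lower bound C / (16 s): the
    size of values that the coefficient range is sure to reach.\<close>
  define X where "X = C * Zj * s ^ (d - 1) / 64"
  have X0: "X > 0" using C0 Zj s0 by (simp add: X_def)
  have prodx: "(\<Prod>i\<in>U. x i) = X"
  proof -
    have "(\<Prod>i<v + u'. x i) = (\<Prod>i<v. x i) * (\<Prod>i<u'. x (v + i))"
      by (induction u') (auto simp: ac_simps)
    also have "(\<Prod>i<v. x i) = Z" unfolding Z_def Y(1)[symmetric] by (intro prod.cong) (auto simp: x_def)
    also have "(\<Prod>i<u'. x (v + i)) = (\<Prod>i<u'. Y' / 16 ^ i)" by (intro prod.cong) (auto simp: x_def)
    finally show ?thesis using Y'(2) by (simp add: U_def X_def mult.commute)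
  qed
  have cardS: "\<mu> ^ (v + u') * X \<le> real (card (prods E U))"
  proof -
    have "\<mu> ^ (v + u') * X = (\<Prod>i\<in>U. \<mu> * x i)" by (simp only: prod.distrib prod_constant prodx cVU)
    also have "\<dots> \<le> (\<Prod>i\<in>U. real (card (E i)))" using cardE(1) x(1) \<mu>0 by (intro prod_mono) (auto intro: less_imp_le)
    finally show ?thesis by (simp add: SB.card_prods)
  qed
  define K where "K = f ` (Tj - Bad)"
  have TjT: "Tj \<subseteq> T" by (auto simp: Tj_def)
  have finTj: "finite Tj" "finite Bad" using TjT Bad(1) finT finite_subset by auto
  \<comment> \<open>The chosen class holds at least 1/(4 v) of all moduli and the bad ones make up
    at most 1/(8 v) by \<open>Lam\<close>, so at least half of the class survives.\<close>
  have cardK: "\<mu> ^ v * Z / (8 * real v) \<le> real (card K)"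
  proof -
    have "real (card T) \<le> real (4 * v * card Tj)" using j(2) by (simp only: Tj_def of_nat_le_iff)
    then have 1: "real (card T) / (4 * real v) \<le> real (card Tj)" using pos by (simp add: field_simps)
    have "32 * real v * 4 ^ v * \<Lambda> * y powr (- 1 / 2) \<le> y powr (1 / 2) * y powr (- 1 / 2)"
      using Lam unfolding \<Lambda>_def Yn_def by (intro mult_right_mono) auto
    also have "\<dots> = 1" using yp by (simp flip: powr_add)
    finally have "2 * 4 ^ v * \<rho> \<le> 1 / (8 * real v)" using pos by (simp add: \<rho>_def field_simps)
    then have "2 * 4 ^ v * \<rho> * real (card T) \<le> 1 / (8 * real v) * real (card T)" by (intro mult_right_mono) auto
    then have 2: "real (card Bad) \<le> real (card T) / (8 * real v)" using Bad(2) by simp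
    have "real (card (Tj - Bad)) \<ge> real (card Tj) - real (card Bad)"
      using diff_card_le_card_Diff[OF finTj(2), of Tj] by linarith
    moreover have "real (card T) / (4 * real v) - real (card T) / (8 * real v) = real (card T) / (8 * real v)"
      using pos by (simp add: field_simps)
    moreover have "card K = card (Tj - Bad)"
      unfolding K_def using inj_on_subset[OF injf] TjT by (intro card_image) blast
    moreover have "\<mu> ^ v * Z / (8 * real v) \<le> real (card T) / (8 * real v)" using cardT by (intro divide_right_mono) auto
    ultimately show ?thesis using 1 2 by linarith
  qed
  define B where "B k = {b::int. real k / (M - 1) \<le> of_int b \<and> of_int b \<le> 2 powr (1 / real d) * (real k / M) \<and> coprime b (int k)}" for k
  have Kprop: "k > 0" "Zj / 2 < real k" "real k \<le> Zj" "\<exists>p. p \<in> T - Bad \<and> k = f p" if kK: "k \<in> K" for k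
  proof -
    obtain p where p: "p \<in> Tj" "p \<notin> Bad" "k = f p" using kK by (auto simp: K_def)
    then show "Zj / 2 < real k" "real k \<le> Zj" by (auto simp: Tj_def Zj_def)
    then have "real k > 0" using Zj by linarith
    then show "k > 0" by simp
    show "\<exists>p. p \<in> T - Bad \<and> k = f p" using p TjT by blast
  qed
  have kfactors: "\<exists>p. p \<in> T \<and> prime_factors k \<subseteq> p ` {..<v}" if kK: "k \<in> K" for k
  proof -
    obtain p where p: "p \<in> T" "k = f p" using Kprop(4)[OF kK] by blast
    have "q \<in> p ` {..<v}" if q: "q \<in> prime_factors k" for q
    proof -
      have "prime q" "q dvd (\<Prod>i<v. p i)" using q p(2) by (auto simp: f_def in_prime_factors_iff)
      then obtain i where i: "i < v" "q dvd p i" using prime_dvd_prod_iff[of "{..<v}" q p] by auto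
      have "q = p i" using primes_dvd_imp_eq[OF \<open>prime q\<close> primeA(1)[OF pA[OF p(1) i(1)]] i(2)] .
      then show ?thesis using i by simp
    qed
    then show ?thesis using p(1) by blast
  qed
  have kprimes: "L \<le> real q \<and> real q \<le> y" if kK: "k \<in> K" and q: "prime q" "q dvd k" for k q
  proof -
    obtain p where p: "p \<in> T" "prime_factors k \<subseteq> p ` {..<v}" using kfactors[OF kK] by blast
    have "q \<in> prime_factors k" using q Kprop(1)[OF kK] by (simp add: in_prime_factors_iff)
    then obtain i where i: "i < v" "q = p i" using p(2) by blast
    then have qA: "q \<in> A i" using pA[OF p(1)] by simp
    have ii: "i \<le> v" using i by simp
    have "L \<le> 10 * ln y * L" using y L1 by simp
    moreover have "160 * ln y * L \<le> Y / 256 ^ i" by (rule order_trans[OF Y(4) Yi(1)[OF ii]])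
    moreover have "0 < ln y * L" using y L1 by simp
    ultimately have "L \<le> Y / 256 ^ i / 16" by (simp add: mult.assoc)
    then show ?thesis using primeA(2,3)[OF qA] Yi(2)[OF ii] by (auto intro: order_trans)
  qed
  have s_bounds: "R / (4 * 16 ^ v) \<le> s" "4 * s \<le> R"
  proof -
    have "(2::real) ^ j \<le> 2 ^ (4 * v)" using j(1) by (intro power_increasing) auto
    also have "\<dots> = 16 ^ v" by (simp add: power_mult)
    finally show "R / (4 * 16 ^ v) \<le> s" unfolding s_eq using R0 by (intro divide_left_mono) auto
    have "R / (4 * 2 ^ j) \<le> R / (4 * 1)" using R0 by (intro divide_left_mono mult_left_mono) auto
    then show "4 * s \<le> R" unfolding s_eq by simp
  qed
  have s_big: "8 * real d * (1 + real v) \<le> s" using sizes(1) s_bounds by linarith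
  have dr: "real d > 0" using pos by simp
  have cardB: "s / (8 * real d) \<le> real (card (B k))" if kK: "k \<in> K" for k
  proof -
    define a where "a = real k / (M - 1)"
    define b where "b = 2 powr (1 / real d) * (real k / M)"
    have "s \<le> real k / M"
      unfolding s_def using Kprop(2)[OF kK] M0 by (simp add: field_simps)
    moreover have "real k / M / (2 * real d) \<le> 2 powr (1 / real d) * (real k / M) - real k / M * M / (M - 1)"
      using pos sizes(3) Kprop(1)[OF kK] M0 by (intro interval_length_bound) auto
    moreover have "real k / M * M / (M - 1) = a" using M0 by (simp add: a_def)
    ultimately have len: "s / (2 * real d) \<le> b - a"
      unfolding b_def using divide_right_mono[of s "real k / M" "2 * real d"] dr by linarith
    have "0 < s / (2 * real d)" using s0 dr by simp
    then have ab: "a \<le> b" using len by linarith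
    obtain p where p: "prime_factors k \<subseteq> p ` {..<v}" using kfactors[OF kK] by blast
    then have "card (prime_factors k) \<le> card (p ` {..<v})" by (intro card_mono) auto
    also have "\<dots> \<le> v" using card_image_le[of "{..<v}" p] by simp
    finally have "card (prime_factors k) \<le> v" .
    \<comment> \<open>As L >= 2 v, the primes of k remove at most half of the interval and v further
      integers. With e = s / (8 d) the interval has length at least 4 e, so at least 2 e - 1 - v >=
      e integers remain.\<close>
    then have cnt: "(b - a) - 1 - real v * ((b - a) / L + 1) \<le> real (card (B k))"
      unfolding B_def a_def[symmetric] b_def[symmetric]
      using Kprop(1)[OF kK] ab L1 kprimes[OF kK] by (intro coprime_count) auto
    have "real v * ((b - a) / L) = (real v / L) * (b - a)" by simp
    also have "\<dots> \<le> 1 / 2 * (b - a)" using L0(2) L1 ab by (intro mult_right_mono) (auto simp: field_simps)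
    finally have 1: "real v * ((b - a) / L) \<le> (b - a) / 2" by simp
    define e where "e = s / (8 * real d)"
    define w where "w = real v * ((b - a) / L)"
    have 2: "1 + real v \<le> e" using s_big dr by (simp add: e_def field_simps)
    have "4 * e = s / (2 * real d)" by (simp add: e_def)
    then have 3: "4 * e \<le> b - a" using len by simp
    have "real v * ((b - a) / L + 1) = w + real v" by (simp add: w_def distrib_left)
    then have "(b - a) - 1 - (w + real v) \<le> real (card (B k))" using cnt by simp
    then have "e \<le> real (card (B k))" using 1[folded w_def] 2 3 by argo
    then show ?thesis by (simp only: e_def)
  qed
  \<comment> \<open>As b <= 4 s, coefficients up to q b stay below C; even after rounding, q is at
    least C / (16 s).\<close>
  define q where "q = nat \<lfloor>C / (8 * s)\<rfloor>"
  have Cs: "4 * real (d + 1) + 1 \<le> C / (8 * s)"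
  proof -
    have "(4 * real (d + 1) + 1) * (8 * s) = (32 * real (d + 1) + 8) * s" by (simp add: algebra_simps)
    also have "\<dots> \<le> (32 * real (d + 1) + 8) * (R / 4)" using s_bounds by (intro mult_left_mono) auto
    also have "\<dots> \<le> C" using sizes(2) by simp
    finally show ?thesis using s0 by (simp add: field_simps)
  qed
  have q: "real q \<le> C / (8 * s)" "C / (16 * s) \<le> real q" "4 * (d + 1) \<le> q"
  proof -
    have fl: "real q = of_int \<lfloor>C / (8 * s)\<rfloor>" using Cs by (simp add: q_def)
    show "real q \<le> C / (8 * s)" unfolding fl by (rule of_int_floor_le)
    have "C / (8 * s) - 1 < real q" unfolding fl by linarith
    moreover have "C / (16 * s) = C / (8 * s) / 2" by simp
    moreover have "4 * real (d + 1) \<ge> 4" by simp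
    ultimately show "C / (16 * s) \<le> real q" using Cs by linarith
    have "4 * real (d + 1) < real q" using Cs \<open>C / (8 * s) - 1 < real q\<close> by linarith
    then show "4 * (d + 1) \<le> q" by linarith
  qed
  let ?sum = "\<Sum>m\<in>Mset n \<delta> d. \<Sum>c\<in>Cset n \<delta> \<kappa> d. real (card (Xset n m d c \<sigma> \<beta> \<beta>))"
  have main: "real (card K) * (s / (8 * real d)) * (\<mu> ^ (v + u') * X / (2 * Zj)) * real q ^ (d - 1) \<le> ?sum"
  proof (rule sum_card_Xset_ge[where Z = Zj and B = B and X = X])
    show "d > 0" by (rule pos(1))
    show "4 \<le> Lf (real n) (2/3) (1/\<delta>)" using sizes(3) by (simp add: M_def)
    show "finite K" using finTj by (simp add: K_def)
    show "k > 0" "Zj / 2 \<le> real k \<and> real k \<le> Zj" if "k \<in> K" for k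
      using Kprop(1-3)[OF that] by auto
    show "real p \<le> Lf (real n) (1/3) \<beta>" if "k \<in> K" "prime p" "p dvd k" for k p
      using kprimes[OF that] by (simp add: y_def)
    show "real k / (Lf (real n) (2/3) (1/\<delta>) - 1) \<le> of_int b \<and> of_int b \<le> 2 powr (1 / real d) * (real k / Lf (real n) (2/3) (1/\<delta>)) \<and> coprime b (int k)"
      if "k \<in> K" "b \<in> B k" for k b
      using that(2) by (simp add: B_def M_def)
    show "s / (8 * real d) \<le> real (card (B k))" if "k \<in> K" for k by (rule cardB[OF that])
    show "0 \<le> s / (8 * real d)" using s0 by simp
    have "2 * Zj / M = 4 * s" using M0 by (simp add: s_def)
    then show "2 * Zj / Lf (real n) (2/3) (1/\<delta>) \<le> Lf (real n) (1/3) \<sigma> / 2"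
      using s_bounds by (simp add: M_def R_def)
    show "0 < Zj" by (rule Zj)
    show "4 * (d + 1) \<le> q" by (rule q)
    have "real q * (4 * s) \<le> C / (8 * s) * (4 * s)" using q s0 by (intro mult_right_mono) auto
    also have "\<dots> < C" using s0 C0 by simp
    finally show "real q * (2 * Zj / Lf (real n) (2/3) (1/\<delta>)) < Lf (real n) (2/3) (\<kappa> - 1/\<delta>)"
      using \<open>2 * Zj / M = 4 * s\<close> by (simp add: M_def C_def)
    have "X = C / (16 * s) / 2 * (Zj / 2) * (s * s ^ (d - 1))" using s0 by (simp add: X_def)
    also have "s * s ^ (d - 1) = s ^ d" using pos(1) by (cases d) auto
    also have "C / (16 * s) / 2 * (Zj / 2) * s ^ d \<le> real q / 2 * (Zj / 2) * s ^ d"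
      using q Zj s0 by (intro mult_right_mono divide_right_mono) auto
    finally show "X \<le> real q / 2 * (Zj / 2) * (Zj / (2 * Lf (real n) (2/3) (1/\<delta>))) ^ d"
      by (simp add: s_def M_def)
    show "0 \<le> \<mu> ^ (v + u') * X / (2 * Zj)" using \<mu>0 X0 Zj by simp
    fix k and r :: int assume kK: "k \<in> K"
    obtain p where p: "p \<in> T - Bad" "k = f p" using Kprop(4)[OF kK] by blast
    obtain S where S: "finite S" "\<forall>s\<in>S. s > 0 \<and> real s \<le> X \<and> (\<forall>q. prime q \<and> q dvd s \<longrightarrow> q \<le> Yn) \<and> int k dvd int s - r"
       "real (card (prods E U)) \<le> 2 * real k * real (card S)"
      using Bad(3)[OF p(1), of r] unfolding prodx p(2)[symmetric] by blast
    have "real q \<le> y" if "q \<le> Yn" for q using that Yn(1) by linarith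
    then have S2: "\<forall>s\<in>S. s > 0 \<and> real s \<le> X \<and> (\<forall>q. prime q \<and> q dvd s \<longrightarrow> real q \<le> y) \<and> int k dvd int s - r"
      using S(2) by blast
    have "\<mu> ^ (v + u') * X \<le> 2 * real k * real (card S)" using cardS S(3) by linarith
    also have "\<dots> \<le> 2 * Zj * real (card S)" using Kprop(3)[OF kK] by (intro mult_right_mono) auto
    finally have "\<mu> ^ (v + u') * X / (2 * Zj) \<le> real (card S)" using Zj by (simp add: field_simps)
    then show "\<exists>S. finite S \<and> (\<forall>s\<in>S. s > 0 \<and> real s \<le> X
        \<and> (\<forall>p. prime p \<and> p dvd s \<longrightarrow> real p \<le> Lf (real n) (1/3) \<beta>) \<and> int k dvd int s - r)
        \<and> \<mu> ^ (v + u') * X / (2 * Zj) \<le> real (card S)"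
      using S(1) S2 unfolding y_def by blast
  qed
  define P where "P = \<mu> ^ (2 * v + u') * Z * s * C ^ d / (8192 * real v * real d * 16 ^ (d - 1))"
  have vr: "real v > 0" using pos by simp
  have P0: "P > 0" unfolding P_def using \<mu>0 Zp s0 C0 vr dr by simp
  have "P = \<mu> ^ v * Z / (8 * real v) * (s / (8 * real d)) * (\<mu> ^ (v + u') * X / (2 * Zj)) * (C / (16 * s)) ^ (d - 1)"
  proof -
    have "X / (2 * Zj) = C * s ^ (d - 1) / 128" using Zj by (simp add: X_def)
    then have "\<mu> ^ v * Z / (8 * real v) * (s / (8 * real d)) * (\<mu> ^ (v + u') * X / (2 * Zj)) * (C / (16 * s)) ^ (d - 1)
      = \<mu> ^ v * Z / (8 * real v) * (s / (8 * real d)) * (\<mu> ^ (v + u') * (C * s ^ (d - 1) / 128)) * (C / (16 * s)) ^ (d - 1)"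
      by (simp only: times_divide_eq_right[symmetric])
    also have "\<dots> = (\<mu> ^ v * \<mu> ^ (v + u')) * Z * s * (C * C ^ (d - 1)) / (8192 * real v * real d * 16 ^ (d - 1))"
      using s0 by (simp add: power_divide power_mult_distrib ac_simps)
    also have "\<mu> ^ v * \<mu> ^ (v + u') = \<mu> ^ (2 * v + u')" by (simp flip: power_add add: mult_2 add.assoc)
    also have "C * C ^ (d - 1) = C ^ d" using pos(1) by (cases d) auto
    finally show ?thesis by (simp only: P_def)
  qed
  also have "\<dots> \<le> real (card K) * (s / (8 * real d)) * (\<mu> ^ (v + u') * X / (2 * Zj)) * real q ^ (d - 1)"
    using cardK q(2) s0 dr \<mu>0 X0 Zj C0 by (intro mult_mono power_mono) auto
  also note main
  finally have PS: "P \<le> ?sum" .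
  \<comment> \<open>Division by zero gives 0 in \<open>expectX\<close>, so both families must be
    nonempty. An empty one would make the sum 0, which is less than P.\<close>
  have "card (Mset n \<delta> d) \<noteq> 0"
  proof
    assume "card (Mset n \<delta> d) = 0"
    then have "Mset n \<delta> d = {}" using finite_Mset by simp
    then show False using PS P0 by simp
  qed
  moreover have "card (Cset n \<delta> \<kappa> d) \<noteq> 0"
  proof
    assume "card (Cset n \<delta> \<kappa> d) = 0"
    then have "Cset n \<delta> \<kappa> d = {}" using finite_Cset by simp
    then show False using PS P0 by simp
  qed
  ultimately have mc: "0 < real (card (Mset n \<delta> d)) * real (card (Cset n \<delta> \<kappa> d))" by simp
  have "real (card (Mset n \<delta> d)) * real (card (Cset n \<delta> \<kappa> d)) \<le> M * (3 * C) ^ d"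
    using card_Mset_le[of n \<delta> M d] card_Cset_le[of n \<kappa> \<delta> C d] sizes(4) M0
    by (intro mult_mono) (auto simp: M_def C_def)
  then have "P / (M * (3 * C) ^ d) \<le> ?sum / (real (card (Mset n \<delta> d)) * real (card (Cset n \<delta> \<kappa> d)))"
    using PS P0 mc by (intro frac_le) auto
  also have "\<dots> = expectX n \<delta> \<kappa> \<sigma> \<beta> \<beta>" by (simp add: expectX_def Let_def d_def)
  finally have fin: "P / (M * (3 * C) ^ d) \<le> expectX n \<delta> \<kappa> \<sigma> \<beta> \<beta>" .
  have "P / (M * (3 * C) ^ d) = \<mu> ^ (2 * v + u') * R * s / (16384 * real v * real d * (16 ^ (d - 1) * 3 ^ d))"
    using M0 C0 by (simp add: P_def Z_def power_mult_distrib)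
  \<comment> \<open>In 48 = 16 * 3, the 16 comes from q >= C / (16 s) and the 3 from the bound 3 C
    on the number of values of a coefficient.\<close>
  also have "\<dots> \<ge> \<mu> ^ (2 * v + u') * R * (R / (4 * 16 ^ v)) / (16384 * real v * real d * 48 ^ d)"
  proof (intro frac_le mult_left_mono)
    have "(16::real) ^ (d - 1) * 3 ^ d \<le> 16 ^ d * 3 ^ d" by (intro mult_right_mono power_increasing) auto
    also have "\<dots> = 48 ^ d" by (simp flip: power_mult_distrib)
    finally show "(16::real) ^ (d - 1) * 3 ^ d \<le> 48 ^ d" .
  qed (use \<mu>0 R0 s0 s_bounds vr dr in auto)
  finally have "\<mu> ^ (2 * v + u') * R * (R / (4 * 16 ^ v)) / (16384 * real v * real d * 48 ^ d) \<le> expectX n \<delta> \<kappa> \<sigma> \<beta> \<beta>"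
    using fin by linarith
  moreover have "\<mu> ^ (2 * v + u') * R * (R / (4 * 16 ^ v)) / (16384 * real v * real d * 48 ^ d)
     = \<mu> ^ (2 * v + u') * R ^ 2 / 16 ^ v / (65536 * real v * real d * 48 ^ d)"
    by (simp add: power2_eq_square)
  ultimately show ?thesis by (simp only: \<mu>_def)
qed

section \<open>Asymptotics\<close>

definition loglog :: "nat \<Rightarrow> real" where "loglog n = ln (ln (real n))"
definition tscale :: "nat \<Rightarrow> real" where "tscale n = (ln (real n) / ln (ln (real n))) powr (1/3)"
text \<open>In terms of \<open>t\<close> = \<open>tscale n\<close> and \<open>l\<close> = \<open>loglog n\<close> we have \<open>L(1/3, c) = exp (c * t * l)\<close> and
  \<open>L(2/3, c) = exp (c * t\<^sup>2 * l)\<close>; all error terms are at most a constant times \<open>err_scale n = o(t * l)\<close>.\<close>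

definition err_scale :: "nat \<Rightarrow> real" where "err_scale n = tscale n * (1 + ln (loglog n)) + loglog n + 1"

text \<open>All lower-order losses can be gathered in one constant K, whose size does not
  matter.\<close>

lemma eventually_err_scale:
  assumes "\<epsilon> > 0"
  shows "\<forall>\<^sub>F n in sequentially. K * err_scale n \<le> \<epsilon> * (tscale n * loglog n)"
proof -
  have "(\<lambda>n. err_scale n / (tscale n * loglog n)) \<longlonglongrightarrow> 0" unfolding err_scale_def tscale_def loglog_def by real_asymp
  then have "(\<lambda>n. K * (err_scale n / (tscale n * loglog n))) \<longlonglongrightarrow> K * 0" by (intro tendsto_intros)
  then have "\<forall>\<^sub>F n in sequentially. K * (err_scale n / (tscale n * loglog n)) < \<epsilon>"
    using assms by (intro order_tendstoD(2)) auto
  moreover have "\<forall>\<^sub>F n in sequentially. tscale n * loglog n > 0" unfolding tscale_def loglog_def by real_asymp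
  ultimately show ?thesis by eventually_elim (simp add: field_simps)
qed

lemma filterlim_tscale: "filterlim tscale at_top sequentially" unfolding tscale_def by real_asymp
lemma filterlim_loglog: "filterlim loglog at_top sequentially" unfolding loglog_def by real_asymp

lemma eventually_basic: "\<forall>\<^sub>F n in sequentially. tscale n \<ge> c \<and> loglog n \<ge> c"
  using filterlim_tscale filterlim_loglog by (auto simp: filterlim_at_top intro: eventually_conj)

text \<open>The third identity is the source of the 1/3 in the exponent: log y has the size of t *
  l, and the logarithm of that is l/3 + O(log l).\<close>

lemma Lf_tscale:
  assumes "loglog n \<ge> 1"
  shows "Lf (real n) (1/3) c = exp (c * (tscale n * loglog n))" "Lf (real n) (2/3) c = exp (c * (tscale n * (tscale n * loglog n)))"
    "ln (tscale n) = (loglog n - ln (loglog n)) / 3"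
proof -
  define l where "l = ln (real n)"
  \<comment> \<open>Because \<open>ln 0 = 0\<close>, a vanishing \<open>ln n\<close> would make
    \<open>loglog n\<close> equal to 0.\<close>
  have "l > 0"
  proof (rule ccontr)
    assume "\<not> l > 0"
    then have "loglog n = ln l" "l \<le> 0" by (auto simp: loglog_def l_def)
    moreover have "l \<ge> 0" unfolding l_def by (cases "n = 0") auto
    ultimately show False using assms by simp
  qed
  define s where "s = loglog n"
  have s: "s > 0" "s = ln l" using assms by (auto simp: s_def loglog_def l_def)
  have t: "tscale n = l powr (1/3) / s powr (1/3)" using \<open>l > 0\<close> s by (simp add: tscale_def l_def s_def loglog_def powr_divide)
  have s3: "s = s powr (1/3) * s powr (2/3)" using s by (simp flip: powr_add)
  have s23: "s powr (2/3) = s powr (1/3) * s powr (1/3)" by (simp flip: powr_add)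
  have l23: "l powr (2/3) = l powr (1/3) * l powr (1/3)" by (simp flip: powr_add)
  have sp: "s powr (1/3) > 0" using s by simp
  have a: "tscale n * s = l powr (1/3) * s powr (2/3)" unfolding t using sp by (subst s3) (simp add: field_simps)
  show "Lf (real n) (1/3) c = exp (c * (tscale n * loglog n))"
    using a s by (simp add: Lf_def l_def s_def mult.assoc)
  have b: "tscale n * (tscale n * s) = l powr (2/3) * s powr (1/3)" unfolding a unfolding t l23 s23 using sp by simp
  show "Lf (real n) (2/3) c = exp (c * (tscale n * (tscale n * loglog n)))"
    using b s by (simp add: Lf_def l_def s_def mult.assoc)
  show "ln (tscale n) = (loglog n - ln (loglog n)) / 3"
    unfolding t using \<open>l > 0\<close> s by (simp add: ln_div ln_powr s_def[symmetric] diff_divide_distrib)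
qed

lemma err_scale_bounds:
  assumes "tscale n \<ge> 1" "loglog n \<ge> 1"
  shows "tscale n \<le> err_scale n" "loglog n \<le> err_scale n" "1 \<le> err_scale n" "tscale n * ln (loglog n) \<le> err_scale n" "ln (loglog n) \<le> err_scale n" "0 \<le> ln (loglog n)"
    "ln (tscale n) \<le> err_scale n"
proof -
  show l: "0 \<le> ln (loglog n)" using assms by simp
  then have "0 \<le> tscale n * ln (loglog n)" using assms by simp
  then show "tscale n \<le> err_scale n" "loglog n \<le> err_scale n" "1 \<le> err_scale n" "tscale n * ln (loglog n) \<le> err_scale n"
    using assms by (auto simp: err_scale_def distrib_left)
  have "ln (loglog n) \<le> loglog n" using assms ln_le_minus_one[of "loglog n"] by simp
  then show "ln (loglog n) \<le> err_scale n" using \<open>loglog n \<le> err_scale n\<close> by simp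
  have "ln (tscale n) \<le> tscale n" using assms ln_le_minus_one[of "tscale n"] by simp
  then show "ln (tscale n) \<le> err_scale n" using \<open>tscale n \<le> err_scale n\<close> by simp
qed

lemma prod_exp_div_power:
  assumes "c > 0"
  shows "(\<Prod>i<k. exp a / c ^ i) = exp (real k * a - ln c * (real k * (real k - 1) / 2))"
proof (induction k)
  case (Suc k)
  have "exp (real k * ln c) = c ^ k" using assms by (simp add: exp_of_nat_mult)
  then have "c ^ k = exp (ln c * real k)" by (simp only: mult.commute)
  then show ?case using Suc by (simp add: exp_diff[symmetric] exp_add[symmetric] field_simps)
qed simp

lemma deg_bounds:
  assumes "\<delta> * tscale n \<ge> 0"
  shows "\<delta> * tscale n - 1 \<le> real (deg \<delta> n)" "real (deg \<delta> n) \<le> \<delta> * tscale n + 1" "deg \<delta> n > 0"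
proof -
  define f where "f = \<lfloor>\<delta> * tscale n / 2\<rfloor>"
  have f: "f \<ge> 0" using assms by (simp add: f_def)
  have d: "deg \<delta> n = nat (2 * f + 1)" by (simp add: deg_def f_def tscale_def)
  then have r: "real (deg \<delta> n) = 2 * of_int f + 1" using f by simp
  have "of_int f \<le> \<delta> * tscale n / 2" "\<delta> * tscale n / 2 < of_int f + 1" unfolding f_def by linarith+
  then show "\<delta> * tscale n - 1 \<le> real (deg \<delta> n)" "real (deg \<delta> n) \<le> \<delta> * tscale n + 1" unfolding r by linarith+
  show "deg \<delta> n > 0" using f by (simp add: d)
qed

lemma harm_le_ln:
  assumes "n > 0"
  shows "harm n \<le> ln (real n) + 1"
proof -
  have "harm (Suc (n - 1)) - ln (real (Suc (n - 1))) \<le> harm (Suc 0) - ln (real (Suc 0))"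
    using decseqD[OF decseq_harm_diff_ln, of 0 "n - 1"] by simp
  then show ?thesis using assms by (simp add: harm_Suc harm_def)
qed

text \<open>\<open>\<eta>\<close> is a small slack. \<open>expectX_ge\<close> will be applied with h
  = 5 \<eta>, which turns 6 h v into 30 \<eta> v. The last assumption says that 1/\<delta> <
  (\<sigma> \<delta> + \<kappa>)/2, in the form 1 < \<delta> (\<kappa> - 1/\<delta> + \<sigma>
  \<delta>), survives with this margin.\<close>

locale sieve_params =
  fixes \<delta> \<kappa> \<sigma> \<beta> \<eta> :: real
  assumes pos: "\<delta> > 0" "\<sigma> > 0" "\<beta> > 0" "\<eta> > 0" and kd: "\<kappa> > 1 / \<delta>"
    and eta: "30 * \<eta> \<le> 1" "1 + 30 * \<eta> < \<delta> * (\<kappa> - 1 / \<delta> + \<sigma> * \<delta>)"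
begin

text \<open>\<open>v n\<close> and \<open>u n\<close> are the numbers of blocks, \<open>yl n\<close> and \<open>zl n j\<close> the logarithms of \<open>Y\<close> and \<open>Y'\<close> in
  \<open>expectX_ge\<close>, and \<open>ql n j\<close> is the logarithm of the product of the tops of the last \<open>u n\<close> blocks.\<close>

definition \<Gamma> where "\<Gamma> = \<kappa> - 1 / \<delta> + \<sigma> * \<delta>"
text \<open>With t / (\<delta> \<beta>) blocks the top Y would be about y. The excess 1 + \<eta>
  lowers it to about y^(1/(1 + \<eta>)), the larger excess 1 + 3 \<eta> in \<open>c2\<close> puts Y'
  below all blocks of the moduli, and both remain above L = y^(1 - 5 \<eta>). The factors 256^v and
  16^u are absorbed by these gaps.\<close>

definition c1 where "c1 = (1 + \<eta>) / (\<delta> * \<beta>)"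
definition c2 where "c2 = (1 + 3 * \<eta>) * \<Gamma> / \<beta>"
definition v :: "nat \<Rightarrow> nat" where "v n = nat \<lceil>c1 * tscale n\<rceil>"
definition u :: "nat \<Rightarrow> nat" where "u n = nat \<lceil>c2 * tscale n\<rceil>"
definition yl :: "nat \<Rightarrow> real" where
  "yl n = (\<sigma> * (tscale n * loglog n) + (tscale n * (tscale n * loglog n)) / \<delta> - 2 * ln 2) / real (v n) + (real (v n) - 1) / 2 * ln 256"
definition ql :: "nat \<Rightarrow> nat \<Rightarrow> real" where
  "ql n j = (\<kappa> - 1 / \<delta>) * (tscale n * (tscale n * loglog n)) - real j * ln 2
    + real (deg \<delta> n - 1) * (\<sigma> * (tscale n * loglog n) - (real j + 3) * ln 2) - 6 * ln 2"
definition zl :: "nat \<Rightarrow> nat \<Rightarrow> real" where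
  "zl n j = ql n j / real (u n) + (real (u n) - 1) / 2 * ln 16"

lemma Gpos: "\<Gamma> > 0" using pos kd by (simp add: \<Gamma>_def add_pos_pos)
lemma cpos: "c1 > 0" "c2 > 0" using pos Gpos by (auto simp: c1_def c2_def)

lemma v_bounds: "tscale n \<ge> 1 \<Longrightarrow> c1 * tscale n \<le> real (v n)" "tscale n \<ge> 1 \<Longrightarrow> real (v n) \<le> c1 * tscale n + 1"
  "tscale n \<ge> 1 \<Longrightarrow> v n > 0" "tscale n \<ge> 1 \<Longrightarrow> real (v n) \<le> (c1 + 1) * tscale n" 
proof -
  assume t: "tscale n \<ge> 1"
  have p: "c1 * tscale n > 0" using cpos t by simp
  then show "c1 * tscale n \<le> real (v n)" "real (v n) \<le> c1 * tscale n + 1" "v n > 0" unfolding v_def by linarith+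
  then show "real (v n) \<le> (c1 + 1) * tscale n" using t by (simp add: algebra_simps)
qed

lemma u_bounds: "tscale n \<ge> 1 \<Longrightarrow> c2 * tscale n \<le> real (u n)" "tscale n \<ge> 1 \<Longrightarrow> real (u n) \<le> c2 * tscale n + 1"
  "tscale n \<ge> 1 \<Longrightarrow> u n > 0" "tscale n \<ge> 1 \<Longrightarrow> real (u n) \<le> (c2 + 1) * tscale n" 
proof -
  assume t: "tscale n \<ge> 1"
  have p: "c2 * tscale n > 0" using cpos t by simp
  then show "c2 * tscale n \<le> real (u n)" "real (u n) \<le> c2 * tscale n + 1" "u n > 0" unfolding u_def by linarith+
  then show "real (u n) \<le> (c2 + 1) * tscale n" using t by (simp add: algebra_simps)
qed

lemma d_bounds:
  assumes "tscale n \<ge> 1"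
  shows "\<delta> * tscale n - 2 \<le> real (deg \<delta> n - 1)" "real (deg \<delta> n - 1) \<le> \<delta> * tscale n" "real (deg \<delta> n) \<le> (\<delta> + 1) * tscale n"
    "deg \<delta> n > 0"
proof -
  have "\<delta> * tscale n \<ge> 0" using pos assms by simp
  note D = deg_bounds[OF this]
  show "deg \<delta> n > 0" by (rule D)
  then show "\<delta> * tscale n - 2 \<le> real (deg \<delta> n - 1)" "real (deg \<delta> n - 1) \<le> \<delta> * tscale n" using D by linarith+
  show "real (deg \<delta> n) \<le> (\<delta> + 1) * tscale n" using D assms by (simp add: algebra_simps)
qed

lemma yl_upper:
  assumes "tscale n \<ge> 1" "loglog n \<ge> 1"
  shows "yl n \<le> \<beta> / (1 + \<eta>) * (tscale n * loglog n) + (\<sigma> / c1 + (c1 + 1) * ln 256) * err_scale n"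
proof -
  note V = v_bounds[OF assms(1)] and W = err_scale_bounds[OF assms]
  define N where "N = \<sigma> * (tscale n * loglog n) + (tscale n * (tscale n * loglog n)) / \<delta>"
  have N0: "N \<ge> 0" using pos assms by (simp add: N_def)
  have "(N - 2 * ln 2) / real (v n) \<le> N / real (v n)" using V(3) by (intro divide_right_mono) auto
  also have "\<dots> \<le> N / (c1 * tscale n)" using V(1,3) N0 cpos assms by (intro divide_left_mono) auto
  also have "\<dots> = \<sigma> / c1 * loglog n + 1 / (\<delta> * c1) * (tscale n * loglog n)"
    using assms cpos pos by (simp add: N_def field_simps)
  also have "1 / (\<delta> * c1) = \<beta> / (1 + \<eta>)" using pos by (simp add: c1_def)
  also have "\<sigma> / c1 * loglog n \<le> \<sigma> / c1 * err_scale n" using W pos cpos by (intro mult_left_mono) auto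
  finally have 1: "(N - 2 * ln 2) / real (v n) \<le> \<sigma> / c1 * err_scale n + \<beta> / (1 + \<eta>) * (tscale n * loglog n)" by simp
  have "(real (v n) - 1) / 2 \<le> real (v n)" using of_nat_0_le_iff[of "v n"] by (simp add: field_simps)
  also have "\<dots> \<le> (c1 + 1) * tscale n" by (rule V)
  also have "\<dots> \<le> (c1 + 1) * err_scale n" using W cpos by (intro mult_left_mono) auto
  finally have "(real (v n) - 1) / 2 * ln 256 \<le> (c1 + 1) * err_scale n * ln 256" by (intro mult_right_mono) auto
  from add_mono[OF 1 this] have "yl n \<le> \<sigma> / c1 * err_scale n + \<beta> / (1 + \<eta>) * (tscale n * loglog n) + (c1 + 1) * err_scale n * ln 256"
    by (simp only: yl_def N_def)
  moreover have "(\<sigma> / c1 + (c1 + 1) * ln 256) * err_scale n = \<sigma> / c1 * err_scale n + (c1 + 1) * err_scale n * ln 256"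
    by (simp only: distrib_right mult.assoc mult.commute[of "err_scale n"])
  ultimately show ?thesis by linarith
qed

text \<open>Controls the rounding up of the number of blocks: the correction 1/(c^2 t), multiplied
  by a constant times t * l, changes the logarithm of a top by O(l) only.\<close>

lemma frac_lower:
  fixes c t :: real
  assumes "c > 0" "t > 0" shows "1 / c - 1 / (c * c * t) \<le> t / (c * t + 1)"
proof -
  have "c * t + 1 > 0" using assms by (simp add: add_pos_pos)
  moreover have "(1 / c - 1 / (c * c * t)) * (c * t + 1) = t - 1 / (c * c * t)" using assms by (simp add: field_simps)
  moreover have "\<dots> \<le> t" using assms by simp
  ultimately show ?thesis by (simp add: pos_le_divide_eq)
qed

lemma yl_lower:
  assumes "tscale n \<ge> 1" "loglog n \<ge> 1" "\<sigma> * (tscale n * loglog n) \<ge> 2 * ln 2"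
  shows "\<beta> / (1 + \<eta>) * (tscale n * loglog n) - 1 / (\<delta> * c1 * c1) * err_scale n \<le> yl n"
proof -
  note V = v_bounds[OF assms(1)] and W = err_scale_bounds[OF assms(1,2)]
  have q: "1 / c1 - 1 / (c1 * c1 * tscale n) \<le> tscale n / (c1 * tscale n + 1)" using cpos assms by (intro frac_lower) auto
  have "\<beta> / (1 + \<eta>) = 1 / (\<delta> * c1)" using pos by (simp add: c1_def)
  then have "\<beta> / (1 + \<eta>) * (tscale n * loglog n) - 1 / (\<delta> * c1 * c1) * loglog n
      = (1 / c1 - 1 / (c1 * c1 * tscale n)) * (tscale n * loglog n / \<delta>)"
    using assms cpos pos by (simp add: field_simps)
  also have "\<dots> \<le> tscale n / (c1 * tscale n + 1) * (tscale n * loglog n / \<delta>)" using q assms pos by (intro mult_right_mono) auto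
  also have "\<dots> = (tscale n * (tscale n * loglog n)) / \<delta> / (c1 * tscale n + 1)" by simp
  also have "\<dots> \<le> (tscale n * (tscale n * loglog n)) / \<delta> / real (v n)"
    using V assms pos cpos by (intro divide_left_mono) (auto intro!: mult_pos_pos add_pos_pos)
  also have "\<dots> \<le> (\<sigma> * (tscale n * loglog n) + (tscale n * (tscale n * loglog n)) / \<delta> - 2 * ln 2) / real (v n)"
    using assms(3) by (intro divide_right_mono) auto
  also have "\<dots> \<le> yl n" unfolding yl_def using V(3) by simp
  finally have "\<beta> / (1 + \<eta>) * (tscale n * loglog n) - 1 / (\<delta> * c1 * c1) * loglog n \<le> yl n" .
  moreover have "1 / (\<delta> * c1 * c1) * loglog n \<le> 1 / (\<delta> * c1 * c1) * err_scale n"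
    using W pos cpos by (intro mult_left_mono) auto
  ultimately show ?thesis by linarith
qed

lemma zl_upper:
  assumes "tscale n \<ge> 1" "loglog n \<ge> 1"
  shows "zl n j \<le> \<beta> / (1 + 3 * \<eta>) * (tscale n * loglog n) + (c2 + 1) * ln 16 * err_scale n"
proof -
  note U = u_bounds[OF assms(1)] and W = err_scale_bounds[OF assms] and D = d_bounds[OF assms(1)]
  have l2: "0 \<le> real k * ln 2" for k :: nat by simp
  have "real (deg \<delta> n - 1) * (\<sigma> * (tscale n * loglog n) - (real j + 3) * ln 2) \<le> real (deg \<delta> n - 1) * (\<sigma> * (tscale n * loglog n))"
    by (intro mult_left_mono) auto
  also have "\<dots> \<le> (\<delta> * tscale n) * (\<sigma> * (tscale n * loglog n))" using D pos assms by (intro mult_right_mono) auto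
  finally have "ql n j \<le> (\<kappa> - 1 / \<delta>) * (tscale n * (tscale n * loglog n)) + (\<delta> * tscale n) * (\<sigma> * (tscale n * loglog n))"
    unfolding ql_def using l2[of j] ln_gt_zero[of "2::real"] by linarith
  also have "\<dots> = \<Gamma> * (tscale n * (tscale n * loglog n))" by (simp add: \<Gamma>_def algebra_simps)
  finally have "ql n j / real (u n) \<le> \<Gamma> * (tscale n * (tscale n * loglog n)) / real (u n)" by (intro divide_right_mono) auto
  also have "\<dots> \<le> \<Gamma> * (tscale n * (tscale n * loglog n)) / (c2 * tscale n)"
    using U Gpos cpos assms by (intro divide_left_mono) auto
  also have "\<dots> = \<Gamma> / c2 * (tscale n * loglog n)" using assms by simp
  also have "\<Gamma> / c2 = \<beta> / (1 + 3 * \<eta>)" using Gpos pos by (simp add: c2_def)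
  finally have 1: "ql n j / real (u n) \<le> \<beta> / (1 + 3 * \<eta>) * (tscale n * loglog n)" .
  have "(real (u n) - 1) / 2 \<le> real (u n)" using of_nat_0_le_iff[of "u n"] by (simp add: field_simps)
  also have "\<dots> \<le> (c2 + 1) * tscale n" by (rule U)
  also have "\<dots> \<le> (c2 + 1) * err_scale n" using W cpos by (intro mult_left_mono) auto
  finally have "(real (u n) - 1) / 2 * ln 16 \<le> (c2 + 1) * err_scale n * ln 16" by (intro mult_right_mono) auto
  from add_mono[OF 1 this] have "zl n j \<le> \<beta> / (1 + 3 * \<eta>) * (tscale n * loglog n) + (c2 + 1) * err_scale n * ln 16"
    by (simp only: zl_def)
  moreover have "(c2 + 1) * ln 16 * err_scale n = (c2 + 1) * err_scale n * ln 16"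
    by (simp only: mult.assoc mult.commute[of "err_scale n"])
  ultimately show ?thesis by linarith
qed

text \<open>Collects the losses of order t^2 in \<open>ql\<close>: j is O(t) and is multiplied by
  the degree, again O(t). They are smaller than the main term \<Gamma> t^2 l by a factor of order
  l.\<close>

definition K0 where "K0 = ln 2 * (4 * (c1 + 1) + \<delta> * (3 + 4 * (c1 + 1)) + 6)"

lemma zl_lower:
  assumes "tscale n \<ge> 1" "loglog n \<ge> 1" "j < 4 * v n" "2 * \<sigma> * loglog n + K0 * tscale n \<le> \<Gamma> * (tscale n * loglog n)"
  shows "\<beta> / (1 + 3 * \<eta>) * (tscale n * loglog n) - (2 * \<sigma> / c2 + K0 / c2 + \<Gamma> / (c2 * c2)) * err_scale n \<le> zl n j"
proof -
  define t where "t = tscale n"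
  note U = u_bounds[OF assms(1)] and V = v_bounds[OF assms(1)] and W = err_scale_bounds[OF assms(1,2)] and D = d_bounds[OF assms(1)]
  have t1: "t \<ge> 1" using assms by (simp add: t_def)
  define G where "G = \<Gamma> * (t * loglog n) - 2 * \<sigma> * loglog n - K0 * t"
  have G0: "G \<ge> 0" using assms(4) by (simp add: G_def t_def)
  have l2: "ln 2 \<ge> (0::real)" by simp
  have j: "real j \<le> 4 * (c1 + 1) * t" 
  proof -
    have "real j \<le> 4 * real (v n)" using assms(3) by linarith
    then have "real j \<le> 4 * ((c1 + 1) * tscale n)" using V(4) by linarith
    then show ?thesis by (simp only: t_def mult.assoc)
  qed
  have tsq: "t \<le> t * t" "1 \<le> t * t" using t1 by (auto intro: mult_mono[of 1 t 1 t, simplified] simp: mult_le_cancel_left1)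
  have e1: "real j * ln 2 \<le> ln 2 * (4 * (c1 + 1)) * (t * t)"
  proof -
    have "real j \<le> 4 * (c1 + 1) * (t * t)" using j tsq cpos by (smt (verit) mult_left_mono)
    from mult_right_mono[OF this l2] show ?thesis by (simp add: ac_simps)
  qed
  have e2: "real (deg \<delta> n - 1) * ((real j + 3) * ln 2) \<le> ln 2 * (\<delta> * (3 + 4 * (c1 + 1))) * (t * t)"
  proof -
    have "real j + 3 \<le> (3 + 4 * (c1 + 1)) * t" using j t1 by (simp add: algebra_simps)
    then have "(real j + 3) * ln 2 \<le> (3 + 4 * (c1 + 1)) * t * ln 2" using l2 by (rule mult_right_mono)
    then have "real (deg \<delta> n - 1) * ((real j + 3) * ln 2) \<le> (\<delta> * t) * ((3 + 4 * (c1 + 1)) * t * ln 2)"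
      using D pos t1 by (intro mult_mono) (auto simp: t_def)
    then show ?thesis by (simp add: ac_simps)
  qed
  have e3: "6 * ln 2 \<le> ln 2 * 6 * (t * t)" using mult_left_mono[OF tsq(2), of "ln 2 * 6"] l2 by simp
  have e4: "(\<delta> * t - 2) * (\<sigma> * (t * loglog n)) \<le> real (deg \<delta> n - 1) * (\<sigma> * (t * loglog n))"
    using D pos assms t1 by (intro mult_right_mono) (auto simp: t_def)
  have "ql n j = (\<kappa> - 1 / \<delta>) * (t * (t * loglog n)) - real j * ln 2
    + (real (deg \<delta> n - 1) * (\<sigma> * (t * loglog n)) - real (deg \<delta> n - 1) * ((real j + 3) * ln 2)) - 6 * ln 2"
    by (simp only: ql_def t_def right_diff_distrib)
  also have "\<dots> \<ge> (\<kappa> - 1 / \<delta>) * (t * (t * loglog n)) + (\<delta> * t - 2) * (\<sigma> * (t * loglog n))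
     - (ln 2 * (4 * (c1 + 1)) * (t * t) + ln 2 * (\<delta> * (3 + 4 * (c1 + 1))) * (t * t) + ln 2 * 6 * (t * t))"
    using e1 e2 e3 e4 by linarith
  also have "(\<kappa> - 1 / \<delta>) * (t * (t * loglog n)) + (\<delta> * t - 2) * (\<sigma> * (t * loglog n))
     - (ln 2 * (4 * (c1 + 1)) * (t * t) + ln 2 * (\<delta> * (3 + 4 * (c1 + 1))) * (t * t) + ln 2 * 6 * (t * t)) = t * G"
    by (simp add: G_def \<Gamma>_def K0_def algebra_simps)
  finally have ql: "t * G \<le> ql n j" .
  have q: "1 / c2 - 1 / (c2 * c2 * t) \<le> t / (c2 * t + 1)" using cpos t1 by (intro frac_lower) auto
  have "G / (c2 * c2 * t) \<le> \<Gamma> * (t * loglog n) / (c2 * c2 * t)"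
  proof (rule divide_right_mono)
    have "0 \<le> 2 * \<sigma> * loglog n + K0 * t" using pos cpos assms t1 by (simp add: K0_def)
    then show "G \<le> \<Gamma> * (t * loglog n)" by (simp add: G_def)
  qed (use cpos t1 in auto)
  also have "\<dots> = \<Gamma> / (c2 * c2) * loglog n" using t1 by simp
  finally have g: "G / (c2 * c2 * t) \<le> \<Gamma> / (c2 * c2) * loglog n" .
  have "G / c2 - G / (c2 * c2 * t) = (1 / c2 - 1 / (c2 * c2 * t)) * G" by (simp add: algebra_simps)
  also have "\<dots> \<le> t / (c2 * t + 1) * G" using q G0 by (rule mult_right_mono)
  also have "\<dots> = t * G / (c2 * t + 1)" by simp
  also have "\<dots> \<le> t * G / real (u n)"
    using U G0 t1 cpos by (intro divide_left_mono) (auto simp: t_def intro!: mult_pos_pos add_pos_pos)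
  also have "\<dots> \<le> ql n j / real (u n)" using ql by (intro divide_right_mono) auto
  also have "\<dots> \<le> zl n j" unfolding zl_def using U(3) by simp
  finally have z: "G / c2 - \<Gamma> / (c2 * c2) * loglog n \<le> zl n j" using g by linarith
  have "G / c2 = \<Gamma> / c2 * (t * loglog n) - 2 * \<sigma> / c2 * loglog n - K0 / c2 * t" by (simp add: G_def diff_divide_distrib)
  also have "\<Gamma> / c2 = \<beta> / (1 + 3 * \<eta>)" using Gpos pos by (simp add: c2_def)
  finally have "\<beta> / (1 + 3 * \<eta>) * (t * loglog n) - 2 * \<sigma> / c2 * loglog n - K0 / c2 * t - \<Gamma> / (c2 * c2) * loglog n \<le> zl n j"
    using z by simp
  moreover have nn: "0 \<le> 2 * \<sigma> / c2" "0 \<le> K0 / c2" "0 \<le> \<Gamma> / (c2 * c2)"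
    using pos cpos Gpos by (simp_all add: K0_def)
  moreover have "2 * \<sigma> / c2 * loglog n \<le> 2 * \<sigma> / c2 * err_scale n" "K0 / c2 * t \<le> K0 / c2 * err_scale n"
    "\<Gamma> / (c2 * c2) * loglog n \<le> \<Gamma> / (c2 * c2) * err_scale n"
    using mult_left_mono[OF W(2) nn(1)] mult_left_mono[OF W(1) nn(2)] mult_left_mono[OF W(2) nn(3)]
    by (simp_all only: t_def)
  ultimately show ?thesis unfolding t_def distrib_right by linarith
qed
end

section \<open>The hypotheses of \<open>expectX_ge\<close> for large n\<close>

context sieve_params
begin

abbreviation tl where "tl n \<equiv> tscale n * loglog n"

definition lc where "lc = \<bar>ln (160 * \<beta>)\<bar>"

lemma ln_160_bound:
  assumes "tscale n \<ge> 1" "loglog n \<ge> 1"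
  shows "ln (160 * (\<beta> * tl n)) \<le> (lc + 2) * err_scale n"
proof -
  note W = err_scale_bounds[OF assms]
  have "160 * (\<beta> * tl n) = (160 * \<beta>) * (tscale n * loglog n)" by simp
  then have "ln (160 * (\<beta> * tl n)) = ln (160 * \<beta>) + (ln (tscale n) + ln (loglog n))"
    using assms pos by (simp only:) (subst ln_mult, auto simp: ln_mult)
  moreover have "ln (160 * \<beta>) \<le> lc * err_scale n" using W(3) mult_left_mono[of 1 "err_scale n" lc] unfolding lc_def by simp
  ultimately show ?thesis using W(5,7) by (simp add: distrib_right)
qed

lemma block_counts_times_le:
  assumes "tscale n \<ge> 1" "loglog n \<ge> 1" "c \<ge> 0"
  shows "real (v n) * c \<le> (c1 + 1) * c * err_scale n" "real (u n) * c \<le> (c2 + 1) * c * err_scale n"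
    "real (deg \<delta> n) * c \<le> (\<delta> + 1) * c * err_scale n"
proof -
  note W = err_scale_bounds[OF assms(1,2)]
  have *: "x * c \<le> k * c * err_scale n" if "x \<le> k * tscale n" "k \<ge> 0" for x k
  proof -
    have "x \<le> k * err_scale n" using that mult_left_mono[OF W(1) that(2)] by linarith
    from mult_right_mono[OF this assms(3)] show ?thesis by (simp only: ac_simps)
  qed
  show "real (v n) * c \<le> (c1 + 1) * c * err_scale n" "real (u n) * c \<le> (c2 + 1) * c * err_scale n"
    "real (deg \<delta> n) * c \<le> (\<delta> + 1) * c * err_scale n"
    using v_bounds(4)[OF assms(1)] u_bounds(4)[OF assms(1)] d_bounds(3)[OF assms(1)] cpos pos by (auto intro!: *)
qed

text \<open>Multiplied by \<open>tl n\<close>, these gaps absorb the errors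
  O(\<open>err_scale n\<close>) in the comparison of y, Y, Y' and L.\<close>

lemma eta_gaps:
  "0 < \<beta> - \<beta> / (1 + \<eta>)" "0 < \<beta> / (1 + \<eta>) - (1 - 5 * \<eta>) * \<beta>"
  "0 < \<beta> / (1 + \<eta>) - \<beta> / (1 + 3 * \<eta>)" "0 < \<beta> / (1 + 3 * \<eta>) - (1 - 5 * \<eta>) * \<beta>"
proof -
  show "0 < \<beta> - \<beta> / (1 + \<eta>)" using pos by (simp add: field_simps)
  show "0 < \<beta> / (1 + \<eta>) - \<beta> / (1 + 3 * \<eta>)" using pos by (simp add: frac_less2)
  have *: "(1 - 5 * \<eta>) * \<beta> < \<beta> / (1 + c * \<eta>)" if "0 < c" "c < 5" for c
  proof -
    have "(1 - 5 * \<eta>) * (1 + c * \<eta>) = 1 - (5 - c) * \<eta> - 5 * c * (\<eta> * \<eta>)" by (simp add: algebra_simps)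
    also have "\<dots> < 1"
    proof -
      have "0 < (5 - c) * \<eta>" "0 \<le> 5 * c * (\<eta> * \<eta>)" using that pos by auto
      then show ?thesis by linarith
    qed
    finally have "(1 - 5 * \<eta>) * (1 + c * \<eta>) * \<beta> < 1 * \<beta>" using pos by (intro mult_strict_right_mono)
    moreover have "0 < 1 + c * \<eta>" using that pos by (simp add: add_pos_pos)
    ultimately show ?thesis by (simp add: pos_less_divide_eq ac_simps)
  qed
  show "0 < \<beta> / (1 + \<eta>) - (1 - 5 * \<eta>) * \<beta>" "0 < \<beta> / (1 + 3 * \<eta>) - (1 - 5 * \<eta>) * \<beta>"
    using *[of 1] *[of 3] by auto
qed

lemma eventually_scale_upper: "\<forall>\<^sub>F n in sequentially. yl n \<le> \<beta> * tl n"
  using eventually_err_scale[OF eta_gaps(1), of "\<sigma> / c1 + (c1 + 1) * ln 256"] eventually_basic[of 1]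
proof eventually_elim
  case (elim n)
  then have t: "tscale n \<ge> 1" "loglog n \<ge> 1" by auto
  show ?case using elim(1) yl_upper[OF t] unfolding left_diff_distrib by linarith
qed

lemma eventually_scale_lower:
  "\<forall>\<^sub>F n in sequentially. ln (160 * (\<beta> * tl n)) + (1 - 5 * \<eta>) * (\<beta> * tl n) \<le> yl n - real (v n) * ln 256"
proof -
  have "\<forall>\<^sub>F n in sequentially. 2 * err_scale n \<le> \<sigma> * tl n" using pos by (intro eventually_err_scale)
  then show ?thesis
    using eventually_err_scale[OF eta_gaps(2), of "(lc + 2) + (c1 + 1) * ln 256 + 1 / (\<delta> * c1 * c1)"] eventually_basic[of 1]
  proof eventually_elim
    case (elim n)
    then have t: "tscale n \<ge> 1" "loglog n \<ge> 1" by auto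
    have "2 * ln 2 \<le> 2 * err_scale n" using err_scale_bounds(3)[OF t] ln_2_less_1 by linarith
    then have s: "\<sigma> * tl n \<ge> 2 * ln 2" using elim(1) by linarith
    show ?case
      using elim(2) yl_lower[OF t s] ln_160_bound[OF t] block_counts_times_le(1)[OF t, of "ln 256"]
      unfolding left_diff_distrib distrib_right mult.assoc by simp
  qed
qed

lemma eventually_second_scale:
  "\<forall>\<^sub>F n in sequentially. \<forall>j<4 * v n. zl n j \<le> yl n - real (v n) * ln 256
     \<and> ln (160 * (\<beta> * tl n)) + (1 - 5 * \<eta>) * (\<beta> * tl n) \<le> zl n j - real (u n) * ln 16"
proof -
  have "\<forall>\<^sub>F n in sequentially. 2 * err_scale n \<le> \<sigma> * tl n" using pos by (intro eventually_err_scale)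
  moreover have "\<forall>\<^sub>F n in sequentially. (2 * \<sigma> + K0) * err_scale n \<le> \<Gamma> * tl n" using Gpos by (intro eventually_err_scale)
  ultimately show ?thesis
    using eventually_err_scale[OF eta_gaps(3), of "(c2 + 1) * ln 16 + 1 / (\<delta> * c1 * c1) + (c1 + 1) * ln 256"]
      eventually_err_scale[OF eta_gaps(4), of "(lc + 2) + (2 * \<sigma> / c2 + K0 / c2 + \<Gamma> / (c2 * c2)) + (c2 + 1) * ln 16"] eventually_basic[of 1]
  proof eventually_elim
    case (elim n)
    then have t: "tscale n \<ge> 1" "loglog n \<ge> 1" by auto
    note W = err_scale_bounds[OF t]
    have "2 * ln 2 \<le> 2 * err_scale n" using W(3) ln_2_less_1 by linarith
    then have s: "\<sigma> * tl n \<ge> 2 * ln 2" using elim(1) by linarith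
    have K: "K0 \<ge> 0" using pos cpos by (simp add: K0_def)
    have "2 * \<sigma> * loglog n \<le> 2 * \<sigma> * err_scale n" "K0 * tscale n \<le> K0 * err_scale n"
      using mult_left_mono[OF W(2), of "2 * \<sigma>"] mult_left_mono[OF W(1) K] pos by auto
    then have g: "2 * \<sigma> * loglog n + K0 * tscale n \<le> \<Gamma> * (tscale n * loglog n)" using elim(2) unfolding distrib_right by linarith
    show ?case
    proof (intro allI impI conjI)
      fix j assume j: "j < 4 * v n"
      show "zl n j \<le> yl n - real (v n) * ln 256"
        using elim(3) yl_lower[OF t s] zl_upper[OF t, of j] block_counts_times_le(1)[OF t, of "ln 256"]
        unfolding left_diff_distrib distrib_right mult.assoc by simp
      define a where "a = 2 * \<sigma> / c2 + K0 / c2 + \<Gamma> / (c2 * c2)"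
      show "ln (160 * (\<beta> * tl n)) + (1 - 5 * \<eta>) * (\<beta> * tl n) \<le> zl n j - real (u n) * ln 16"
        using elim(4) zl_lower[OF t j g] ln_160_bound[OF t] block_counts_times_le(2)[OF t, of "ln 16"]
        unfolding a_def[symmetric] left_diff_distrib distrib_right mult.assoc by simp
    qed
  qed
qed

text \<open>The ratio c2 / c1 is at least \<delta> \<Gamma>, hence more than 1 + 30 \<eta>; for
  large t the surplus also covers the rounding and the constant 2.\<close>

lemma eventually_block_ratio:
  "\<forall>\<^sub>F n in sequentially. 2 * real (v n) + 6 * (5 * \<eta>) * real (v n) + 2 \<le> real (v n + u n)"
proof -
  have g: "0 < c2 - c1 * (1 + 30 * \<eta>)"
  proof -
    have "(1 + \<eta>) * (1 + 30 * \<eta>) < (1 + \<eta>) * (\<delta> * \<Gamma>)"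
      using eta pos by (intro mult_strict_left_mono) (auto simp: \<Gamma>_def)
    also have "\<dots> \<le> (1 + 3 * \<eta>) * (\<delta> * \<Gamma>)" using pos Gpos by (intro mult_right_mono) auto
    finally have "(1 + \<eta>) * (1 + 30 * \<eta>) / (\<delta> * \<beta>) < (1 + 3 * \<eta>) * (\<delta> * \<Gamma>) / (\<delta> * \<beta>)"
      using pos by (intro divide_strict_right_mono) auto
    moreover have "(1 + 3 * \<eta>) * (\<delta> * \<Gamma>) / (\<delta> * \<beta>) = c2" using pos by (simp add: c2_def)
    ultimately show ?thesis by (simp add: c1_def)
  qed
  show ?thesis
    using eventually_basic[of 1] eventually_basic[of "(3 + 30 * \<eta>) / (c2 - c1 * (1 + 30 * \<eta>))"]
  proof eventually_elim
    case (elim n)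
    then have t: "tscale n \<ge> 1" and "tscale n \<ge> (3 + 30 * \<eta>) / (c2 - c1 * (1 + 30 * \<eta>))" by auto
    then have "3 + 30 * \<eta> \<le> tscale n * (c2 - c1 * (1 + 30 * \<eta>))" using g by (simp add: pos_divide_le_eq)
    moreover have "real (v n) * (1 + 30 * \<eta>) \<le> (c1 * tscale n + 1) * (1 + 30 * \<eta>)"
      using v_bounds(2)[OF t] pos by (intro mult_right_mono) auto
    ultimately show ?case using u_bounds(1)[OF t] by (simp add: algebra_simps)
  qed
qed

lemma exp_le_mult: "x \<le> exp a \<Longrightarrow> y \<le> exp b \<Longrightarrow> 0 \<le> x \<Longrightarrow> 0 \<le> y \<Longrightarrow> x * y \<le> exp (a + b :: real)"
  unfolding exp_add by (rule mult_mono) auto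

lemma le_exp_self: "x \<le> y \<Longrightarrow> x \<le> exp (y :: real)"
  using exp_ge_add_one_self[of y] by linarith

lemma power_eq_exp: "0 < c \<Longrightarrow> c ^ k = exp (real k * ln (c :: real))"
  by (simp add: exp_of_nat_mult)

text \<open>The harmonic number is about log(y^(2 v)), of order t^2 l, and 4^v is exp(O(t)); half a
  power of y outweighs both.\<close>

lemma eventually_bad_proportion:
  "\<forall>\<^sub>F n in sequentially. 32 * real (v n) * 4 ^ v n * (2 + 4 * harm (nat \<lfloor>exp (\<beta> * tl n)\<rfloor> ^ (2 * v n)))
     \<le> exp (\<beta> * tl n) powr (1 / 2)"
proof -
  define k where "k = 6 + 8 * \<beta> * (c1 + 1)"
  have "\<forall>\<^sub>F n in sequentially. ((k + 3) + (c1 + 1) * 32 + (c1 + 1) * ln 4) * err_scale n \<le> \<beta> / 2 * tl n"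
    using pos by (intro eventually_err_scale) auto
  then show ?thesis using eventually_basic[of 1]
  proof eventually_elim
    case (elim n)
    then have t: "tscale n \<ge> 1" "loglog n \<ge> 1" by auto
    note W = err_scale_bounds[OF t] and V = v_bounds[OF t(1)]
    have tl1: "tl n \<ge> 1" using mult_mono[of 1 "tscale n" 1 "loglog n"] t by simp
    define y where "y = exp (\<beta> * tl n)"
    define N where "N = nat \<lfloor>y\<rfloor> ^ (2 * v n)"
    have y1: "y \<ge> 1" using pos tl1 by (simp add: y_def)
    have f: "nat \<lfloor>y\<rfloor> > 0" "real (nat \<lfloor>y\<rfloor>) \<le> y" using y1 by auto
    have N0: "N > 0" using f by (simp add: N_def)
    have "real N \<le> y ^ (2 * v n)" unfolding N_def of_nat_power using f by (intro power_mono) auto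
    then have "ln (real N) \<le> ln (y ^ (2 * v n))" using N0 y1 by (subst ln_le_cancel_iff) auto
    also have "\<dots> = 2 * real (v n) * (\<beta> * tl n)" using y1 by (simp add: ln_realpow y_def)
    also have "\<dots> \<le> 2 * ((c1 + 1) * tscale n) * (\<beta> * tl n)"
      using V(4) pos tl1 by (intro mult_right_mono mult_left_mono) auto
    finally have lnN: "ln (real N) \<le> 2 * ((c1 + 1) * tscale n) * (\<beta> * tl n)" .
    have "2 + 4 * harm N \<le> 6 + 4 * ln (real N)" using harm_le_ln[OF N0] by simp
    also have "\<dots> \<le> 6 * (tscale n * tl n) + 8 * \<beta> * (c1 + 1) * (tscale n * tl n)"
      using lnN mult_mono[of 1 "tscale n" 1 "tl n"] t tl1 by (simp add: algebra_simps)
    also have "\<dots> = k * (tscale n * tl n)" by (simp add: k_def algebra_simps)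
    also have "\<dots> \<le> exp (k * err_scale n + (err_scale n + (err_scale n + err_scale n)))"
    proof (intro exp_le_mult)
      have "0 \<le> k" using pos cpos by (simp add: k_def)
      then show "k \<le> exp (k * err_scale n)" using mult_left_mono[OF W(3)] by (intro le_exp_self) simp
      have "tscale n = exp (ln (tscale n))" "loglog n = exp (ln (loglog n))" using t by auto
      then show "tscale n \<le> exp (err_scale n)" "tscale n \<le> exp (err_scale n)" "loglog n \<le> exp (err_scale n)" using W by (metis exp_le_cancel_iff)+
    qed (use t pos cpos in \<open>auto simp: k_def\<close>)
    finally have h: "2 + 4 * harm N \<le> exp ((k + 3) * err_scale n)" by (simp add: algebra_simps)
    have "32 * real (v n) \<le> exp ((c1 + 1) * 32 * err_scale n)" using block_counts_times_le(1)[OF t, of 32] by (intro le_exp_self) simp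
    moreover have "4 ^ v n \<le> exp ((c1 + 1) * ln 4 * err_scale n)" using block_counts_times_le(1)[OF t, of "ln 4"] by (simp add: power_eq_exp)
    ultimately have "32 * real (v n) * 4 ^ v n * (2 + 4 * harm N)
       \<le> exp ((c1 + 1) * 32 * err_scale n + (c1 + 1) * ln 4 * err_scale n + (k + 3) * err_scale n)"
      using h by (intro exp_le_mult) (auto simp: harm_nonneg)
    also have "\<dots> \<le> exp (\<beta> / 2 * tl n)" using elim(1) by (simp add: distrib_right)
    also have "\<dots> = y powr (1 / 2)" by (simp add: y_def powr_def)
    finally show ?case by (simp only: N_def y_def)
  qed
qed

lemma eventually_many_b:
  "\<forall>\<^sub>F n in sequentially. 8 * real (deg \<delta> n) * (1 + real (v n)) \<le> exp (\<sigma> * tl n) / 2 / (4 * 16 ^ v n)"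
proof -
  have "\<forall>\<^sub>F n in sequentially. ((\<delta> + 1) * 8 + (c1 + 1) * 1 + 8 + (c1 + 1) * ln 16) * err_scale n \<le> \<sigma> * tl n"
    using pos by (intro eventually_err_scale) auto
  then show ?thesis using eventually_basic[of 1]
  proof eventually_elim
    case (elim n)
    then have t: "tscale n \<ge> 1" "loglog n \<ge> 1" by auto
    note W = err_scale_bounds[OF t]
    have "8 * real (deg \<delta> n) \<le> exp ((\<delta> + 1) * 8 * err_scale n)" using block_counts_times_le(3)[OF t, of 8] by (intro le_exp_self) simp
    moreover have "1 + real (v n) \<le> exp ((c1 + 1) * 1 * err_scale n)"
      using block_counts_times_le(1)[OF t, of 1] exp_ge_add_one_self[of "(c1 + 1) * 1 * err_scale n"] by linarith
    moreover have "8 \<le> exp (8 * err_scale n)" using W(3) by (intro le_exp_self) simp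
    moreover have "16 ^ v n \<le> exp ((c1 + 1) * ln 16 * err_scale n)" using block_counts_times_le(1)[OF t, of "ln 16"] by (simp add: power_eq_exp)
    ultimately have "8 * real (deg \<delta> n) * (1 + real (v n)) * 8 * 16 ^ v n
      \<le> exp ((\<delta> + 1) * 8 * err_scale n + (c1 + 1) * 1 * err_scale n + 8 * err_scale n + (c1 + 1) * ln 16 * err_scale n)"
      by (intro exp_le_mult) auto
    also have "\<dots> \<le> exp (\<sigma> * tl n)" using elim(1) by (simp add: distrib_right)
    finally show ?case by (simp add: field_simps)
  qed
qed

text \<open>This rests on \<kappa> > 1/\<delta>: the logarithm of C is then of order t^2 l, whereas
  that of R is only of order t l.\<close>

lemma eventually_large_C:
  "\<forall>\<^sub>F n in sequentially. (32 * real (deg \<delta> n + 1) + 8) * (exp (\<sigma> * tl n) / 2)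
      \<le> 4 * exp ((\<kappa> - 1 / \<delta>) * (tscale n * tl n))"
proof -
  have "\<forall>\<^sub>F n in sequentially. ((\<delta> + 1) * 32 + 40) * err_scale n \<le> 1 * tl n" by (intro eventually_err_scale) auto
  then show ?thesis using eventually_basic[of 1] eventually_basic[of "(\<sigma> + 1) / (\<kappa> - 1 / \<delta>)"]
  proof eventually_elim
    case (elim n)
    then have t: "tscale n \<ge> 1" "loglog n \<ge> 1" "(\<sigma> + 1) / (\<kappa> - 1 / \<delta>) \<le> tscale n" by auto
    note W = err_scale_bounds[OF t(1,2)]
    have "32 * real (deg \<delta> n + 1) + 8 \<le> exp (1 * tl n)"
    proof (rule le_exp_self)
      have "32 * real (deg \<delta> n + 1) + 8 = real (deg \<delta> n) * 32 + 40" by simp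
      also have "\<dots> \<le> (\<delta> + 1) * 32 * err_scale n + 40 * err_scale n" using block_counts_times_le(3)[OF t(1,2), of 32] W(3) by linarith
      also have "\<dots> \<le> 1 * tl n" using elim(1) by (simp add: distrib_right)
      finally show "32 * real (deg \<delta> n + 1) + 8 \<le> 1 * tl n" .
    qed
    then have "(32 * real (deg \<delta> n + 1) + 8) * exp (\<sigma> * tl n) \<le> exp (1 * tl n + \<sigma> * tl n)"
      by (intro exp_le_mult) auto
    also have "\<dots> \<le> exp ((\<kappa> - 1 / \<delta>) * (tscale n * tl n))"
    proof -
      have "\<sigma> + 1 \<le> (\<kappa> - 1 / \<delta>) * tscale n" using t(3) kd by (simp add: pos_divide_le_eq mult.commute)
      then have "(\<sigma> + 1) * tl n \<le> (\<kappa> - 1 / \<delta>) * tscale n * tl n" using t by (intro mult_right_mono) auto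
      then show ?thesis by (simp add: algebra_simps)
    qed
    finally have "(32 * real (deg \<delta> n + 1) + 8) * (exp (\<sigma> * tl n) / 2) \<le> exp ((\<kappa> - 1 / \<delta>) * (tscale n * tl n)) / 2"
      by simp
    also have "\<dots> \<le> 4 * exp ((\<kappa> - 1 / \<delta>) * (tscale n * tl n))" by simp
    finally show ?case .
  qed
qed

lemma eventually_large_M:
  "\<forall>\<^sub>F n in sequentially. 6 * real (deg \<delta> n) + 4 \<le> exp (1 / \<delta> * (tscale n * tl n))"
proof -
  have "\<forall>\<^sub>F n in sequentially. ((\<delta> + 1) * 6 + 4) * err_scale n \<le> 1 / \<delta> * tl n" using pos by (intro eventually_err_scale) auto
  then show ?thesis using eventually_basic[of 1]
  proof eventually_elim
    case (elim n)
    then have t: "tscale n \<ge> 1" "loglog n \<ge> 1" by auto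
    note W = err_scale_bounds[OF t]
    have "6 * real (deg \<delta> n) + 4 \<le> (\<delta> + 1) * 6 * err_scale n + 4 * err_scale n" using block_counts_times_le(3)[OF t, of 6] W(3) by linarith
    also have "\<dots> \<le> 1 / \<delta> * (1 * tl n)" using elim(1) by (simp add: distrib_right)
    also have "\<dots> \<le> 1 / \<delta> * (tscale n * tl n)" using t pos by (intro mult_left_mono mult_right_mono) auto
    finally show ?case by (rule le_exp_self)
  qed
qed

lemma eventually_large_L:
  "\<forall>\<^sub>F n in sequentially. z0 \<le> exp (\<beta> * tl n) powr (1 - 5 * \<eta>) \<and> 2 * real (v n) \<le> exp (\<beta> * tl n) powr (1 - 5 * \<eta>)
     \<and> 1 \<le> \<beta> * tl n"
proof -
  have e: "(1 - 5 * \<eta>) * \<beta> > 0" using pos eta by simp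
  have "\<forall>\<^sub>F n in sequentially. \<bar>z0\<bar> * err_scale n \<le> (1 - 5 * \<eta>) * \<beta> * tl n" by (rule eventually_err_scale[OF e])
  then show ?thesis using eventually_err_scale[OF e, of "(c1 + 1) * 2"] eventually_err_scale[OF pos(3), of 1] eventually_basic[of 1]
  proof eventually_elim
    case (elim n)
    then have t: "tscale n \<ge> 1" "loglog n \<ge> 1" by auto
    note W = err_scale_bounds[OF t]
    have x: "exp (\<beta> * tl n) powr (1 - 5 * \<eta>) = exp ((1 - 5 * \<eta>) * \<beta> * tl n)" by (simp add: powr_def mult.assoc)
    have "z0 \<le> \<bar>z0\<bar> * err_scale n" using mult_left_mono[OF W(3), of "\<bar>z0\<bar>"] by simp
    then have "z0 \<le> exp ((1 - 5 * \<eta>) * \<beta> * tl n)" using elim(1) by (intro le_exp_self) linarith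
    moreover have "2 * real (v n) \<le> exp ((1 - 5 * \<eta>) * \<beta> * tl n)"
      using block_counts_times_le(1)[OF t, of 2] elim(2) by (intro le_exp_self) simp
    moreover have "1 \<le> \<beta> * tl n" using elim(3) W(3) by simp
    ultimately show ?case unfolding x by blast
  qed
qed

text \<open>There are N = 2 v + u primes, v in the modulus and v + u in the value, and each costs q
  = log(160 log y) = l/3 + O(1 + log l). As N is about (2 c1 + c2) t, this is the exponent; all
  other factors are exp(O(\<open>err_scale n\<close>)).\<close>

lemma eventually_value:
  assumes "\<epsilon> > 0"
  shows "\<forall>\<^sub>F n in sequentially. exp ((2 * \<sigma> - (2 * c1 + c2) / 3 - \<epsilon>) * tl n)
    \<le> (1 / (160 * (\<beta> * tl n))) ^ (2 * v n + u n) * (exp (\<sigma> * tl n) / 2) ^ 2 / 16 ^ v n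
        / (65536 * real (v n) * real (deg \<delta> n) * 48 ^ deg \<delta> n)"
proof -
  define c3 where "c3 = 2 * c1 + c2 + 3"
  have c3: "c3 \<ge> 0" using cpos by (simp add: c3_def)
  have "\<forall>\<^sub>F n in sequentially. (c3 * lc + 1 + c3 + 2 + (c1 + 1) * ln 16 + 65536 + (c1 + 1) * 1 + (\<delta> + 1) * 1 + (\<delta> + 1) * ln 48) * err_scale n \<le> \<epsilon> * tl n"
    using assms by (intro eventually_err_scale) auto
  then show ?thesis using eventually_basic[of 1]
  proof eventually_elim
    case (elim n)
    then have t: "tscale n \<ge> 1" "loglog n \<ge> 1" by auto
    note W = err_scale_bounds[OF t] and V = v_bounds[OF t(1)] and U = u_bounds[OF t(1)] and D = d_bounds[OF t(1)]
    define N where "N = real (2 * v n + u n)"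
    define q where "q = ln (160 * (\<beta> * tl n))"
    have N: "0 \<le> N" "N \<le> (2 * c1 + c2) * tscale n + 3" "N \<le> c3 * tscale n"
      using V(2) U(2) t by (auto simp: N_def c3_def algebra_simps)
    have q: "q \<le> lc + loglog n / 3 + ln (loglog n)"
    proof -
      have "160 * (\<beta> * tl n) = (160 * \<beta>) * (tscale n * loglog n)" by simp
      then have "q = ln (160 * \<beta>) + (ln (tscale n) + ln (loglog n))"
        using t pos unfolding q_def by (simp only:) (subst ln_mult, auto simp: ln_mult)
      then show ?thesis using Lf_tscale(3)[OF t(2)] W(6) abs_ge_self[of "ln (160 * \<beta>)"] unfolding lc_def by argo
    qed
    have "N * q \<le> N * (lc + loglog n / 3 + ln (loglog n))" using q N(1) by (rule mult_left_mono)
    also have "\<dots> = N * lc + N * loglog n / 3 + N * ln (loglog n)" by (simp add: distrib_left)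
    also have "\<dots> \<le> c3 * lc * err_scale n + ((2 * c1 + c2) / 3 * tl n + 1 * err_scale n) + c3 * err_scale n"
    proof (intro add_mono)
      have "0 \<le> lc" by (simp add: lc_def)
      have "N * lc \<le> c3 * tscale n * lc" using N(3) \<open>0 \<le> lc\<close> by (rule mult_right_mono)
      also have "\<dots> \<le> c3 * err_scale n * lc" using W(1) c3 \<open>0 \<le> lc\<close> by (intro mult_right_mono mult_left_mono)
      finally show "N * lc \<le> c3 * lc * err_scale n" by (simp only: ac_simps)
      have "N * loglog n \<le> ((2 * c1 + c2) * tscale n + 3) * loglog n" using N(2) t by (intro mult_right_mono) auto
      then show "N * loglog n / 3 \<le> (2 * c1 + c2) / 3 * tl n + 1 * err_scale n" using W(2) by (simp add: field_simps)
      have "N * ln (loglog n) \<le> c3 * tscale n * ln (loglog n)" using N(3) W(6) by (rule mult_right_mono)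
      also have "\<dots> = c3 * (tscale n * ln (loglog n))" by simp
      also have "\<dots> \<le> c3 * err_scale n" using W(4) c3 by (rule mult_left_mono)
      finally show "N * ln (loglog n) \<le> c3 * err_scale n" .
    qed
    finally have Nq: "N * q \<le> c3 * lc * err_scale n + ((2 * c1 + c2) / 3 * tl n + 1 * err_scale n) + c3 * err_scale n" .
    have "160 * (\<beta> * tl n) = exp q" unfolding q_def using pos t by simp
    then have "(1 / (160 * (\<beta> * tl n))) ^ (2 * v n + u n) = exp (- q) ^ (2 * v n + u n)"
      by (simp add: exp_minus inverse_eq_divide)
    also have "\<dots> = exp (- (N * q))" by (simp add: N_def flip: exp_of_nat_mult)
    finally have f1: "(1 / (160 * (\<beta> * tl n))) ^ (2 * v n + u n) = exp (- (N * q))" .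
    have f2: "(exp (\<sigma> * tl n) / 2) ^ 2 = exp (2 * \<sigma> * tl n) / 4"
      by (simp add: power_divide exp_double[symmetric] mult.assoc)
    have "4 \<le> exp (2 * err_scale n)"
    proof -
      have "(1 + err_scale n) ^ 2 \<le> exp (err_scale n) ^ 2" using W(3) exp_ge_add_one_self by (intro power_mono) auto
      moreover have "(2::real) ^ 2 \<le> (1 + err_scale n) ^ 2" using W(3) by (intro power_mono) auto
      ultimately show ?thesis by (simp add: exp_double)
    qed
    moreover have "16 ^ v n \<le> exp ((c1 + 1) * ln 16 * err_scale n)" using block_counts_times_le(1)[OF t, of "ln 16"] by (simp add: power_eq_exp)
    moreover have "65536 \<le> exp (65536 * err_scale n)" using W(3) by (intro le_exp_self) simp
    moreover have "real (v n) \<le> exp ((c1 + 1) * 1 * err_scale n)" using block_counts_times_le(1)[OF t, of 1] by (intro le_exp_self) simp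
    moreover have "real (deg \<delta> n) \<le> exp ((\<delta> + 1) * 1 * err_scale n)" using block_counts_times_le(3)[OF t, of 1] by (intro le_exp_self) simp
    moreover have "48 ^ deg \<delta> n \<le> exp ((\<delta> + 1) * ln 48 * err_scale n)" using block_counts_times_le(3)[OF t, of "ln 48"] by (simp add: power_eq_exp)
    ultimately have den: "4 * 16 ^ v n * 65536 * real (v n) * real (deg \<delta> n) * 48 ^ deg \<delta> n
      \<le> exp (2 * err_scale n + (c1 + 1) * ln 16 * err_scale n + 65536 * err_scale n + (c1 + 1) * 1 * err_scale n + (\<delta> + 1) * 1 * err_scale n + (\<delta> + 1) * ln 48 * err_scale n)"
      by (intro exp_le_mult) simp_all
    define E where "E = 2 * err_scale n + (c1 + 1) * ln 16 * err_scale n + 65536 * err_scale n + (c1 + 1) * 1 * err_scale n + (\<delta> + 1) * 1 * err_scale n + (\<delta> + 1) * ln 48 * err_scale n"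
    define Q where "Q = 4 * 16 ^ v n * 65536 * real (v n) * real (deg \<delta> n) * 48 ^ deg \<delta> n"
    define P where "P = exp (2 * \<sigma> * tl n - N * q)"
    have Q: "0 < Q" "Q \<le> exp E" using V(3) D(4) den by (simp_all add: Q_def E_def)
    have "(2 * \<sigma> - (2 * c1 + c2) / 3 - \<epsilon>) * tl n \<le> 2 * \<sigma> * tl n - N * q - E"
      using Nq elim(1) unfolding E_def left_diff_distrib distrib_right by linarith
    then have "exp ((2 * \<sigma> - (2 * c1 + c2) / 3 - \<epsilon>) * tl n) \<le> exp (2 * \<sigma> * tl n - N * q - E)"
      by (simp only: exp_le_cancel_iff)
    also have "\<dots> = P / exp E" unfolding P_def by (rule exp_diff)
    also have "\<dots> \<le> P / Q" using Q by (intro divide_left_mono mult_pos_pos) (simp_all add: P_def)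
    also have "P = exp (- (N * q)) * exp (2 * \<sigma> * tl n)" unfolding P_def exp_add[symmetric] by (simp only: uminus_add_conv_diff)
    also have "exp (- (N * q)) * exp (2 * \<sigma> * tl n) / Q
      = exp (- (N * q)) * (exp (2 * \<sigma> * tl n) / 4) / 16 ^ v n / (65536 * real (v n) * real (deg \<delta> n) * 48 ^ deg \<delta> n)"
    proof -
      have "a * b / (4 * c * 65536 * w * d * k) = a * (b / 4) / c / (65536 * w * d * k)" for a b c w d k :: real
        by simp
      then show ?thesis unfolding Q_def by blast
    qed
    finally show ?case unfolding f1 f2 .
  qed
qed

lemma eventually_expectX_ge:
  assumes "\<epsilon> > 0"
  shows "\<forall>\<^sub>F n in sequentially. Lf (real n) (1/3) (2 * \<sigma> - (2 * c1 + c2) / 3 - \<epsilon>) \<le> expectX n \<delta> \<kappa> \<sigma> \<beta> \<beta>"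
proof -
  obtain z1 where z1: "\<And>z. z \<ge> z1 \<Longrightarrow> z / (10 * ln z) \<le> real (card {p::nat. prime p \<and> z / 16 < real p \<and> real p \<le> z})"
    using many_primes_in_interval unfolding eventually_at_top_linorder by blast
  define z0 where "z0 = max 2 z1"
  have z0: "z0 \<ge> 2" "\<And>z. z \<ge> z0 \<Longrightarrow> z / (10 * ln z) \<le> real (card (prime_block z))"
    using z1 by (auto simp: z0_def prime_block_def)
  show ?thesis
    using eventually_value[OF assms] eventually_scale_upper eventually_scale_lower eventually_second_scale eventually_block_ratio eventually_bad_proportion eventually_many_b
      eventually_large_C eventually_large_M eventually_large_L[of z0] eventually_basic[of 1]
  proof eventually_elim
    case (elim n)
    then have t: "tscale n \<ge> 1" "loglog n \<ge> 1" by auto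
    note V = v_bounds[OF t(1)] and U = u_bounds[OF t(1)] and D = d_bounds[OF t(1)] and Lf = Lf_tscale(1,2)[OF t(2)]
    have tl1: "tl n \<ge> 1" using mult_mono[of 1 "tscale n" 1 "loglog n"] t by simp
    have L_le: "160 * ln (exp (\<beta> * tl n)) * exp (\<beta> * tl n) powr (1 - 5 * \<eta>)
        = exp (ln (160 * (\<beta> * tl n)) + (1 - 5 * \<eta>) * (\<beta> * tl n))"
      using pos tl1 by (simp add: exp_add powr_def)
    have RM: "exp (\<sigma> * tl n) / 2 * exp (1 / \<delta> * (tscale n * tl n)) / 2
        = exp (\<sigma> * tl n + (tscale n * tl n) / \<delta> - 2 * ln 2)"
    proof -
      have "exp (2 * ln 2) = (4::real)" by (simp add: exp_double)
      then show ?thesis by (simp add: exp_add exp_diff)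
    qed
    \<comment> \<open>\<open>yl\<close> was obtained by solving this equation for the first top: the
      mean logarithm per block plus the mean decay ln 256 * (v - 1) / 2.\<close>
    have vy: "(\<Prod>i<v n. exp (yl n) / 256 ^ i) = exp (\<sigma> * tl n) / 2 * exp (1 / \<delta> * (tscale n * tl n)) / 2"
    proof -
      have "real (v n) * yl n - ln 256 * (real (v n) * (real (v n) - 1) / 2)
          = \<sigma> * tl n + (tscale n * tl n) / \<delta> - 2 * ln 2"
        using V(3) by (simp add: yl_def distrib_left)
      then show ?thesis unfolding RM by (subst prod_exp_div_power) auto
    qed
    have pow: "exp (a - real k * ln c) = exp a / c ^ k" if "c > 0" for a c :: real and k
      using that by (simp add: exp_diff power_eq_exp)
    have zq: "(\<Prod>i<u n. exp (zl n j) / 16 ^ i) = exp (ql n j)" for j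
    proof -
      have "real (u n) * zl n j - ln 16 * (real (u n) * (real (u n) - 1) / 2) = ql n j"
        using U(3) by (simp add: zl_def distrib_left)
      then show ?thesis by (subst prod_exp_div_power) auto
    qed
    have ql: "exp (ql n j) = exp ((\<kappa> - 1 / \<delta>) * (tscale n * tl n)) / 2 ^ j
        * (exp (\<sigma> * tl n) / 2 / (4 * 2 ^ j)) ^ (deg \<delta> n - 1) / 64" for j
    proof -
      \<comment> \<open>The 3 in \<open>j + 3\<close> combines the 1/2 contained in R with the 4 of
        R / (4 * 2^j).\<close>
      have a: "exp (\<sigma> * tl n - (real j + 3) * ln 2) = exp (\<sigma> * tl n) / 2 / (4 * 2 ^ j)"
        using pow[of 2 "\<sigma> * tl n" "j + 3"] by (simp add: power_add)
      have b: "exp (6 * ln 2) = (64::real)" using power_eq_exp[of 2 6] by simp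
      have "exp (ql n j) = exp ((\<kappa> - 1 / \<delta>) * (tscale n * tl n) - real j * ln 2)
          * exp (\<sigma> * tl n - (real j + 3) * ln 2) ^ (deg \<delta> n - 1) / exp (6 * ln 2)"
        by (simp only: ql_def exp_diff exp_add exp_of_nat_mult)
      then show ?thesis unfolding a b using pow[of 2 "(\<kappa> - 1 / \<delta>) * (tscale n * tl n)" j] by simp
    qed
    have "(1 / (160 * ln (Lf (real n) (1/3) \<beta>))) ^ (2 * v n + u n) * (Lf (real n) (1/3) \<sigma> / 2) ^ 2 / 16 ^ v n
        / (65536 * real (v n) * real (deg \<delta> n) * 48 ^ deg \<delta> n) \<le> expectX n \<delta> \<kappa> \<sigma> \<beta> \<beta>"
    proof (rule expectX_ge[where h = "5 * \<eta>" and Y = "exp (yl n)", OF z0], unfold Lf)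
      show "0 < deg \<delta> n" "0 < v n" by (rule D V)+
      show "1 \<le> ln (exp (\<beta> * tl n))" "z0 \<le> exp (\<beta> * tl n) powr (1 - 5 * \<eta>)"
        "2 * real (v n) \<le> exp (\<beta> * tl n) powr (1 - 5 * \<eta>)" using elim by auto
      show "(\<Prod>i<v n. exp (yl n) / 256 ^ i) = exp (\<sigma> * tl n) / 2 * exp (1 / \<delta> * (tscale n * tl n)) / 2" by (rule vy)
      show "0 < exp (yl n)" "exp (yl n) \<le> exp (\<beta> * tl n)" using elim by auto
      show "160 * ln (exp (\<beta> * tl n)) * exp (\<beta> * tl n) powr (1 - 5 * \<eta>) \<le> exp (yl n) / 256 ^ v n"
        unfolding L_le using elim pow[of 256 "yl n" "v n"] by (metis exp_le_cancel_iff zero_less_numeral)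
      show "0 \<le> 5 * \<eta>" "5 * \<eta> \<le> 1 / 6" using pos eta by auto
      show "2 * real (v n) + 6 * (5 * \<eta>) * real (v n) + 2 \<le> real (v n + u n)" using elim by blast
      show "32 * real (v n) * 4 ^ v n * (2 + 4 * harm (nat \<lfloor>exp (\<beta> * tl n)\<rfloor> ^ (2 * v n))) \<le> exp (\<beta> * tl n) powr (1 / 2)"
        using elim by blast
      show "8 * real (deg \<delta> n) * (1 + real (v n)) \<le> exp (\<sigma> * tl n) / 2 / (4 * 16 ^ v n)" using elim by blast
      show "(32 * real (deg \<delta> n + 1) + 8) * (exp (\<sigma> * tl n) / 2) \<le> 4 * exp ((\<kappa> - 1 / \<delta>) * (tscale n * tl n))"
        using elim by blast
      show "6 * real (deg \<delta> n) + 4 \<le> exp (1 / \<delta> * (tscale n * tl n))" using elim by blast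
      show "1 \<le> exp ((\<kappa> - 1 / \<delta>) * (tscale n * tl n))" using kd t by simp
      fix j assume j: "j < 4 * v n"
      have z: "zl n j \<le> yl n - real (v n) * ln 256"
        "ln (160 * (\<beta> * tl n)) + (1 - 5 * \<eta>) * (\<beta> * tl n) \<le> zl n j - real (u n) * ln 16"
        using elim j by blast+
      show "\<exists>Y'>0. (\<Prod>i<u n. Y' / 16 ^ i) * (exp (\<sigma> * tl n) / 2 * exp (1 / \<delta> * (tscale n * tl n)) / 2)
          = exp ((\<kappa> - 1 / \<delta>) * (tscale n * tl n)) * (exp (\<sigma> * tl n) / 2 * exp (1 / \<delta> * (tscale n * tl n)) / 2 / 2 ^ j)
            * (exp (\<sigma> * tl n) / 2 / (4 * 2 ^ j)) ^ (deg \<delta> n - 1) / 64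
        \<and> Y' \<le> exp (yl n) / 256 ^ v n
        \<and> 160 * ln (exp (\<beta> * tl n)) * exp (\<beta> * tl n) powr (1 - 5 * \<eta>) \<le> Y' / 16 ^ u n"
      proof (intro exI[of _ "exp (zl n j)"] conjI)
        show "exp (zl n j) \<le> exp (yl n) / 256 ^ v n"
          using z(1) pow[of 256 "yl n" "v n"] by (metis exp_le_cancel_iff zero_less_numeral)
        show "160 * ln (exp (\<beta> * tl n)) * exp (\<beta> * tl n) powr (1 - 5 * \<eta>) \<le> exp (zl n j) / 16 ^ u n"
          unfolding L_le using z(2) pow[of 16 "zl n j" "u n"] by (metis exp_le_cancel_iff zero_less_numeral)
        show "(\<Prod>i<u n. exp (zl n j) / 16 ^ i) * (exp (\<sigma> * tl n) / 2 * exp (1 / \<delta> * (tscale n * tl n)) / 2)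
          = exp ((\<kappa> - 1 / \<delta>) * (tscale n * tl n)) * (exp (\<sigma> * tl n) / 2 * exp (1 / \<delta> * (tscale n * tl n)) / 2 / 2 ^ j)
            * (exp (\<sigma> * tl n) / 2 / (4 * 2 ^ j)) ^ (deg \<delta> n - 1) / 64"
          unfolding zq ql by (simp only: divide_inverse ac_simps)
      qed simp
    qed
    moreover have "Lf (real n) (1/3) (2 * \<sigma> - (2 * c1 + c2) / 3 - \<epsilon>)
      \<le> (1 / (160 * ln (Lf (real n) (1/3) \<beta>))) ^ (2 * v n + u n) * (Lf (real n) (1/3) \<sigma> / 2) ^ 2 / 16 ^ v n
        / (65536 * real (v n) * real (deg \<delta> n) * 48 ^ deg \<delta> n)"
      using elim(1) unfolding Lf by simp
    ultimately show ?case by linarith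
  qed
qed

end

text \<open>In 2 c1 + c2 the -1/\<delta> of \<Gamma> cancels one of the two copies of 1/\<delta>
  coming from c1, which leaves at most 3 (1 + 3 \<eta>) S. Half of e pays for the slack 3 \<eta> S,
  the other half for the error terms.\<close>

lemma eventually_expectX_ge_limit_exponent:
  fixes \<delta> \<kappa> \<sigma> \<beta> e :: real
  assumes pos: "\<delta> > 0" "\<sigma> > 0" "\<beta> > 0" and kd: "\<kappa> > 1 / \<delta>" and lev: "1 / \<delta> < (\<sigma> * \<delta> + \<kappa>) / 2" and e: "e > 0"
  shows "\<forall>\<^sub>F n in sequentially. Lf (real n) (1/3) (2 * \<sigma> - ((1 / \<delta>) / (3 * \<beta>) + (\<sigma> * \<delta> + \<kappa>) / (3 * \<beta>)) - e)
    \<le> expectX n \<delta> \<kappa> \<sigma> \<beta> \<beta>"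
proof -
  define S where "S = (1 / \<delta>) / (3 * \<beta>) + (\<sigma> * \<delta> + \<kappa>) / (3 * \<beta>)"
  define G where "G = \<delta> * (\<kappa> - 1 / \<delta> + \<sigma> * \<delta>)"
  have k0: "\<kappa> > 0" using pos kd by (smt (verit) zero_less_divide_1_iff)
  have S: "S > 0" unfolding S_def using pos k0 by (intro add_pos_pos divide_pos_pos mult_pos_pos) auto
  have G: "G > 1"
  proof -
    have "1 / \<delta> < \<kappa> - 1 / \<delta> + \<sigma> * \<delta>" using lev by simp
    then have "\<delta> * (1 / \<delta>) < G" unfolding G_def using pos by (intro mult_strict_left_mono)
    then show ?thesis using pos by simp
  qed
  \<comment> \<open>The three bounds give h = 5 \<eta> <= 1/6, the strict margin 1 + 30 \<eta> < G,
    and 3 \<eta> S <= e/2.\<close>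
  define \<eta> where "\<eta> = min (1 / 30) (min ((G - 1) / 31) (e / (6 * S)))"
  have "\<eta> > 0" using G S e by (simp add: \<eta>_def)
  moreover have "\<eta> \<le> 1 / 30" unfolding \<eta>_def by (rule min.cobounded1)
  moreover have "\<eta> \<le> (G - 1) / 31" unfolding \<eta>_def by (rule min.coboundedI2[OF min.cobounded1])
  moreover have "\<eta> \<le> e / (6 * S)" unfolding \<eta>_def by (rule min.coboundedI2[OF min.cobounded2])
  ultimately have small: "\<eta> > 0" "\<eta> \<le> 1 / 30" "\<eta> \<le> (G - 1) / 31" "\<eta> \<le> e / (6 * S)" by auto
  interpret sieve_params \<delta> \<kappa> \<sigma> \<beta> \<eta>
  proof
    show "1 + 30 * \<eta> < \<delta> * (\<kappa> - 1 / \<delta> + \<sigma> * \<delta>)" using small G unfolding G_def[symmetric] by simp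
  qed (use pos kd small in auto)
  have "c1 \<le> (1 + 3 * \<eta>) / (\<delta> * \<beta>)" unfolding c1_def using pos small by (intro divide_right_mono) auto
  then have "(2 * c1 + c2) / 3 \<le> (2 * ((1 + 3 * \<eta>) / (\<delta> * \<beta>)) + c2) / 3"
    by (intro divide_right_mono add_right_mono mult_left_mono) auto
  also have "\<dots> = (1 + 3 * \<eta>) * S" using pos by (simp add: c2_def \<Gamma>_def S_def field_simps)
  also have "\<dots> \<le> S + e / 2"
  proof -
    have "\<eta> * (6 * S) \<le> e" using small(4) S by (simp add: pos_le_divide_eq)
    then show ?thesis by (simp add: algebra_simps)
  qed
  finally have le: "2 * \<sigma> - S - e \<le> 2 * \<sigma> - (2 * c1 + c2) / 3 - e / 2" by argo
  have "e / 2 > 0" using e by simp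
  from eventually_expectX_ge[OF this] show ?thesis using eventually_basic[of 1]
  proof eventually_elim
    case (elim n)
    then have "tl n \<ge> 0" "loglog n \<ge> 1" by auto
    then have "Lf (real n) (1/3) (2 * \<sigma> - S - e) \<le> Lf (real n) (1/3) (2 * \<sigma> - (2 * c1 + c2) / 3 - e / 2)"
      using le by (simp add: Lf_tscale mult_right_mono)
    then show ?case using elim(1) by (simp only: S_def)
  qed
qed

theorem theorem5p16:
  fixes \<delta> \<kappa> \<sigma> \<beta> \<beta>' :: real
  assumes "\<delta> > 0" "\<kappa> > 0" "\<sigma> > 0" "\<beta> > 0" "\<beta>' > 0"
    and "\<beta> = \<beta>'"
    and "\<kappa> > 1 / \<delta>"
    and "1 / \<delta> < (\<sigma> * \<delta> + \<kappa>) / 2"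
    and "2 * \<sigma> > max \<beta> \<beta>' + (1 / \<delta>) / (3 * \<beta>) + (\<sigma> * \<delta> + \<kappa>) / (3 * \<beta>')"
  shows "\<exists>\<epsilon>1 \<epsilon>2 :: nat \<Rightarrow> real. \<epsilon>1 \<longlonglongrightarrow> 0 \<and> \<epsilon>2 \<longlonglongrightarrow> 0 \<and>
    (\<forall>\<^sub>F n in sequentially.
       expectX n \<delta> \<kappa> \<sigma> \<beta> \<beta>' \<ge>
       Lf (real n) (1/3) (2 * \<sigma> - (1 / \<delta>) / (3 * \<beta>) * (1 + \<epsilon>1 n)
                                 - (\<sigma> * \<delta> + \<kappa>) / (3 * \<beta>') * (1 + \<epsilon>2 n)))"
proof -
  define A where "A = (1 / \<delta>) / (3 * \<beta>)"
  define B where "B = (\<sigma> * \<delta> + \<kappa>) / (3 * \<beta>)"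
  define X where "X n = expectX n \<delta> \<kappa> \<sigma> \<beta> \<beta>" for n
  have A: "A > 0" using assms by (simp add: A_def)
  \<comment> \<open>The error term is the actual shortfall of the exponent, so the inequality holds
    by construction wherever \<open>X n\<close> is positive, and what remains is convergence to 0.
    The maximum with 0 settles the lower side of that limit. The whole shortfall is put on the first
    term and the second error is 0.\<close>
  define \<epsilon> where "\<epsilon> n = max 0 ((2 * \<sigma> - A - B - ln (X n) / (tscale n * loglog n)) / A)" for n
  have ev: "\<forall>\<^sub>F n in sequentially. Lf (real n) (1/3) (2 * \<sigma> - (A + B) - e) \<le> X n" if "e > 0" for e
    using eventually_expectX_ge_limit_exponent[OF assms(1,3,4,7,8) that] by (simp add: A_def B_def X_def)
  have lnX: "\<forall>\<^sub>F n in sequentially. 0 < X n \<and> 2 * \<sigma> - (A + B) - e \<le> ln (X n) / (tscale n * loglog n)" if "e > 0" for e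
    using ev[OF that] eventually_basic[of 1]
  proof eventually_elim
    case (elim n)
    then have t: "tscale n * loglog n > 0" "loglog n \<ge> 1" by (auto intro: mult_pos_pos)
    have le: "exp ((2 * \<sigma> - (A + B) - e) * (tscale n * loglog n)) \<le> X n" using elim(1) by (simp add: Lf_tscale t)
    then have "0 < X n" using exp_gt_zero by (rule less_le_trans[rotated])
    moreover have "(2 * \<sigma> - (A + B) - e) * (tscale n * loglog n) \<le> ln (X n)" using le \<open>0 < X n\<close> by (simp add: ln_ge_iff)
    ultimately show ?case using t by (simp add: pos_le_divide_eq)
  qed
  have lim: "\<epsilon> \<longlonglongrightarrow> 0"
  proof (rule order_tendstoI)
    fix a :: real assume "a < 0"
    then show "\<forall>\<^sub>F n in sequentially. a < \<epsilon> n" by (intro always_eventually) (auto simp: \<epsilon>_def less_max_iff_disj)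
  next
    fix a :: real assume a: "0 < a"
    then have "a * A / 2 > 0" using A by simp
    from lnX[OF this] show "\<forall>\<^sub>F n in sequentially. \<epsilon> n < a"
    proof eventually_elim
      case (elim n)
      then have "2 * \<sigma> - A - B - ln (X n) / (tscale n * loglog n) \<le> a * A / 2" by simp
      also have "\<dots> < a * A" using a A by simp
      finally show ?case using a A by (simp add: \<epsilon>_def pos_divide_less_eq)
    qed
  qed
  have "\<forall>\<^sub>F n in sequentially. Lf (real n) (1/3) (2 * \<sigma> - A * (1 + \<epsilon> n) - B * (1 + 0)) \<le> X n"
    using lnX[OF zero_less_one] eventually_basic[of 1]
  proof eventually_elim
    case (elim n)
    then have t: "tscale n * loglog n > 0" "loglog n \<ge> 1" by (auto intro: mult_pos_pos)
    have "(2 * \<sigma> - A - B - ln (X n) / (tscale n * loglog n)) / A \<le> \<epsilon> n" by (simp add: \<epsilon>_def)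
    then have "2 * \<sigma> - A - B - ln (X n) / (tscale n * loglog n) \<le> \<epsilon> n * A" using A by (simp add: pos_divide_le_eq)
    then have "2 * \<sigma> - A * (1 + \<epsilon> n) - B * (1 + 0) \<le> ln (X n) / (tscale n * loglog n)" by (simp add: algebra_simps)
    then have "(2 * \<sigma> - A * (1 + \<epsilon> n) - B * (1 + 0)) * (tscale n * loglog n) \<le> ln (X n)" using t by (simp add: pos_le_divide_eq)
    then show ?case using elim(1) by (simp only: Lf_tscale t) (simp add: ln_ge_iff)
  qed
  then show ?thesis using lim assms(6) unfolding A_def B_def X_def
    by (intro exI[of _ \<epsilon>] exI[of _ "\<lambda>_. 0"]) auto
qed

end
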